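(* Let $\mathfrak g$ be a complex Lie superalgebra with an involution $\theta$, let $\mathfrak g=\mathfrak k\oplus\mathfrak p$ be the decomposition into the $\pm1$ eigenspaces of $\theta$, and assume there is a subalgebra $\mathfrak h\subseteq\mathfrak g_{\bar 0}$ such that: (i) $\theta(\mathfrak h)=\mathfrak h$, so that $\mathfrak h=\mathfrak t\oplus\mathfrak a$ with $\mathfrak t:=\mathfrak h\cap\mathfrak k$ and $\mathfrak a:=\mathfrak h\cap\mathfrak p$; (ii) the operators $\mathrm{ad}_x\in\mathrm{End}(\mathfrak g)$, $x\in\mathfrak h$, are simultaneously diagonalizable; (iii) $C_{\mathfrak g}(\mathfrak h)=\mathfrak h$ and $C_{\mathfrak p}(\mathfrak a)=\mathfrak a$. Then the map $(\mathsf q\circ\overline{\mathsf s})^*:\mathcal A(\mathfrak g,\mathfrak k)\to S(\mathfrak a)^*$, dual to $\mathsf q\circ\overline{\mathsf s}:S(\mathfrak a)\to U(\mathfrak g)/\mathcal I$, is an embedding (injective homomorphism) of commutative algebras. It restricts to an embedding $\mathcal A(\mathfrak g,\mathfrak k)^\circ\to S(\mathfrak a)^\circ$.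
   Context: The base field is $\mathbb C$. $U(\mathfrak g)$ is the universal enveloping algebra, a Hopf superalgebra with coproduct $\Delta(x)=1\otimes x+x\otimes 1$, antipode $S(x)=-x$ and counit $\varepsilon(x)=0$ for $x\in\mathfrak g$. The parity of a homogeneous element is $|\cdot|$. The dual $U(\mathfrak g)^*$ is an associative algebra with product $\phi\psi(x)=\sum(-1)^{|x_1||\psi|}\phi(x_1)\psi(x_2)$, where $\Delta(x)=\sum x_1\otimes x_2$. Here $C_{\mathfrak b}(\mathfrak c)=\{x\in\mathfrak b: [x,y]=0\ \text{for all } y\in\mathfrak c\}$. Put $\mathcal I:=\mathfrak kU(\mathfrak g)+U(\mathfrak g)\mathfrak k$ and $\mathcal I_L:=U(\mathfrak g)\mathfrak k\subseteq\mathcal I$. $\mathcal A(\mathfrak g,\mathfrak k)$ is the subalgebra of $U(\mathfrak g)^*$ of all $\lambda$ with $\mathcal I\subseteq\ker\lambda$; it is identified with $(U(\mathfrak g)/\mathcal I)^*$. The super-symmetrization map $\mathsf s:S(\mathfrak p)\to U(\mathfrak g)$ is $x_1\cdots x_r\mapsto\frac1{r!}\sum_{\pi\in S_r}\mathrm{sgn}(\pi;x)\,x_{\pi(1)}\cdots x_{\pi(r)}$ for homogeneous $x_i\in\mathfrak p$, where $\mathrm{sgn}(\pi;x)$ is the sign of the permutation induced by $\pi$ on the odd vectors among $x_1,\dots,x_r$; $S(\mathfrak p)$ is the supersymmetric algebra. $\overline{\mathsf s}$ is the composition of $\mathsf s$ with $U(\mathfrak g)\to U(\mathfrak g)/\mathcal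 I_L$, considered here as a map with domain $S(\mathfrak a)\subseteq S(\mathfrak p)$, and $\mathsf q:U(\mathfrak g)/\mathcal I_L\to U(\mathfrak g)/\mathcal I$ is the natural quotient map. Thus $(\mathsf q\circ\overline{\mathsf s})^*(\lambda)=\lambda\circ\mathsf s|_{S(\mathfrak a)}$. $S(\mathfrak a)$ is canonically isomorphic to $U(\mathfrak a)$, hence a Hopf algebra, and $S(\mathfrak a)^*$ has the algebra structure dual to its coproduct. For a Hopf (super)algebra $H$, $H^\circ\subseteq H^*$ is the set of $\lambda\in H^*$ whose kernel contains a two-sided ideal of finite codimension. $\mathcal A(\mathfrak g,\mathfrak k)^\circ:=\mathcal A(\mathfrak g,\mathfrak k)\cap U(\mathfrak g)^\circ$. *)

theory Defs
  imports
    Complex_Main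
    "HOL-Library.Poly_Mapping"
    "HOL-Library.FuncSet"
    "HOL-Library.Z2"
    "HOL-Combinatorics.Permutations"
    "HOL-Algebra.QuotRing"
    "HOL-Algebra.Module"
    "HOL-Algebra.Generated_Groups"
begin

section \<open>Complex Lie superalgebras\<close>

text \<open>Parities live in \<^typ>\<open>bit\<close>, the field with two elements.\<close>

definition parity_sign :: "bit \<Rightarrow> complex" where
  "parity_sign i = (if i = 0 then 1 else - 1)"

text \<open>The whole type \<open>'g\<close> is the underlying space. It may have any dimension.\<close>

record 'g lie_super =
  scale :: "complex \<Rightarrow> 'g \<Rightarrow> 'g"
  part :: "bit \<Rightarrow> 'g set"
  bracket :: "'g \<Rightarrow> 'g \<Rightarrow> 'g"

definition linear_map ::
    "'g::ab_group_add lie_super \<Rightarrow> ('g \<Rightarrow> 'g) \<Rightarrow> bool" where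
  "linear_map L f \<longleftrightarrow> Vector_Spaces.linear (scale L) (scale L) f"

definition linear_subspace :: "'g::ab_group_add lie_super \<Rightarrow> 'g set \<Rightarrow> bool" where
  "linear_subspace L V \<longleftrightarrow> Modules.module.subspace (scale L) V"

definition linear_basis :: "'g::ab_group_add lie_super \<Rightarrow> 'g set \<Rightarrow> bool" where
  "linear_basis L B \<longleftrightarrow>
     \<not> Modules.module.dependent (scale L) B \<and> Modules.module.span (scale L) B = UNIV"

locale lie_superalgebra =
  fixes L :: "'g::ab_group_add lie_super"
  assumes vector_space: "vector_space (scale L)"
    and subspace_part: "linear_subspace L (part L i)"
    and part_decomposition: "\<exists>!p. fst p \<in> part L 0 \<and> snd p \<in> part L 1 \<and> x = fst p + snd p"
    and linear_right: "linear_map L (\<lambda>y. bracket L x y)"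
    and linear_left: "linear_map L (\<lambda>x. bracket L x y)"
    and graded: "x \<in> part L i \<Longrightarrow> y \<in> part L j \<Longrightarrow> bracket L x y \<in> part L (i + j)"
    and super_antisym: "x \<in> part L i \<Longrightarrow> y \<in> part L j \<Longrightarrow>
      bracket L x y = - scale L (parity_sign (i * j)) (bracket L y x)"
    and super_jacobi: "x \<in> part L i \<Longrightarrow> y \<in> part L j \<Longrightarrow>
      bracket L x (bracket L y z) =
        bracket L (bracket L x y) z
        + scale L (parity_sign (i * j)) (bracket L y (bracket L x z))"

definition lie_involution ::
    "'g::ab_group_add lie_super \<Rightarrow> ('g \<Rightarrow> 'g) \<Rightarrow> bool" where
  "lie_involution L \<theta> \<longleftrightarrow>
     linear_map L \<theta> \<and>
     (\<forall>i. \<theta> ` part L i \<subseteq> part L i) \<and>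
     (\<forall>x y. \<theta> (bracket L x y) = bracket L (\<theta> x) (\<theta> y)) \<and>
     (\<forall>x. \<theta> (\<theta> x) = x)"

definition lie_subalgebra :: "'g::ab_group_add lie_super \<Rightarrow> 'g set \<Rightarrow> bool" where
  "lie_subalgebra L H \<longleftrightarrow>
     linear_subspace L H \<and> (\<forall>x\<in>H. \<forall>y\<in>H. bracket L x y \<in> H)"

definition centralizer_in ::
    "'g::ab_group_add lie_super \<Rightarrow> 'g set \<Rightarrow> 'g set \<Rightarrow> 'g set" where
  "centralizer_in L B C = {x \<in> B. \<forall>y\<in>C. bracket L x y = 0}"

definition ad_diagonalizable ::
    "'g::ab_group_add lie_super \<Rightarrow> 'g set \<Rightarrow> bool" where
  "ad_diagonalizable L H \<longleftrightarrow>
     (\<exists>B. linear_basis L B \<and>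
        (\<forall>x\<in>H. \<forall>b\<in>B. \<exists>c. bracket L x b = scale L c b))"

section \<open>Free and quotient algebras\<close>

text \<open>Words form the free monoid, written additively as required by the convolution
  product of \<^typ>\<open>'a \<Rightarrow>\<^sub>0 'b\<close>. So \<^typ>\<open>'l list \<Rightarrow>\<^sub>0 complex\<close> is the
  free associative algebra on \<open>'l\<close>.\<close>

instantiation list :: (type) monoid_add
begin
definition zero_list :: "'a list" where "zero_list = []"
definition plus_list :: "'a list \<Rightarrow> 'a list \<Rightarrow> 'a list" where "plus_list = (@)"
instance by standard (simp_all add: zero_list_def plus_list_def)
end

definition complex_field :: "complex ring" where
  "complex_field = \<lparr>carrier = UNIV, mult = (*), one = 1, zero = 0, add = (+)\<rparr>"

definition free_smult :: "complex \<Rightarrow> ('a \<Rightarrow>\<^sub>0 complex) \<Rightarrow> ('a \<Rightarrow>\<^sub>0 complex)" where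
  "free_smult c f = Poly_Mapping.map ((*) c) f"

definition free_algebra :: "'l set \<Rightarrow> (complex, 'l list \<Rightarrow>\<^sub>0 complex) module" where
  "free_algebra S =
     \<lparr>carrier = {f. Poly_Mapping.keys f \<subseteq> lists S}, mult = (*), one = 1, zero = 0, add = (+),
      smult = free_smult\<rparr>"

text \<open>The quotient ring, with scalars acting on cosets.\<close>

definition quotient_algebra ::
    "(complex, 'x) module \<Rightarrow> 'x set \<Rightarrow> (complex, 'x set) module" where
  "quotient_algebra A J =
     \<lparr>carrier = carrier (A Quot J), mult = mult (A Quot J), one = one (A Quot J),
      zero = zero (A Quot J), add = add (A Quot J),
      smult = (\<lambda>c X. \<Union>x\<in>X. J +>\<^bsub>A\<^esub> (c \<odot>\<^bsub>A\<^esub> x))\<rparr>"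

definition coset_rep :: "'x set \<Rightarrow> 'x" where
  "coset_rep X = (SOME x. x \<in> X)"

section \<open>Enveloping and supersymmetric algebras\<close>

text \<open>The letter \<open>(i, x)\<close> stands for the homogeneous vector \<open>x\<close> of parity \<open>i\<close>. The tags
  keep the zero vectors of the two parities apart; the relations below identify both with 0.\<close>

type_synonym 'g word = "(bit \<times> 'g) list"
type_synonym 'g free = "'g word \<Rightarrow>\<^sub>0 complex"

definition letters :: "'g lie_super \<Rightarrow> 'g set \<Rightarrow> (bit \<times> 'g) set" where
  "letters L V = {(i, x). x \<in> V \<inter> part L i}"

definition word_parity :: "'g word \<Rightarrow> bit" where
  "word_parity w = sum_list (map fst w)"

definition generator :: "bit \<Rightarrow> 'g \<Rightarrow> 'g free" where
  "generator i x = Poly_Mapping.single [(i, x)] 1"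

text \<open>Here \<open>V\<close> is a graded subspace and \<open>b\<close> a bracket on it. The first two families of
  relations turn the free algebra on the letters into the tensor algebra of \<open>V\<close>; the third
  imposes the supercommutators.\<close>

definition env_relations ::
    "'g::ab_group_add lie_super \<Rightarrow> 'g set \<Rightarrow> ('g \<Rightarrow> 'g \<Rightarrow> 'g) \<Rightarrow> 'g free set" where
  "env_relations L V b =
     {generator i (x + y) - (generator i x + generator i y) | i x y.
        x \<in> V \<inter> part L i \<and> y \<in> V \<inter> part L i}
     \<union> {generator i (scale L c x) - free_smult c (generator i x) | i c x.
        x \<in> V \<inter> part L i}
     \<union> {generator i x * generator j y
          - free_smult (parity_sign (i * j)) (generator j y * generator i x)
          - generator (i + j) (b x y) | i j x y.
        x \<in> V \<inter> part L i \<and> y \<in> V \<inter> part L j}"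

definition env_ideal ::
    "'g::ab_group_add lie_super \<Rightarrow> 'g set \<Rightarrow> ('g \<Rightarrow> 'g \<Rightarrow> 'g) \<Rightarrow> 'g free set" where
  "env_ideal L V b = Idl\<^bsub>free_algebra (letters L V)\<^esub> (env_relations L V b)"

definition env ::
    "'g::ab_group_add lie_super \<Rightarrow> 'g set \<Rightarrow> ('g \<Rightarrow> 'g \<Rightarrow> 'g) \<Rightarrow>
      (complex, 'g free set) module" where
  "env L V b = quotient_algebra (free_algebra (letters L V)) (env_ideal L V b)"

definition env_class ::
    "'g::ab_group_add lie_super \<Rightarrow> 'g set \<Rightarrow> ('g \<Rightarrow> 'g \<Rightarrow> 'g) \<Rightarrow> 'g free \<Rightarrow> 'g free set" where
  "env_class L V b f = env_ideal L V b +>\<^bsub>free_algebra (letters L V)\<^esub> f"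

abbreviation zero_bracket :: "'g::ab_group_add \<Rightarrow> 'g \<Rightarrow> 'g" where
  "zero_bracket \<equiv> \<lambda>_ _. 0"

definition U :: "'g::ab_group_add lie_super \<Rightarrow> (complex, 'g free set) module" where
  "U L = env L UNIV (bracket L)"

text \<open>With the zero bracket the relations are those of the supersymmetric algebra:
  \<open>xy = (-1)^(|x||y|) yx\<close>.\<close>

definition Sym :: "'g::ab_group_add lie_super \<Rightarrow> 'g set \<Rightarrow> (complex, 'g free set) module" where
  "Sym L V = env L V zero_bracket"

section \<open>The dual algebra of an enveloping algebra\<close>

text \<open>The coproduct of a word as a formal sum of terms \<open>c u \<otimes> v\<close>. The recursion is
  \<open>\<Delta>(x w) = (x \<otimes> 1 + 1 \<otimes> x) \<Delta>(w)\<close>, where in the super tensor product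
  \<open>(1 \<otimes> x)(u \<otimes> v) = (-1)^(|x||u|) u \<otimes> x v\<close>. The ideal of relations is a coideal, so this
  induces the coproduct of the quotient.\<close>

fun coproduct_terms :: "'g word \<Rightarrow> (complex \<times> 'g word \<times> 'g word) list" where
  "coproduct_terms [] = [(1, [], [])]"
| "coproduct_terms (x # w) =
     concat (map (\<lambda>(c, u, v).
       [(c, x # u, v), (parity_sign (fst x * word_parity u) * c, u, x # v)])
       (coproduct_terms w))"

definition free_part :: "bit \<Rightarrow> 'g free \<Rightarrow> 'g free" where
  "free_part i f =
     (\<Sum>w\<in>{w \<in> Poly_Mapping.keys f. word_parity w = i}.
        Poly_Mapping.single w (Poly_Mapping.lookup f w))"

text \<open>The component of parity \<open>i\<close> of a functional on \<open>env L V b\<close>: it agrees with \<open>\<phi>\<close> on the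
  elements of parity \<open>i\<close> and vanishes on those of the other parity.\<close>

definition functional_part ::
    "'g::ab_group_add lie_super \<Rightarrow> 'g set \<Rightarrow> ('g \<Rightarrow> 'g \<Rightarrow> 'g) \<Rightarrow>
      bit \<Rightarrow> ('g free set \<Rightarrow> complex) \<Rightarrow> 'g free set \<Rightarrow> complex" where
  "functional_part L V b i \<phi> =
     (\<lambda>X\<in>carrier (env L V b). \<phi> (env_class L V b (free_part i (coset_rep X))))"

text \<open>The product \<open>\<phi>\<psi>(x) = \<Sum> (-1)^(|x1||\<psi>|) \<phi>(x1) \<psi>(x2)\<close>, extended from homogeneous \<open>\<psi>\<close> to
  all \<open>\<psi>\<close> by summing over the two components of \<open>\<psi>\<close>.\<close>

definition dual_mult ::
    "'g::ab_group_add lie_super \<Rightarrow> 'g set \<Rightarrow> ('g \<Rightarrow> 'g \<Rightarrow> 'g) \<Rightarrow>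
      ('g free set \<Rightarrow> complex) \<Rightarrow> ('g free set \<Rightarrow> complex) \<Rightarrow> 'g free set \<Rightarrow> complex" where
  "dual_mult L V b \<phi> \<psi> =
     (\<lambda>X\<in>carrier (env L V b).
        \<Sum>w\<in>Poly_Mapping.keys (coset_rep X).
          Poly_Mapping.lookup (coset_rep X) w *
          (\<Sum>i\<in>{0, 1}. \<Sum>(c, u, v)\<leftarrow>coproduct_terms w.
             c * parity_sign (word_parity u * i)
               * \<phi> (env_class L V b (Poly_Mapping.single u 1))
               * functional_part L V b i \<psi> (env_class L V b (Poly_Mapping.single v 1))))"

definition counit ::
    "'g::ab_group_add lie_super \<Rightarrow> 'g set \<Rightarrow> ('g \<Rightarrow> 'g \<Rightarrow> 'g) \<Rightarrow> 'g free set \<Rightarrow> complex" where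
  "counit L V b = (\<lambda>X\<in>carrier (env L V b). Poly_Mapping.lookup (coset_rep X) [])"

definition linear_functionals :: "(complex, 'x) module \<Rightarrow> ('x \<Rightarrow> complex) set" where
  "linear_functionals A =
     {\<phi> \<in> extensional (carrier A).
        (\<forall>x\<in>carrier A. \<forall>y\<in>carrier A. \<phi> (x \<oplus>\<^bsub>A\<^esub> y) = \<phi> x + \<phi> y) \<and>
        (\<forall>c. \<forall>x\<in>carrier A. \<phi> (c \<odot>\<^bsub>A\<^esub> x) = c * \<phi> x)}"

definition env_dual ::
    "'g::ab_group_add lie_super \<Rightarrow> 'g set \<Rightarrow> ('g \<Rightarrow> 'g \<Rightarrow> 'g) \<Rightarrow>
      (complex, 'g free set \<Rightarrow> complex) module" where
  "env_dual L V b =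
     \<lparr>carrier = linear_functionals (env L V b),
      mult = dual_mult L V b,
      one = counit L V b,
      zero = (\<lambda>X\<in>carrier (env L V b). 0),
      add = (\<lambda>\<phi> \<psi>. \<lambda>X\<in>carrier (env L V b). \<phi> X + \<psi> X),
      smult = (\<lambda>c \<phi>. \<lambda>X\<in>carrier (env L V b). c * \<phi> X)\<rparr>"

definition U_dual ::
    "'g::ab_group_add lie_super \<Rightarrow> (complex, 'g free set \<Rightarrow> complex) module" where
  "U_dual L = env_dual L UNIV (bracket L)"

definition Sym_dual ::
    "'g::ab_group_add lie_super \<Rightarrow> 'g set \<Rightarrow> (complex, 'g free set \<Rightarrow> complex) module" where
  "Sym_dual L V = env_dual L V zero_bracket"

definition finite_codimension :: "(complex, 'x) module \<Rightarrow> 'x set \<Rightarrow> bool" where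
  "finite_codimension A K \<longleftrightarrow>
     (\<exists>B. finite B \<and> B \<subseteq> carrier A \<and>
        (\<forall>x\<in>carrier A. \<exists>c. \<exists>k\<in>K. x = (\<Oplus>\<^bsub>A\<^esub>y\<in>B. c y \<odot>\<^bsub>A\<^esub> y) \<oplus>\<^bsub>A\<^esub> k))"

text \<open>The locale \<^locale>\<open>ideal\<close> is that of two-sided ideals.\<close>

definition finite_dual :: "(complex, 'x) module \<Rightarrow> ('x \<Rightarrow> complex) set" where
  "finite_dual A =
     {\<phi> \<in> linear_functionals A.
        \<exists>K. ideal K A \<and> finite_codimension A K \<and> (\<forall>x\<in>K. \<phi> x = 0)}"

definition Sym_finite_dual ::
    "'g::ab_group_add lie_super \<Rightarrow> 'g set \<Rightarrow> (complex, 'g free set \<Rightarrow> complex) module" where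
  "Sym_finite_dual L V = (Sym_dual L V)\<lparr>carrier := finite_dual (Sym L V)\<rparr>"

section \<open>The algebra \<open>\<A>(\<gg>, \<kk>)\<close>\<close>

text \<open>The subspace \<open>K\<close> is graded, being an eigenspace of an even map, so the image of \<open>K\<close> in
  the enveloping algebra is spanned by the classes of its homogeneous vectors.\<close>

definition K_image ::
    "'g::ab_group_add lie_super \<Rightarrow> 'g set \<Rightarrow> 'g free set set" where
  "K_image L K = {env_class L UNIV (bracket L) (generator i x) | i x. x \<in> K \<inter> part L i}"

definition K_times_U :: "'g::ab_group_add lie_super \<Rightarrow> 'g set \<Rightarrow> 'g free set set" where
  "K_times_U L K =
     generate (add_monoid (U L)) {x \<otimes>\<^bsub>U L\<^esub> u | x u. x \<in> K_image L K \<and> u \<in> carrier (U L)}"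

definition U_times_K :: "'g::ab_group_add lie_super \<Rightarrow> 'g set \<Rightarrow> 'g free set set" where
  "U_times_K L K =
     generate (add_monoid (U L)) {u \<otimes>\<^bsub>U L\<^esub> x | x u. x \<in> K_image L K \<and> u \<in> carrier (U L)}"

definition I_space :: "'g::ab_group_add lie_super \<Rightarrow> 'g set \<Rightarrow> 'g free set set" where
  "I_space L K = K_times_U L K <+>\<^bsub>U L\<^esub> U_times_K L K"

definition A_alg ::
    "'g::ab_group_add lie_super \<Rightarrow> 'g set \<Rightarrow> (complex, 'g free set \<Rightarrow> complex) module" where
  "A_alg L K = (U_dual L)\<lparr>carrier :=
     {\<phi> \<in> carrier (U_dual L). \<forall>X\<in>I_space L K. \<phi> X = 0}\<rparr>"

definition A_finite ::
    "'g::ab_group_add lie_super \<Rightarrow> 'g set \<Rightarrow> (complex, 'g free set \<Rightarrow> complex) module" where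
  "A_finite L K = (A_alg L K)\<lparr>carrier := carrier (A_alg L K) \<inter> finite_dual (U L)\<rparr>"

section \<open>Super-symmetrization and its dual\<close>

text \<open>The sign of the permutation that \<open>\<pi>\<close> induces on the odd letters of \<open>w\<close>, as the parity of
  its number of inversions.\<close>

definition odd_sign :: "(nat \<Rightarrow> nat) \<Rightarrow> 'g word \<Rightarrow> complex" where
  "odd_sign \<pi> w =
     (- 1) ^ card {(i, j). i < j \<and> j < length w \<and> \<pi> j < \<pi> i \<and>
                           fst (w ! \<pi> i) = 1 \<and> fst (w ! \<pi> j) = 1}"

definition symmetrize_word :: "'g word \<Rightarrow> 'g free" where
  "symmetrize_word w =
     (\<Sum>\<pi> | \<pi> permutes {..<length w}.
        Poly_Mapping.single (map (\<lambda>i. w ! \<pi> i) [0..<length w])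
          (odd_sign \<pi> w / fact (length w)))"

definition symmetrization ::
    "'g::ab_group_add lie_super \<Rightarrow> 'g free set \<Rightarrow> 'g free set" where
  "symmetrization L X =
     env_class L UNIV (bracket L)
       (\<Sum>w\<in>Poly_Mapping.keys (coset_rep X).
          free_smult (Poly_Mapping.lookup (coset_rep X) w) (symmetrize_word w))"

text \<open>The canonical map of supersymmetric algebras induced by an inclusion of a subspace
  in \<open>W\<close>.\<close>

definition Sym_inclusion ::
    "'g::ab_group_add lie_super \<Rightarrow> 'g set \<Rightarrow> 'g free set \<Rightarrow> 'g free set" where
  "Sym_inclusion L W X = env_class L W zero_bracket (coset_rep X)"

text \<open>The dual of the composite \<open>S(\<aa>) \<rightarrow> S(\<pp>) \<rightarrow> U(\<gg>) \<rightarrow> U(\<gg>)/\<I>\<close>. Functionals on the last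
  space are identified with functionals on \<open>U(\<gg>)\<close> vanishing on \<open>\<I>\<close>.\<close>

definition pullback ::
    "'g::ab_group_add lie_super \<Rightarrow> 'g set \<Rightarrow> 'g set \<Rightarrow>
      ('g free set \<Rightarrow> complex) \<Rightarrow> 'g free set \<Rightarrow> complex" where
  "pullback L P A \<phi> =
     (\<lambda>X\<in>carrier (Sym L A). \<phi> (symmetrization L (Sym_inclusion L P X)))"

text \<open>The locale \<^locale>\<open>algebra\<close> is that of commutative associative unital algebras.\<close>

definition commutative_algebra_embedding ::
    "(complex, 'x) module \<Rightarrow> (complex, 'y) module \<Rightarrow> ('x \<Rightarrow> 'y) \<Rightarrow> bool" where
  "commutative_algebra_embedding A B f \<longleftrightarrow>
     algebra complex_field A \<and> algebra complex_field B \<and>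
     f \<in> ring_hom A B \<and>
     (\<forall>c. \<forall>x\<in>carrier A. f (c \<odot>\<^bsub>A\<^esub> x) = c \<odot>\<^bsub>B\<^esub> f x) \<and>
     inj_on f (carrier A)"

end

theory Submission
  imports Defs "HOL-Library.Function_Algebras"
begin

text \<open>A functional on an enveloping algebra is a function \<open>f\<close> from words to complex numbers that is
  linear in each letter and respects the supercommutation relation at each place of a word. Such
  \<open>f\<close> are the \<open>word_functional\<close>s of the locale \<open>enveloping\<close>, which covers \<open>U(\<gg>)\<close>, \<open>S(\<pp>)\<close> and
  \<open>S(\<aa>)\<close> alike, and \<open>functional_of\<close> identifies them with the linear functionals. This turns
  most of the arguments into inductions on words.

  The product of the dual becomes a signed shuffle product with a two-line recursion
  (\<open>super_shuffle\<close>). It is associative, and commutative when all nonzero letters are even, so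
  \<open>S(\<aa>)*\<close> is a commutative algebra (\<open>algebra_env_dual\<close>). The elements of \<open>\<A>(\<gg>,\<kk>)\<close> are the \<open>f\<close> that
  vanish on every word that starts or ends with a letter from \<open>\<kk>\<close> (\<open>A_alg_carrier\<close>), and shuffling
  preserves this. The letters from \<open>\<aa>\<close> are even and commute in \<open>U(\<gg>)\<close>, so symmetrizing a word in
  them changes nothing there: the pullback restricts \<open>f\<close> to the words in \<open>\<aa>\<close>
  (\<open>pullback_eq_restriction\<close>) and therefore preserves products. Since it is injective, the algebra
  laws of \<open>\<A>(\<gg>,\<kk>)\<close>, commutativity included, are inherited from \<open>S(\<aa>)*\<close> (\<open>algebra_of_injection\<close>).

  Injectivity (\<open>restriction_injective\<close>) is an infinitesimal form of the Chevalley restriction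
  argument. Let \<open>f\<close> vanish on words in \<open>\<aa>\<close> and on words with a letter from \<open>\<kk>\<close> at either end, and
  proceed by induction on the length \<open>n\<close> of words. When \<open>f\<close> vanishes on shorter words, letters of a
  word of length \<open>n\<close> may be interchanged up to sign; so a letter from \<open>\<kk>\<close> can be moved to the end,
  and only letters from \<open>\<pp>\<close> remain. The space \<open>\<pp>\<close> is spanned by \<open>\<aa>\<close> and by vectors
  \<open>q = v - \<theta> v\<close>, where \<open>v\<close> is a homogeneous joint eigenvector of \<open>\<aa>\<close> with a nonzero eigenvalue
  function \<open>\<alpha>\<close>; the vector \<open>k = v + \<theta> v\<close> lies in \<open>\<kk>\<close> and satisfies \<open>[k,y] = - \<alpha>(y) q\<close> for \<open>y\<close> in
  \<open>\<aa>\<close>. Now let \<open>k\<close> travel through a word \<open>k y_0 \<dots> y_m p_1 \<dots> p_j\<close> with \<open>y_i\<close> in \<open>\<aa>\<close> and \<open>p_i\<close> in \<open>\<pp>\<close>.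
  By induction on the number of letters outside \<open>\<aa>\<close>, the commutators with the \<open>p_i\<close> do not
  contribute, and the sum of \<open>\<alpha>(y_i) f(\<dots> q p_1 \<dots> p_j)\<close>, with \<open>y_i\<close> removed in the \<open>i\<close>-th term, is
  zero. Take \<open>y\<close> with \<open>\<alpha>(y) \<noteq> 0\<close>: if \<open>r + 1\<close> of the \<open>y_i\<close> equal \<open>y\<close>, the term with \<open>r\<close> copies of \<open>y\<close>
  has the coefficient \<open>(r + 1) \<alpha>(y) \<noteq> 0\<close> and the other terms have more copies, so a downward
  induction on \<open>r\<close> shows that \<open>f\<close> vanishes on all these words (\<open>root_letter_vanishes\<close>).

  For the finite duals, a functional vanishes on a two-sided ideal of finite codimension exactly if
  the left translates of its word function span a space of finite dimension (\<open>finite_dual_eq\<close>).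
  In this form the property visibly passes to sums, to shuffle products and to restrictions.\<close>

text \<open>Sums and products of parities stay in the form in which the exponents of signs are additive.\<close>

declare add_bit_eq_xor [simp del] mult_bit_eq_and [simp del]

section \<open>Linear extension from words to the free algebra\<close>

definition lin :: "('a \<Rightarrow> complex) \<Rightarrow> ('a \<Rightarrow>\<^sub>0 complex) \<Rightarrow> complex" where
  "lin f p = (\<Sum>w\<in>Poly_Mapping.keys p. Poly_Mapping.lookup p w * f w)"

lemma lin_superset:
  assumes "finite A" "Poly_Mapping.keys p \<subseteq> A"
  shows "lin f p = (\<Sum>w\<in>A. Poly_Mapping.lookup p w * f w)"
  unfolding lin_def using assms
  by (intro sum.mono_neutral_left) (auto simp: in_keys_iff)

lemma lin_zero [simp]: "lin f 0 = 0"
  by (simp add: lin_def)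

lemma lin_single [simp]: "lin f (Poly_Mapping.single w c) = c * f w"
  by (simp add: lin_def)

lemma lin_add: "lin f (p + q) = lin f p + lin f q"
proof -
  let ?A = "Poly_Mapping.keys p \<union> Poly_Mapping.keys q"
  have "Poly_Mapping.keys (p + q) \<subseteq> ?A" by (rule keys_add)
  then show ?thesis
    by (simp add: lin_superset[of ?A] lookup_add distrib_right sum.distrib)
qed

lemma lin_uminus: "lin f (- p) = - lin f p"
proof -
  have "lin f (p + - p) = lin f p + lin f (- p)" by (rule lin_add)
  then show ?thesis by (simp add: eq_neg_iff_add_eq_0 add.commute)
qed

lemma lin_diff: "lin f (p - q) = lin f p - lin f q"
  using lin_add[of f p "- q"] by (simp add: lin_uminus)

lemma lookup_free_smult [simp]:
  "Poly_Mapping.lookup (free_smult c p) w = c * Poly_Mapping.lookup p w"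
  by (simp add: free_smult_def Poly_Mapping.map.rep_eq when_def)

lemma lin_smult: "lin f (free_smult c p) = c * lin f p"
proof -
  have "Poly_Mapping.keys (free_smult c p) \<subseteq> Poly_Mapping.keys p"
    by (auto simp: in_keys_iff)
  then show ?thesis
    by (simp add: lin_superset[of "Poly_Mapping.keys p" "free_smult c p"]
        lin_superset[of "Poly_Mapping.keys p" p] sum_distrib_left mult.assoc)
qed

lemma lin_sum: "lin f (sum g I) = (\<Sum>i\<in>I. lin f (g i))"
  by (induction I rule: infinite_finite_induct) (auto simp: lin_add)

lemma sum_single_keys: "(\<Sum>w\<in>Poly_Mapping.keys p. Poly_Mapping.single w (Poly_Mapping.lookup p w)) = p"
proof (rule poly_mapping_eqI)
  fix k
  show "Poly_Mapping.lookup (\<Sum>w\<in>Poly_Mapping.keys p. Poly_Mapping.single w (Poly_Mapping.lookup p w)) k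
      = Poly_Mapping.lookup p k"
    by (auto simp: lookup_sum lookup_single when_def in_keys_iff sum.delta')
qed

lemma lin_cong: "(\<And>w. w \<in> Poly_Mapping.keys p \<Longrightarrow> f w = g w) \<Longrightarrow> lin f p = lin g p"
  by (simp add: lin_def)

lemma lin_fun_zero [simp]: "lin (\<lambda>w. 0) p = 0"
  by (simp add: lin_def)

lemma lin_fun_add: "lin (\<lambda>w. f w + g w) p = lin f p + lin g p"
  by (simp add: lin_def distrib_left sum.distrib)

lemma lin_fun_smult: "lin (\<lambda>w. c * f w) p = c * lin f p"
  by (simp add: lin_def sum_distrib_left mult_ac)

lemma lin_fun_sum: "lin (\<lambda>w. \<Sum>i\<in>I. f i w) p = (\<Sum>i\<in>I. lin (f i) p)"
  by (induction I rule: infinite_finite_induct) (auto simp: lin_fun_add)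

lemma lin_mult:
  fixes p q :: "'a list \<Rightarrow>\<^sub>0 complex"
  shows "lin f (p * q) = lin (\<lambda>u. lin (\<lambda>v. f (u @ v)) q) p"
proof -
  let ?s = "\<lambda>p w. Poly_Mapping.single w (Poly_Mapping.lookup p w)"
  have "p * q = (\<Sum>u\<in>Poly_Mapping.keys p. ?s p u) * (\<Sum>v\<in>Poly_Mapping.keys q. ?s q v)"
    by (simp only: sum_single_keys)
  also have "\<dots> = (\<Sum>u\<in>Poly_Mapping.keys p. \<Sum>v\<in>Poly_Mapping.keys q.
      Poly_Mapping.single (u @ v) (Poly_Mapping.lookup p u * Poly_Mapping.lookup q v))"
    by (simp add: sum_distrib_left sum_distrib_right mult_single plus_list_def)
      (subst sum.swap, rule refl)
  finally have "lin f (p * q) = (\<Sum>u\<in>Poly_Mapping.keys p. \<Sum>v\<in>Poly_Mapping.keys q.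
      Poly_Mapping.lookup p u * Poly_Mapping.lookup q v * f (u @ v))"
    by (simp add: lin_sum)
  then show ?thesis by (simp add: lin_def sum_distrib_left mult.assoc)
qed

lemma lin_swap: "lin (\<lambda>x. lin (\<lambda>y. h x y) q) p = lin (\<lambda>y. lin (\<lambda>x. h x y) p) q"
  unfolding lin_def sum_distrib_left by (subst sum.swap) (simp add: mult.left_commute)

lemma one_eq_single: "(1 :: 'a list \<Rightarrow>\<^sub>0 complex) = Poly_Mapping.single [] 1"
  using single_one[where ?'a = "'a list" and ?'b = complex] by (simp add: zero_list_def)

lemma free_smult_eq_mult:
  fixes p :: "'a list \<Rightarrow>\<^sub>0 complex"
  shows "free_smult c p = Poly_Mapping.single [] c * p"
  unfolding free_smult_def using mult_map_scale_conv_mult[of c p] by (simp add: zero_list_def)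

lemma carrier_free_algebra: "p \<in> carrier (free_algebra S) \<longleftrightarrow> Poly_Mapping.keys p \<subseteq> lists S"
  by (simp add: free_algebra_def)

lemma free_algebra_ops [simp]:
  "mult (free_algebra S) = (*)" "one (free_algebra S) = 1"
  "zero (free_algebra S) = 0" "add (free_algebra S) = (+)" "smult (free_algebra S) = free_smult"
  by (simp_all add: free_algebra_def)

lemma free_algebra_closed:
  shows "p \<in> carrier (free_algebra S) \<Longrightarrow> q \<in> carrier (free_algebra S) \<Longrightarrow> p + q \<in> carrier (free_algebra S)"
    and "p \<in> carrier (free_algebra S) \<Longrightarrow> - p \<in> carrier (free_algebra S)"
    and "p \<in> carrier (free_algebra S) \<Longrightarrow> q \<in> carrier (free_algebra S) \<Longrightarrow> p - q \<in> carrier (free_algebra S)"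
    and "p \<in> carrier (free_algebra S) \<Longrightarrow> q \<in> carrier (free_algebra S) \<Longrightarrow> p * q \<in> carrier (free_algebra S)"
    and "p \<in> carrier (free_algebra S) \<Longrightarrow> free_smult c p \<in> carrier (free_algebra S)"
proof -
  have neg: "Poly_Mapping.keys (- q) = Poly_Mapping.keys q" for q :: "'a list \<Rightarrow>\<^sub>0 complex"
    by (auto simp: in_keys_iff)
  show "p \<in> carrier (free_algebra S) \<Longrightarrow> q \<in> carrier (free_algebra S) \<Longrightarrow> p + q \<in> carrier (free_algebra S)"
    "p \<in> carrier (free_algebra S) \<Longrightarrow> - p \<in> carrier (free_algebra S)"
    "p \<in> carrier (free_algebra S) \<Longrightarrow> q \<in> carrier (free_algebra S) \<Longrightarrow> p - q \<in> carrier (free_algebra S)"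
    using keys_add[of p q] keys_add[of p "- q"] by (auto simp: carrier_free_algebra neg subset_iff)
  show "p \<in> carrier (free_algebra S) \<Longrightarrow> q \<in> carrier (free_algebra S) \<Longrightarrow> p * q \<in> carrier (free_algebra S)"
    using keys_mult[of p q] by (fastforce simp: carrier_free_algebra plus_list_def)
  show "p \<in> carrier (free_algebra S) \<Longrightarrow> free_smult c p \<in> carrier (free_algebra S)"
    by (auto simp: carrier_free_algebra in_keys_iff subset_iff)
qed

lemma single_in_free_algebra: "w \<in> lists S \<Longrightarrow> Poly_Mapping.single w c \<in> carrier (free_algebra S)"
  by (simp add: carrier_free_algebra)

lemma free_algebra_zero_one [simp]: "0 \<in> carrier (free_algebra S)" "1 \<in> carrier (free_algebra S)"
  by (simp_all add: carrier_free_algebra one_eq_single)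

lemma free_algebra_sum_closed:
  "(\<And>i. i \<in> I \<Longrightarrow> g i \<in> carrier (free_algebra S)) \<Longrightarrow> sum g I \<in> carrier (free_algebra S)"
  by (induction I rule: infinite_finite_induct) (auto intro: free_algebra_closed free_algebra_zero_one)

lemma ring_free_algebra: "ring (free_algebra S)"
proof (rule ringI)
  show "abelian_group (free_algebra S)"
    by (rule abelian_groupI)
      (auto simp: add_ac free_algebra_closed free_algebra_zero_one intro: bexI[of _ "- _"])
  show "monoid (free_algebra S)"
    by (rule monoidI) (auto simp: mult.assoc free_algebra_closed free_algebra_zero_one)
qed (auto simp: algebra_simps)

section \<open>The quotient by the relations\<close>

text \<open>The three cases of interest are \<open>U(\<gg>)\<close>, where \<open>V\<close> is everything and \<open>b\<close> is the bracket, and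
  \<open>S(\<pp>)\<close> and \<open>S(\<aa>)\<close>, where \<open>b\<close> is zero.\<close>

locale enveloping =
  fixes L :: "'g::ab_group_add lie_super" and V :: "'g set" and b :: "'g \<Rightarrow> 'g \<Rightarrow> 'g"
  assumes lie: "lie_superalgebra L"
    and subspace: "linear_subspace L V"
    and bracket_closed:
      "x \<in> V \<inter> part L i \<Longrightarrow> y \<in> V \<inter> part L j \<Longrightarrow> b x y \<in> V \<inter> part L (i + j)"
begin

abbreviation "S \<equiv> letters L V"
abbreviation "F \<equiv> free_algebra S"
abbreviation "J \<equiv> env_ideal L V b"
abbreviation "E \<equiv> env L V b"
abbreviation "cls \<equiv> env_class L V b"

interpretation LV: vector_space "scale L"
  using lie by (rule lie_superalgebra.vector_space)

lemma add_closed: "x \<in> V \<inter> part L i \<Longrightarrow> y \<in> V \<inter> part L i \<Longrightarrow> x + y \<in> V \<inter> part L i"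
  using subspace lie_superalgebra.subspace_part[OF lie, of i]
  by (auto simp: linear_subspace_def LV.subspace_add)

lemma scale_closed: "x \<in> V \<inter> part L i \<Longrightarrow> scale L c x \<in> V \<inter> part L i"
  using subspace lie_superalgebra.subspace_part[OF lie, of i]
  by (auto simp: linear_subspace_def LV.subspace_scale)

lemma zero_closed: "0 \<in> V \<inter> part L i"
  using subspace lie_superalgebra.subspace_part[OF lie, of i]
  by (auto simp: linear_subspace_def LV.subspace_0)

lemma in_letters: "(i, x) \<in> S \<longleftrightarrow> x \<in> V \<inter> part L i"
  by (simp add: letters_def)

lemma generator_closed: "x \<in> V \<inter> part L i \<Longrightarrow> generator i x \<in> carrier F"
  by (simp add: generator_def carrier_free_algebra in_letters)

lemma relation_cases:
  assumes "r \<in> env_relations L V b"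
  obtains (add) i x y where "x \<in> V \<inter> part L i" "y \<in> V \<inter> part L i"
      "r = generator i (x + y) - (generator i x + generator i y)"
    | (scale) i c x where "x \<in> V \<inter> part L i"
      "r = generator i (scale L c x) - free_smult c (generator i x)"
    | (commute) i j x y where "x \<in> V \<inter> part L i" "y \<in> V \<inter> part L j"
      "r = generator i x * generator j y
          - free_smult (parity_sign (i * j)) (generator j y * generator i x)
          - generator (i + j) (b x y)"
  using assms unfolding env_relations_def by blast

lemma relations_closed: "env_relations L V b \<subseteq> carrier F"
proof
  fix r assume "r \<in> env_relations L V b"
  then show "r \<in> carrier F"
  proof (cases rule: relation_cases)
    case (add i x y)
    then show ?thesis using add_closed[OF add(1,2)] by (simp only: free_algebra_closed generator_closed)
  next
    case (scale i c x)
    then show ?thesis using scale_closed[OF scale(1)] by (simp only: free_algebra_closed generator_closed)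
  next
    case (commute i j x y)
    then show ?thesis using bracket_closed[OF commute(1,2)] by (simp only: free_algebra_closed generator_closed)
  qed
qed

interpretation F: ring F
  by (rule ring_free_algebra)

lemma ideal_J: "ideal J F"
  unfolding env_ideal_def by (rule F.genideal_ideal[OF relations_closed])

lemma relations_in_J: "env_relations L V b \<subseteq> J"
  unfolding env_ideal_def by (rule F.genideal_self[OF relations_closed])

lemma J_minimal: "ideal I F \<Longrightarrow> env_relations L V b \<subseteq> I \<Longrightarrow> J \<subseteq> I"
  unfolding env_ideal_def by (rule F.genideal_minimal)

interpretation J: ideal J F
  by (rule ideal_J)

lemma J_closed:
  shows "p \<in> J \<Longrightarrow> p \<in> carrier F" "p \<in> J \<Longrightarrow> q \<in> J \<Longrightarrow> p + q \<in> J" "p \<in> J \<Longrightarrow> - p \<in> J"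
    "p \<in> J \<Longrightarrow> q \<in> J \<Longrightarrow> p - q \<in> J" "p \<in> J \<Longrightarrow> free_smult c p \<in> J"
proof -
  show "p \<in> J \<Longrightarrow> p \<in> carrier F" using J.a_Hcarr .
  show add: "p \<in> J \<Longrightarrow> q \<in> J \<Longrightarrow> p + q \<in> J" for p q using J.a_closed[of p q] by simp
  show minus: "p \<in> J \<Longrightarrow> - p \<in> J" for p
    using J.I_l_closed[of p "- 1"] free_algebra_closed(2)[OF free_algebra_zero_one(2), of S] by simp
  show "p \<in> J \<Longrightarrow> q \<in> J \<Longrightarrow> p - q \<in> J" using add[of p "- q"] minus by simp
  show "p \<in> J \<Longrightarrow> free_smult c p \<in> J"
    using J.I_l_closed[of p "Poly_Mapping.single [] c"]
    by (simp add: free_smult_eq_mult carrier_free_algebra)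
qed

lemma zero_in_J: "0 \<in> J"
  using J.zero_closed by simp

lemma sum_in_J: "(\<And>i. i \<in> I \<Longrightarrow> g i \<in> J) \<Longrightarrow> sum g I \<in> J"
  by (induction I rule: infinite_finite_induct) (auto intro: J_closed zero_in_J)

lemma cls_eq_set: "cls p = {j + p | j. j \<in> J}"
  by (auto simp: env_class_def a_r_coset_def r_coset_def)

lemma carrier_E: "carrier E = cls ` carrier F"
  by (auto simp: env_def quotient_algebra_def FactRing_def A_RCOSETS_defs env_class_def a_r_coset_def r_coset_def)

lemma E_mult: "p \<in> carrier F \<Longrightarrow> q \<in> carrier F \<Longrightarrow> cls p \<otimes>\<^bsub>E\<^esub> cls q = cls (p * q)"
  using J.rcoset_mult_add[of p q] by (simp add: env_def quotient_algebra_def FactRing_def env_class_def)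

lemma E_add: "p \<in> carrier F \<Longrightarrow> q \<in> carrier F \<Longrightarrow> cls p \<oplus>\<^bsub>E\<^esub> cls q = cls (p + q)"
  using J.a_rcos_sum[of p q] by (simp add: env_def quotient_algebra_def FactRing_def env_class_def)

lemma E_one: "\<one>\<^bsub>E\<^esub> = cls 1"
  by (simp add: env_def quotient_algebra_def FactRing_def env_class_def)

lemma cls_eq: "cls p = cls q \<longleftrightarrow> p - q \<in> J"
proof
  assume "cls p = cls q"
  moreover have "p \<in> cls p" using zero_in_J by (auto simp: cls_eq_set)
  ultimately show "p - q \<in> J" by (auto simp: cls_eq_set)
next
  assume *: "p - q \<in> J"
  have 1: "j + p = (j + (p - q)) + q" "j + q = (j - (p - q)) + p" for j by simp_all
  show "cls p = cls q"
    unfolding cls_eq_set using J_closed(2)[OF _ *] J_closed(4)[OF _ *] 1 by blast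
qed

lemma E_zero: "\<zero>\<^bsub>E\<^esub> = cls 0"
  using zero_in_J by (auto simp: env_def quotient_algebra_def FactRing_def cls_eq_set)

lemma E_smult: "p \<in> carrier F \<Longrightarrow> c \<odot>\<^bsub>E\<^esub> cls p = cls (free_smult c p)"
proof -
  assume p: "p \<in> carrier F"
  have "c \<odot>\<^bsub>E\<^esub> cls p = (\<Union>x\<in>cls p. cls (free_smult c x))"
    by (simp add: env_def quotient_algebra_def env_class_def)
  moreover have "cls (free_smult c x) = cls (free_smult c p)" if "x \<in> cls p" for x
  proof -
    obtain j where j: "j \<in> J" "x = j + p" using \<open>x \<in> cls p\<close> by (auto simp: cls_eq_set)
    then have "free_smult c x - free_smult c p = free_smult c j"
      by (simp add: free_smult_eq_mult algebra_simps)
    then show ?thesis using J_closed(5)[OF j(1)] by (simp add: cls_eq)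
  qed
  moreover have "p \<in> cls p" using zero_in_J by (auto simp: cls_eq_set)
  ultimately show ?thesis by blast
qed

lemma cls_closed: "p \<in> carrier F \<Longrightarrow> cls p \<in> carrier E"
  by (simp add: carrier_E)

text \<open>The definitions of the product, the counit and the pullback all evaluate on a chosen
  representative; this is what makes the choice harmless.\<close>

lemma coset_rep_props:
  assumes "X \<in> carrier E"
  shows "coset_rep X \<in> carrier F" "cls (coset_rep X) = X"
proof -
  obtain p where p: "p \<in> carrier F" "X = cls p" using assms by (auto simp: carrier_E)
  have "p \<in> X" using zero_in_J p by (auto simp: cls_eq_set)
  then have "coset_rep X \<in> X" unfolding coset_rep_def by (rule someI)
  then obtain j where j: "j \<in> J" "coset_rep X = j + p" using p by (auto simp: cls_eq_set)
  show "coset_rep X \<in> carrier F" using j p J_closed(1) by (simp add: free_algebra_closed)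
  show "cls (coset_rep X) = X" using j p by (simp add: cls_eq)
qed

lemma coset_rep_cls: "p \<in> carrier F \<Longrightarrow> coset_rep (cls p) - p \<in> J"
  using coset_rep_props(2)[OF cls_closed] by (simp add: cls_eq)

lemma ring_E: "ring E"
proof (rule ringI)
  show "abelian_group E"
  proof (rule abelian_groupI)
    fix X assume "X \<in> carrier E"
    then obtain p where p: "p \<in> carrier F" "X = cls p" by (auto simp: carrier_E)
    then have "cls (- p) \<in> carrier E" "cls (- p) \<oplus>\<^bsub>E\<^esub> X = \<zero>\<^bsub>E\<^esub>"
      by (simp_all add: cls_closed E_add E_zero free_algebra_closed)
    then show "\<exists>Y\<in>carrier E. Y \<oplus>\<^bsub>E\<^esub> X = \<zero>\<^bsub>E\<^esub>" by blast
  qed (auto simp: carrier_E E_add E_zero free_algebra_closed free_algebra_zero_one add_ac)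
  show "monoid E"
    by (rule monoidI) (auto simp: carrier_E E_mult E_one free_algebra_closed free_algebra_zero_one mult.assoc)
qed (auto simp: carrier_E E_mult E_add free_algebra_closed algebra_simps)

section \<open>Functionals as functions of words\<close>

text \<open>Requiring the value 0 on words with letters outside \<open>S\<close> makes the word function of a
  functional unique, and it lets the relations be stated for arbitrary contexts \<open>u\<close> and \<open>v\<close>.\<close>

definition word_functional :: "('g word \<Rightarrow> complex) \<Rightarrow> bool" where
  "word_functional f \<longleftrightarrow>
     (\<forall>w. w \<notin> lists S \<longrightarrow> f w = 0) \<and>
     (\<forall>u v i x y. x \<in> V \<inter> part L i \<longrightarrow> y \<in> V \<inter> part L i \<longrightarrow>
        f (u @ (i, x + y) # v) = f (u @ (i, x) # v) + f (u @ (i, y) # v)) \<and>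
     (\<forall>u v i c x. x \<in> V \<inter> part L i \<longrightarrow> f (u @ (i, scale L c x) # v) = c * f (u @ (i, x) # v)) \<and>
     (\<forall>u v i j x y. x \<in> V \<inter> part L i \<longrightarrow> y \<in> V \<inter> part L j \<longrightarrow>
        f (u @ (i, x) # (j, y) # v)
          = parity_sign (i * j) * f (u @ (j, y) # (i, x) # v) + f (u @ (i + j, b x y) # v))"

lemma
  assumes "word_functional f"
  shows word_functional_support: "w \<notin> lists S \<Longrightarrow> f w = 0"
    and word_functional_add: "x \<in> V \<inter> part L i \<Longrightarrow> y \<in> V \<inter> part L i \<Longrightarrow>
      f (u @ (i, x + y) # v) = f (u @ (i, x) # v) + f (u @ (i, y) # v)"
    and word_functional_scale: "x \<in> V \<inter> part L i \<Longrightarrow> f (u @ (i, scale L c x) # v) = c * f (u @ (i, x) # v)"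
    and word_functional_commute: "x \<in> V \<inter> part L i \<Longrightarrow> y \<in> V \<inter> part L j \<Longrightarrow>
      f (u @ (i, x) # (j, y) # v)
          = parity_sign (i * j) * f (u @ (j, y) # (i, x) # v) + f (u @ (i + j, b x y) # v)"
  using assms unfolding word_functional_def by blast+

lemma word_functional_zero_letter: "word_functional f \<Longrightarrow> f (u @ (i, 0) # v) = 0"
  using word_functional_scale[of f 0 i u 0 v] zero_closed by simp

lemma lin_kills_relations:
  assumes f: "word_functional f" and "r \<in> env_relations L V b"
  shows "lin (\<lambda>w. f (u @ w @ v)) r = 0"
  using assms(2)
proof (cases rule: relation_cases)
  case (add i x y)
  then show ?thesis by (simp add: generator_def lin_diff lin_add word_functional_add[OF f add(1,2)])
next
  case (scale i c x)
  then show ?thesis by (simp add: generator_def lin_diff lin_smult word_functional_scale[OF f scale(1)])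
next
  case (commute i j x y)
  then show ?thesis
    by (simp add: generator_def lin_diff lin_smult lin_mult word_functional_commute[OF f commute(1,2)])
qed

text \<open>The elements killed by all translates of \<open>f\<close> from both sides form a two-sided ideal, and it
  contains the relations.\<close>

lemma lin_kills_J:
  assumes f: "word_functional f" and p: "p \<in> J"
  shows "lin f p = 0"
proof -
  let ?I = "{p \<in> carrier F. \<forall>u v. lin (\<lambda>w. f (u @ w @ v)) p = 0}"
  have left: "lin (\<lambda>w. f (u @ w @ v)) (q * r) = lin (\<lambda>x. lin (\<lambda>w. f ((u @ x) @ w @ v)) r) q"
    for q r u v by (simp add: lin_mult)
  have right: "lin (\<lambda>w. f (u @ w @ v)) (r * q) = lin (\<lambda>x. lin (\<lambda>w. f (u @ w @ (x @ v))) r) q"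
    for q r u v by (subst lin_swap) (simp add: lin_mult)
  have "ideal ?I F"
  proof (rule idealI)
    show "ring F" by (rule ring_free_algebra)
    show "subgroup ?I (add_monoid F)"
    proof (rule group.subgroupI)
      show "group (add_monoid F)" by (rule F.add.is_group)
      show "?I \<subseteq> carrier (add_monoid F)" by auto
      show "?I \<noteq> {}" using free_algebra_zero_one(1) by (auto intro!: exI[of _ 0])
      fix q assume q: "q \<in> ?I"
      have "inv\<^bsub>add_monoid F\<^esub> q = - q"
        using q by (intro group.inv_equality F.add.is_group) (auto simp: free_algebra_closed)
      then show "inv\<^bsub>add_monoid F\<^esub> q \<in> ?I" using q by (simp add: free_algebra_closed lin_uminus)
    qed (auto simp: free_algebra_closed lin_add)
  next
    fix q r assume "q \<in> ?I" "r \<in> carrier F"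
    then show "r \<otimes>\<^bsub>F\<^esub> q \<in> ?I" by (simp add: free_algebra_closed left del: append_assoc)
  next
    fix q r assume "q \<in> ?I" "r \<in> carrier F"
    then show "q \<otimes>\<^bsub>F\<^esub> r \<in> ?I" by (simp add: free_algebra_closed right del: append_assoc)
  qed
  moreover have "env_relations L V b \<subseteq> ?I"
    using relations_closed lin_kills_relations[OF f] by (auto simp: lin_mult)
  ultimately have "J \<subseteq> ?I" by (rule J_minimal)
  with p have "lin (\<lambda>w. f ([] @ w @ [])) p = 0" by blast
  then show ?thesis by simp
qed

definition functional_of :: "('g word \<Rightarrow> complex) \<Rightarrow> 'g free set \<Rightarrow> complex" where
  "functional_of f = (\<lambda>X\<in>carrier E. lin f (coset_rep X))"

definition word_values :: "('g free set \<Rightarrow> complex) \<Rightarrow> 'g word \<Rightarrow> complex" where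
  "word_values \<phi> w = (if w \<in> lists S then \<phi> (cls (Poly_Mapping.single w 1)) else 0)"

lemma functional_of_cls:
  "word_functional f \<Longrightarrow> p \<in> carrier F \<Longrightarrow> functional_of f (cls p) = lin f p"
  using lin_kills_J[of f "coset_rep (cls p) - p"] coset_rep_cls[of p]
  by (simp add: functional_of_def cls_closed lin_diff)

lemma functional_of_linear:
  assumes "word_functional f" shows "functional_of f \<in> linear_functionals E"
proof -
  have "functional_of f \<in> extensional (carrier E)" by (simp add: functional_of_def)
  then show ?thesis
    by (auto simp: linear_functionals_def carrier_E E_add E_smult functional_of_cls[OF assms]
        free_algebra_closed lin_add lin_smult)
qed

lemma word_values_functional_of:
  assumes "word_functional f" shows "word_values (functional_of f) = f"
  using word_functional_support[OF assms]
  by (auto simp: fun_eq_iff word_values_def functional_of_cls[OF assms] carrier_free_algebra simp del: in_lists_conv_set)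

context
  fixes \<phi> assumes \<phi>: "\<phi> \<in> linear_functionals E"
begin

lemma functional_add: "p \<in> carrier F \<Longrightarrow> q \<in> carrier F \<Longrightarrow> \<phi> (cls (p + q)) = \<phi> (cls p) + \<phi> (cls q)"
  using \<phi> by (simp add: linear_functionals_def E_add[symmetric] cls_closed)

lemma functional_smult: "p \<in> carrier F \<Longrightarrow> \<phi> (cls (free_smult c p)) = c * \<phi> (cls p)"
  using \<phi> by (simp add: linear_functionals_def E_smult[symmetric] cls_closed)

lemma functional_zero: "\<phi> (cls 0) = 0"
  using functional_add[of 0 0] free_algebra_zero_one by simp

lemma functional_sum:
  "(\<And>i. i \<in> I \<Longrightarrow> g i \<in> carrier F) \<Longrightarrow> \<phi> (cls (sum g I)) = (\<Sum>i\<in>I. \<phi> (cls (g i)))"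
  by (induction I rule: infinite_finite_induct)
    (auto simp: functional_add functional_zero free_algebra_sum_closed)

text \<open>A linear functional on the quotient is determined by its values on the classes of words.\<close>

lemma functional_eq_lin:
  assumes "p \<in> carrier F" shows "\<phi> (cls p) = lin (word_values \<phi>) p"
proof -
  let ?s = "\<lambda>w. Poly_Mapping.single w (Poly_Mapping.lookup p w)"
  have keys: "w \<in> lists S" if "w \<in> Poly_Mapping.keys p" for w
    using that assms by (auto simp: carrier_free_algebra)
  have "\<phi> (cls p) = \<phi> (cls (\<Sum>w\<in>Poly_Mapping.keys p. ?s w))" by (simp only: sum_single_keys)
  also have "\<dots> = (\<Sum>w\<in>Poly_Mapping.keys p. \<phi> (cls (?s w)))"
    by (rule functional_sum) (use keys in \<open>simp add: carrier_free_algebra\<close>)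
  also have "\<dots> = (\<Sum>w\<in>Poly_Mapping.keys p. Poly_Mapping.lookup p w * word_values \<phi> w)"
  proof (rule sum.cong[OF refl])
    fix w assume w: "w \<in> Poly_Mapping.keys p"
    have "?s w = free_smult (Poly_Mapping.lookup p w) (Poly_Mapping.single w 1)"
      by (simp add: free_smult_eq_mult mult_single plus_list_def)
    with functional_smult[OF single_in_free_algebra[OF keys[OF w]]] keys[OF w]
    show "\<phi> (cls (?s w)) = Poly_Mapping.lookup p w * word_values \<phi> w"
      by (simp add: word_values_def)
  qed
  finally show ?thesis by (simp add: lin_def)
qed

lemma functional_of_word_values: "functional_of (word_values \<phi>) = \<phi>"
proof
  fix X
  show "functional_of (word_values \<phi>) X = \<phi> X"
  proof (cases "X \<in> carrier E")
    case True
    then show ?thesis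
      using functional_eq_lin[of "coset_rep X"] by (simp add: functional_of_def coset_rep_props)
  next
    case False
    then show ?thesis using \<phi> by (auto simp: functional_of_def linear_functionals_def extensional_def)
  qed
qed

lemma word_values_functional: "word_functional (word_values \<phi>)"
proof -
  have rel: "lin (word_values \<phi>) (Poly_Mapping.single u 1 * r * Poly_Mapping.single v 1) = 0"
    if "r \<in> env_relations L V b" and uv: "u \<in> lists S" "v \<in> lists S" for r u v
  proof -
    have "r \<in> J" using that relations_in_J by blast
    then have *: "Poly_Mapping.single u 1 * r * Poly_Mapping.single v 1 \<in> J"
      using J.I_l_closed[of r "Poly_Mapping.single u 1"]
        J.I_r_closed[of "Poly_Mapping.single u 1 * r" "Poly_Mapping.single v 1"] uv
      by (simp add: carrier_free_algebra)
    then have "cls (Poly_Mapping.single u 1 * r * Poly_Mapping.single v 1) = cls 0"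
      by (simp add: cls_eq)
    then show ?thesis
      using functional_eq_lin[OF J_closed(1)[OF *]] functional_zero by simp
  qed
  have rel': "lin (\<lambda>w. word_values \<phi> (u @ w @ v)) r = 0" if r: "r \<in> env_relations L V b" for r u v
  proof (cases "u \<in> lists S \<and> v \<in> lists S")
    case True
    then show ?thesis using rel[of r u v] r by (simp add: lin_mult)
  next
    case False
    then have "word_values \<phi> (u @ w @ v) = 0" for w by (auto simp: word_values_def)
    then show ?thesis by simp
  qed
  show ?thesis
    unfolding word_functional_def
  proof (intro conjI allI impI)
    fix u v i x y assume "x \<in> V \<inter> part L i" "y \<in> V \<inter> part L i"
    then have "generator i (x + y) - (generator i x + generator i y) \<in> env_relations L V b"
      unfolding env_relations_def by blast
    from rel'[OF this, of u v]
    show "word_values \<phi> (u @ (i, x + y) # v) = word_values \<phi> (u @ (i, x) # v) + word_values \<phi> (u @ (i, y) # v)"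
      by (simp add: generator_def lin_diff lin_add)
  next
    fix u v i c x assume "x \<in> V \<inter> part L i"
    then have "generator i (scale L c x) - free_smult c (generator i x) \<in> env_relations L V b"
      unfolding env_relations_def by blast
    from rel'[OF this, of u v]
    show "word_values \<phi> (u @ (i, scale L c x) # v) = c * word_values \<phi> (u @ (i, x) # v)"
      by (simp add: generator_def lin_diff lin_smult)
  next
    fix u v i j x y assume "x \<in> V \<inter> part L i" "y \<in> V \<inter> part L j"
    then have "generator i x * generator j y
          - free_smult (parity_sign (i * j)) (generator j y * generator i x)
          - generator (i + j) (b x y) \<in> env_relations L V b"
      unfolding env_relations_def by blast
    from rel'[OF this, of u v]
    show "word_values \<phi> (u @ (i, x) # (j, y) # v)
        = parity_sign (i * j) * word_values \<phi> (u @ (j, y) # (i, x) # v)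
          + word_values \<phi> (u @ (i + j, b x y) # v)"
      by (simp add: generator_def lin_diff lin_smult lin_mult diff_eq_eq add.commute)
  qed (simp add: word_values_def)
qed

end

end

section \<open>The convolution product of word functions\<close>

lemma parity_sign_simps [simp]: "parity_sign 0 = 1" "parity_sign 1 = - 1"
  by (simp_all add: parity_sign_def)

lemma parity_sign_add: "parity_sign (i + j) = parity_sign i * parity_sign j"
  by (cases i; cases j) simp_all

lemma parity_sign_square: "parity_sign i * parity_sign i = 1" "parity_sign i * (parity_sign i * z) = z"
  by (cases i; simp)+

lemma word_parity_simps [simp]:
  "word_parity [] = 0" "word_parity (x # w) = fst x + word_parity w"
  "word_parity (u @ v) = word_parity u + word_parity v"
  by (simp_all add: word_parity_def)

text \<open>Composition with the \<open>i\<close>-th power of the parity automorphism. It produces the sign from moving a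
  letter of parity \<open>i\<close> past the first tensor factor.\<close>

definition twist :: "bit \<Rightarrow> ('g word \<Rightarrow> complex) \<Rightarrow> 'g word \<Rightarrow> complex" where
  "twist i f w = parity_sign (i * word_parity w) * f w"

text \<open>The recursion reads off the product from \<open>\<Delta>(x w) = (x \<otimes> 1 + 1 \<otimes> x) \<Delta>(w)\<close>: the first letter
  goes either to the first or to the second factor. The lemma \<open>super_shuffle_coproduct\<close> compares it with
  the sum over the terms of the coproduct.\<close>

fun super_shuffle :: "('g word \<Rightarrow> complex) \<Rightarrow> ('g word \<Rightarrow> complex) \<Rightarrow> 'g word \<Rightarrow> complex" where
  "super_shuffle f g [] = f [] * g []"
| "super_shuffle f g (x # w) =
     super_shuffle (\<lambda>v. f (x # v)) (twist (fst x) g) w + super_shuffle f (\<lambda>v. g (x # v)) w"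

lemma twist_0 [simp]: "twist 0 f = f"
  by (simp add: twist_def fun_eq_iff)

lemma twist_twist: "twist i (twist j f) = twist (i + j) f"
  by (simp add: twist_def fun_eq_iff distrib_right parity_sign_add)

lemma twist_add: "twist i (\<lambda>w. f w + g w) = (\<lambda>w. twist i f w + twist i g w)"
  by (simp add: twist_def fun_eq_iff algebra_simps)

lemma twist_scale: "twist i (\<lambda>w. c * f w) = (\<lambda>w. c * twist i f w)"
  by (simp add: twist_def fun_eq_iff)

lemma twist_translate:
  "(\<lambda>v. twist i f (x # v)) = (\<lambda>v. parity_sign (i * fst x) * twist i (\<lambda>v. f (x # v)) v)"
  by (simp add: twist_def fun_eq_iff distrib_left parity_sign_add)

lemma super_shuffle_coproduct:
  "super_shuffle f g w = (\<Sum>(c, u, v)\<leftarrow>coproduct_terms w.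
     c * parity_sign (word_parity u * word_parity v) * f u * g v)"
proof (induction w arbitrary: f g)
  case (Cons x w)
  have concat: "sum_list (map h (concat (map k xs))) = (\<Sum>t\<leftarrow>xs. sum_list (map h (k t)))"
    for h :: "'b \<Rightarrow> complex" and k :: "'c \<Rightarrow> _" and xs
    by (induction xs) auto
  have sign: "parity_sign (a * i) * parity_sign (i * (a + j)) = parity_sign (i * j)" for a i j
    by (simp add: distrib_left parity_sign_add mult.assoc[symmetric] parity_sign_square mult.commute[of a i])
  show ?case
    unfolding super_shuffle.simps Cons.IH coproduct_terms.simps concat sum_list_addf[symmetric]
    by (rule arg_cong[of _ _ sum_list], rule map_cong[OF refl])
      (auto simp: twist_def distrib_right parity_sign_add sign[symmetric])
qed simp

lemma shuffle_zero_left [simp]: "super_shuffle (\<lambda>v. 0) g w = 0"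
  by (induction w arbitrary: g) auto

lemma shuffle_zero_right [simp]: "super_shuffle f (\<lambda>v. 0) w = 0"
  by (induction w arbitrary: f) (auto simp: twist_def[abs_def])

lemma shuffle_add_left:
  "super_shuffle (\<lambda>v. f v + f' v) g w = super_shuffle f g w + super_shuffle f' g w"
  by (induction w arbitrary: f f' g) (auto simp: algebra_simps)

lemma shuffle_add_right:
  "super_shuffle f (\<lambda>v. g v + g' v) w = super_shuffle f g w + super_shuffle f g' w"
  by (induction w arbitrary: f g g') (auto simp: algebra_simps twist_add)

lemma shuffle_scale_left: "super_shuffle (\<lambda>v. c * f v) g w = c * super_shuffle f g w"
  by (induction w arbitrary: f g) (auto simp: algebra_simps)

lemma shuffle_scale_right: "super_shuffle f (\<lambda>v. c * g v) w = c * super_shuffle f g w"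
  by (induction w arbitrary: f g) (auto simp: algebra_simps twist_scale)

lemma twist_shuffle: "twist i (super_shuffle f g) = super_shuffle (twist i f) (twist i g)"
proof
  fix w
  show "twist i (super_shuffle f g) w = super_shuffle (twist i f) (twist i g) w"
  proof (induction w arbitrary: f g)
    case (Cons x w)
    have "twist i (super_shuffle f g) (x # w) = parity_sign (i * fst x) *
       (twist i (super_shuffle (\<lambda>v. f (x # v)) (twist (fst x) g)) w
        + twist i (super_shuffle f (\<lambda>v. g (x # v))) w)"
      by (simp add: twist_def distrib_left parity_sign_add)
    then show ?case
      unfolding Cons.IH
      by (simp add: twist_translate shuffle_scale_left shuffle_scale_right twist_twist add.commute algebra_simps)
  qed (simp add: twist_def)
qed

text \<open>By induction on the word, with all three factors varying, because the recursion
  replaces them by translates and twists.\<close>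

lemma shuffle_assoc:
  "super_shuffle (super_shuffle f g) h w = super_shuffle f (super_shuffle g h) w"
proof (induction w arbitrary: f g h)
  case (Cons x w)
  show ?case
    by (simp add: twist_shuffle shuffle_add_left shuffle_add_right Cons.IH)
qed simp

lemma shuffle_unit_left: "super_shuffle (\<lambda>v. of_bool (v = [])) g w = g w"
  by (induction w arbitrary: g) auto

lemma shuffle_commute_even:
  "(\<forall>x\<in>set w. fst x = 0) \<Longrightarrow> super_shuffle f g w = super_shuffle g f w"
  by (induction w arbitrary: f g) auto

lemma shuffle_cong:
  assumes "\<And>v. v \<in> lists A \<Longrightarrow> f v = f' v" "\<And>v. v \<in> lists A \<Longrightarrow> g v = g' v" "w \<in> lists A"
  shows "super_shuffle f g w = super_shuffle f' g' w"
  using assms(3,1,2)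
proof (induction w arbitrary: f g f' g')
  case (Cons x w)
  have "twist i g v = twist i g' v" if "v \<in> lists A" for i v
    using Cons.prems(2) that by (simp add: twist_def)
  then have "super_shuffle (\<lambda>v. f (x # v)) (twist (fst x) g) w = super_shuffle (\<lambda>v. f' (x # v)) (twist (fst x) g') w"
    using Cons.prems Cons.hyps by (intro Cons.IH) auto
  moreover have "super_shuffle f (\<lambda>v. g (x # v)) w = super_shuffle f' (\<lambda>v. g' (x # v)) w"
    using Cons.prems Cons.hyps by (intro Cons.IH) auto
  ultimately show ?case by simp
qed simp

lemma coproduct_terms_lists:
  "w \<in> lists A \<Longrightarrow> (c, u, v) \<in> set (coproduct_terms w) \<Longrightarrow> u \<in> lists A \<and> v \<in> lists A"
  by (induction w arbitrary: c u v) fastforce+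

context enveloping
begin

lemma word_functional_zero: "word_functional (\<lambda>w. 0)"
  by (simp add: word_functional_def)

lemma word_functional_sum:
  assumes f: "word_functional f" and g: "word_functional g"
  shows "word_functional (\<lambda>w. f w + g w)"
  unfolding word_functional_def
proof (intro conjI allI impI)
  fix u v i j x y assume *: "x \<in> V \<inter> part L i" "y \<in> V \<inter> part L j"
  show "f (u @ (i, x) # (j, y) # v) + g (u @ (i, x) # (j, y) # v) =
       parity_sign (i * j) * (f (u @ (j, y) # (i, x) # v) + g (u @ (j, y) # (i, x) # v)) +
       (f (u @ (i + j, b x y) # v) + g (u @ (i + j, b x y) # v))"
    by (simp add: word_functional_commute[OF f *] word_functional_commute[OF g *] algebra_simps)
qed (simp_all add: word_functional_support[OF f] word_functional_support[OF g] word_functional_add[OF f] word_functional_add[OF g] word_functional_scale[OF f]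
    word_functional_scale[OF g] algebra_simps del: in_lists_conv_set)

lemma word_functional_smult:
  assumes f: "word_functional f" shows "word_functional (\<lambda>w. c * f w)"
  unfolding word_functional_def
proof (intro conjI allI impI)
  fix u v i j x y assume *: "x \<in> V \<inter> part L i" "y \<in> V \<inter> part L j"
  show "c * f (u @ (i, x) # (j, y) # v) =
       parity_sign (i * j) * (c * f (u @ (j, y) # (i, x) # v)) + c * f (u @ (i + j, b x y) # v)"
    by (simp add: word_functional_commute[OF f *] algebra_simps)
qed (simp_all add: word_functional_support[OF f] word_functional_add[OF f] word_functional_scale[OF f] algebra_simps del: in_lists_conv_set)

lemma word_functional_translate:
  assumes f: "word_functional f" shows "word_functional (\<lambda>w. f (z # w))"
  unfolding word_functional_def
proof (intro conjI allI impI)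
  fix w assume "w \<notin> lists S"
  then show "f (z # w) = 0" by (intro word_functional_support[OF f]) simp
next
  fix u v i j x y assume *: "x \<in> V \<inter> part L i" "y \<in> V \<inter> part L j"
  show "f (z # u @ (i, x) # (j, y) # v) =
      parity_sign (i * j) * f (z # u @ (j, y) # (i, x) # v) + f (z # u @ (i + j, b x y) # v)"
    using word_functional_commute[OF f *, of "z # u" v] by simp
qed (use word_functional_add[OF f, where u = "z # _"] word_functional_scale[OF f, where u = "z # _"] in simp_all)

lemma word_functional_parity:
  assumes "word_functional f" shows "word_functional (\<lambda>w. h (word_parity w) * f w)"
  unfolding word_functional_def
proof (intro conjI allI impI)
  fix u v i j x y assume *: "x \<in> V \<inter> part L i" "y \<in> V \<inter> part L j"
  show "h (word_parity (u @ (i, x) # (j, y) # v)) * f (u @ (i, x) # (j, y) # v) =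
       parity_sign (i * j) * (h (word_parity (u @ (j, y) # (i, x) # v)) * f (u @ (j, y) # (i, x) # v)) +
       h (word_parity (u @ (i + j, b x y) # v)) * f (u @ (i + j, b x y) # v)"
    by (simp add: word_functional_commute[OF assms *] algebra_simps)
qed (simp_all add: word_functional_support[OF assms] word_functional_add[OF assms] word_functional_scale[OF assms] algebra_simps del: in_lists_conv_set)

lemma word_functional_twist: "word_functional f \<Longrightarrow> word_functional (twist i f)"
  using word_functional_parity[of f "\<lambda>j. parity_sign (i * j)"] by (simp add: twist_def[abs_def])

text \<open>The relations span a coideal. After stripping the prefix \<open>u\<close> by the recursion, one has to
  check each relation at the start of a word. For the supercommutator, the terms in which \<open>x\<close> and \<open>y\<close>
  go to different factors cancel, as the signs of \<open>twist\<close> account for their interchange.\<close>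

lemma word_functional_shuffle:
  assumes "word_functional f" "word_functional g"
  shows "word_functional (super_shuffle f g)"
proof -
  have support: "super_shuffle f g w = 0"
    if "word_functional f" "word_functional g" "w \<notin> lists S" for f g w
    using that
  proof (induction w arbitrary: f g)
    case (Cons x w)
    show ?case
    proof (cases "x \<in> S")
      case True
      then have "w \<notin> lists S" using Cons.prems(3) by simp
      with Cons show ?thesis by (simp add: word_functional_translate word_functional_twist del: in_lists_conv_set)
    next
      case False
      then have "(\<lambda>v. f (x # v)) = (\<lambda>v. 0)" "(\<lambda>v. g (x # v)) = (\<lambda>v. 0)"
        using word_functional_support[OF Cons.prems(1), of "x # _"] word_functional_support[OF Cons.prems(2), of "x # _"] by auto
      then show ?thesis by simp
    qed
  qed simp
  have add: "super_shuffle f g (u @ (i, x + y) # v)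
      = super_shuffle f g (u @ (i, x) # v) + super_shuffle f g (u @ (i, y) # v)"
    if "word_functional f" "word_functional g" "x \<in> V \<inter> part L i" "y \<in> V \<inter> part L i" for f g u v i x y
    using that
  proof (induction u arbitrary: f g)
    case Nil
    then show ?case
      using word_functional_add[of f x i y "[]"] word_functional_add[of g x i y "[]"]
      by (simp add: shuffle_add_left shuffle_add_right)
  next
    case (Cons z u)
    then show ?case by (simp add: word_functional_translate word_functional_twist)
  qed
  have scale: "super_shuffle f g (u @ (i, scale L c x) # v) = c * super_shuffle f g (u @ (i, x) # v)"
    if "word_functional f" "word_functional g" "x \<in> V \<inter> part L i" for f g u v i c x
    using that
  proof (induction u arbitrary: f g)
    case Nil
    then show ?case
      using word_functional_scale[of f x i "[]"] word_functional_scale[of g x i "[]"]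
      by (simp add: shuffle_scale_left shuffle_scale_right distrib_left)
  next
    case (Cons z u)
    then show ?case by (simp add: word_functional_translate word_functional_twist distrib_left)
  qed
  have commute: "super_shuffle f g (u @ (i, x) # (j, y) # v)
      = parity_sign (i * j) * super_shuffle f g (u @ (j, y) # (i, x) # v)
        + super_shuffle f g (u @ (i + j, b x y) # v)"
    if "word_functional f" "word_functional g" "x \<in> V \<inter> part L i" "y \<in> V \<inter> part L j" for f g u v i j x y
    using that
  proof (induction u arbitrary: f g)
    case Nil
    have fg: "(\<lambda>w. f ((i, x) # (j, y) # w)) = (\<lambda>w. parity_sign (i * j) * f ((j, y) # (i, x) # w) + f ((i + j, b x y) # w))"
      "(\<lambda>w. g ((i, x) # (j, y) # w)) = (\<lambda>w. parity_sign (i * j) * g ((j, y) # (i, x) # w) + g ((i + j, b x y) # w))"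
      using word_functional_commute[OF Nil(1,3,4), of "[]"] word_functional_commute[OF Nil(2,3,4), of "[]"] unfolding append_Nil by blast+
    show ?case
      unfolding append_Nil super_shuffle.simps fst_conv fg twist_twist twist_translate
        shuffle_add_left shuffle_add_right shuffle_scale_left shuffle_scale_right
      by (cases i; cases j) simp_all
  next
    case (Cons z u)
    then show ?case by (simp add: word_functional_translate word_functional_twist algebra_simps)
  qed
  show ?thesis
    unfolding word_functional_def
    by (intro conjI allI impI support[OF assms] add[OF assms] scale[OF assms] commute[OF assms])
qed

lemma word_functional_counit: "word_functional (\<lambda>w. of_bool (w = []))"
  by (auto simp: word_functional_def)

lemma counit_functional_of: "counit L V b = functional_of (\<lambda>w. of_bool (w = []))"
proof -
  have "lin (\<lambda>w. of_bool (w = [])) p = Poly_Mapping.lookup p []" for p :: "'g free"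
    by (auto simp: lin_def of_bool_def if_distrib sum.delta in_keys_iff cong: if_cong)
  then show ?thesis by (simp add: counit_def functional_of_def)
qed

lemma functional_part_single:
  assumes \<psi>: "\<psi> \<in> linear_functionals E" and v: "v \<in> lists S"
  shows "functional_part L V b i \<psi> (cls (Poly_Mapping.single v 1))
    = (if word_parity v = i then word_values \<psi> v else 0)"
proof -
  let ?h = "\<lambda>w. of_bool (word_parity w = i) * word_values \<psi> w"
  have h: "word_functional ?h"
    using word_functional_parity[OF word_values_functional[OF \<psi>], of "\<lambda>j. of_bool (j = i)"] .
  have part: "free_part i p \<in> carrier F" "lin (word_values \<psi>) (free_part i p) = lin ?h p"
    if "p \<in> carrier F" for p
  proof -
    show "free_part i p \<in> carrier F" unfolding free_part_def
      using that by (intro free_algebra_sum_closed) (auto simp: carrier_free_algebra)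
    show "lin (word_values \<psi>) (free_part i p) = lin ?h p"
      unfolding free_part_def lin_sum lin_single unfolding lin_def
      by (rule sum.mono_neutral_cong_left) auto
  qed
  have single: "Poly_Mapping.single v 1 \<in> carrier F" using v by (rule single_in_free_algebra)
  have rep: "coset_rep (cls (Poly_Mapping.single v 1)) \<in> carrier F"
    by (rule coset_rep_props(1)[OF cls_closed[OF single]])
  have "functional_part L V b i \<psi> (cls (Poly_Mapping.single v 1))
    = \<psi> (cls (free_part i (coset_rep (cls (Poly_Mapping.single v 1)))))"
    by (simp add: functional_part_def cls_closed[OF single])
  also have "\<dots> = lin ?h (coset_rep (cls (Poly_Mapping.single v 1)))"
    using functional_eq_lin[OF \<psi> part(1)[OF rep]] part(2)[OF rep] by simp
  also have "\<dots> = lin ?h (Poly_Mapping.single v 1)"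
    using functional_of_cls[OF h single] by (simp add: functional_of_def cls_closed[OF single])
  finally show ?thesis by simp
qed

text \<open>Only the component of \<open>\<psi>\<close> whose parity is that of \<open>v\<close> contributes to a term \<open>u \<otimes> v\<close>, so the
  sum over the two components of \<open>\<psi>\<close> collapses to the sign \<open>(-1)^(|u||v|)\<close>.\<close>

lemma dual_mult_functional_of:
  assumes \<phi>: "\<phi> \<in> linear_functionals E" and \<psi>: "\<psi> \<in> linear_functionals E"
  shows "dual_mult L V b \<phi> \<psi> = functional_of (super_shuffle (word_values \<phi>) (word_values \<psi>))"
proof -
  have "(\<Sum>i\<in>{0, 1}. \<Sum>(c, u, v)\<leftarrow>coproduct_terms w.
             c * parity_sign (word_parity u * i)
               * \<phi> (cls (Poly_Mapping.single u 1))
               * functional_part L V b i \<psi> (cls (Poly_Mapping.single v 1)))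
      = super_shuffle (word_values \<phi>) (word_values \<psi>) w" (is "?l = _") if w: "w \<in> lists S" for w
  proof -
    have "?l = (\<Sum>(c, u, v)\<leftarrow>coproduct_terms w. \<Sum>i\<in>{0, 1}.
             c * parity_sign (word_parity u * i)
               * \<phi> (cls (Poly_Mapping.single u 1))
               * functional_part L V b i \<psi> (cls (Poly_Mapping.single v 1)))"
      by (simp add: sum_list_addf[symmetric] case_prod_unfold)
    also have "\<dots> = (\<Sum>(c, u, v)\<leftarrow>coproduct_terms w.
        c * parity_sign (word_parity u * word_parity v) * word_values \<phi> u * word_values \<psi> v)"
    proof (rule arg_cong[of _ _ sum_list], rule map_cong[OF refl])
      fix t assume t: "t \<in> set (coproduct_terms w)"
      obtain c u v where [simp]: "t = (c, u, v)" by (cases t)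
      have uv: "u \<in> lists S" "v \<in> lists S" using coproduct_terms_lists[OF w] t by auto
      show "(case t of (c, u, v) \<Rightarrow> \<Sum>i\<in>{0, 1}.
             c * parity_sign (word_parity u * i)
               * \<phi> (cls (Poly_Mapping.single u 1))
               * functional_part L V b i \<psi> (cls (Poly_Mapping.single v 1)))
        = (case t of (c, u, v) \<Rightarrow>
            c * parity_sign (word_parity u * word_parity v) * word_values \<phi> u * word_values \<psi> v)"
        using uv by (cases "word_parity v") (simp_all add: functional_part_single[OF \<psi>] word_values_def)
    qed
    finally show ?thesis by (simp add: super_shuffle_coproduct)
  qed
  moreover have "w \<in> lists S" if "X \<in> carrier E" "w \<in> Poly_Mapping.keys (coset_rep X)" for X w
    using coset_rep_props(1)[OF that(1)] that(2) by (auto simp: carrier_free_algebra)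
  ultimately show ?thesis
    unfolding dual_mult_def functional_of_def lin_def
    by (intro restrict_ext sum.cong refl) simp
qed

end

section \<open>Algebra structures transported along injections\<close>

text \<open>Every law of \<open>A\<close> is an equation that can be tested after applying \<open>f\<close>. Negatives exist
  because they are multiples by \<open>-1\<close>.\<close>

lemma algebra_of_injection:
  assumes "algebra R B"
    and inj: "inj_on f (carrier A)"
    and range: "\<And>x. x \<in> carrier A \<Longrightarrow> f x \<in> carrier B"
    and mult: "\<And>x y. x \<in> carrier A \<Longrightarrow> y \<in> carrier A \<Longrightarrow>
      x \<otimes>\<^bsub>A\<^esub> y \<in> carrier A \<and> f (x \<otimes>\<^bsub>A\<^esub> y) = f x \<otimes>\<^bsub>B\<^esub> f y"
    and add: "\<And>x y. x \<in> carrier A \<Longrightarrow> y \<in> carrier A \<Longrightarrow>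
      x \<oplus>\<^bsub>A\<^esub> y \<in> carrier A \<and> f (x \<oplus>\<^bsub>A\<^esub> y) = f x \<oplus>\<^bsub>B\<^esub> f y"
    and smult: "\<And>c x. c \<in> carrier R \<Longrightarrow> x \<in> carrier A \<Longrightarrow>
      c \<odot>\<^bsub>A\<^esub> x \<in> carrier A \<and> f (c \<odot>\<^bsub>A\<^esub> x) = c \<odot>\<^bsub>B\<^esub> f x"
    and one: "\<one>\<^bsub>A\<^esub> \<in> carrier A" "f \<one>\<^bsub>A\<^esub> = \<one>\<^bsub>B\<^esub>"
    and zero: "\<zero>\<^bsub>A\<^esub> \<in> carrier A" "f \<zero>\<^bsub>A\<^esub> = \<zero>\<^bsub>B\<^esub>"
  shows "algebra R A"
proof -
  interpret B: algebra R B by fact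
  note closed = mult[THEN conjunct1] add[THEN conjunct1] smult[THEN conjunct1] one(1) zero(1)
  note image = mult[THEN conjunct2] add[THEN conjunct2] smult[THEN conjunct2] one(2) zero(2)
  have eqI: "x = y" if "f x = f y" "x \<in> carrier A" "y \<in> carrier A" for x y
    using inj that by (rule inj_onD)
  show ?thesis
  proof (rule algebraI)
    show "cring R" by (rule B.R_cring)
    show "cring A"
    proof (rule cringI)
      show "abelian_group A"
      proof (rule abelian_groupI)
        fix x assume x: "x \<in> carrier A"
        let ?y = "(\<ominus>\<^bsub>R\<^esub> \<one>\<^bsub>R\<^esub>) \<odot>\<^bsub>A\<^esub> x"
        have "f (?y \<oplus>\<^bsub>A\<^esub> x) = f \<zero>\<^bsub>A\<^esub>"
          using x range[OF x] by (simp add: image closed B.smult_l_minus B.M.l_neg)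
        then have "?y \<oplus>\<^bsub>A\<^esub> x = \<zero>\<^bsub>A\<^esub>" by (rule eqI) (simp_all add: closed x)
        then show "\<exists>y\<in>carrier A. y \<oplus>\<^bsub>A\<^esub> x = \<zero>\<^bsub>A\<^esub>" using x closed(3)[of "\<ominus>\<^bsub>R\<^esub> \<one>\<^bsub>R\<^esub>" x] by auto
      qed (auto intro!: eqI simp: closed image range B.M.add.m_ac)
      show "comm_monoid A"
        by (rule comm_monoidI) (auto intro!: eqI simp: closed image range B.m_ac)
    qed (auto intro!: eqI simp: closed image range B.l_distr)
  qed (auto intro!: eqI simp: closed image range B.smult_l_distr B.smult_r_distr B.smult_assoc1 B.smult_assoc2)
qed

lemma cring_complex_field: "cring complex_field"
proof (rule cringI)
  show "abelian_group complex_field"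
    by (rule abelian_groupI) (auto simp: complex_field_def intro: exI[of _ "- _"])
  show "comm_monoid complex_field"
    by (rule comm_monoidI) (auto simp: complex_field_def)
qed (auto simp: complex_field_def algebra_simps)

section \<open>The dual algebra in terms of word functions\<close>

context enveloping
begin

lemma linear_functionals_eq: "linear_functionals E = functional_of ` Collect word_functional"
proof
  show "linear_functionals E \<subseteq> functional_of ` Collect word_functional"
    using functional_of_word_values word_values_functional by (metis image_eqI mem_Collect_eq subsetI)
qed (auto intro: functional_of_linear)

lemma carrier_env_dual: "carrier (env_dual L V b) = functional_of ` Collect word_functional"
  by (simp add: env_dual_def linear_functionals_eq)

lemma functional_of_mult:
  "word_functional f \<Longrightarrow> word_functional g \<Longrightarrow>
    functional_of f \<otimes>\<^bsub>env_dual L V b\<^esub> functional_of g = functional_of (super_shuffle f g)"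
  by (simp add: env_dual_def dual_mult_functional_of functional_of_linear word_values_functional_of)

lemma functional_of_add:
  "functional_of f \<oplus>\<^bsub>env_dual L V b\<^esub> functional_of g = functional_of (\<lambda>w. f w + g w)"
  by (auto simp: env_dual_def functional_of_def lin_fun_add intro!: restrict_ext)

lemma functional_of_smult:
  "c \<odot>\<^bsub>env_dual L V b\<^esub> functional_of f = functional_of (\<lambda>w. c * f w)"
  by (auto simp: env_dual_def functional_of_def lin_fun_smult intro!: restrict_ext)

lemma functional_of_one: "\<one>\<^bsub>env_dual L V b\<^esub> = functional_of (\<lambda>w. of_bool (w = []))"
  by (simp add: env_dual_def counit_functional_of)

lemma functional_of_zero: "\<zero>\<^bsub>env_dual L V b\<^esub> = functional_of (\<lambda>w. 0)"
  by (simp add: env_dual_def functional_of_def)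

lemma functional_of_inj:
  "word_functional f \<Longrightarrow> word_functional g \<Longrightarrow> functional_of f = functional_of g \<longleftrightarrow> f = g"
  using word_values_functional_of by metis

text \<open>The letter \<open>(1, 0)\<close> is odd by its tag, but a word containing it has the value 0.\<close>

lemma word_functional_commute_even:
  assumes even: "\<And>x. x \<in> V \<inter> part L 1 \<Longrightarrow> x = 0"
    and f: "word_functional f" and g: "word_functional g"
  shows "super_shuffle f g = super_shuffle g f"
proof
  fix w
  consider "w \<notin> lists S" | "\<forall>x\<in>set w. fst x = 0" | z where "w \<in> lists S" "z \<in> set w" "fst z = 1"
    using bit_not_one_iff by blast
  then show "super_shuffle f g w = super_shuffle g f w"
  proof cases
    case 1
    then show ?thesis using word_functional_support[OF word_functional_shuffle] f g by metis
  next
    case 2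
    then show ?thesis by (rule shuffle_commute_even)
  next
    case 3
    then have "z \<in> S" by auto
    then have "z = (1, 0)" using even[of "snd z"] 3 by (cases z) (auto simp: in_letters)
    then obtain u v where "w = u @ (1, 0) # v" using 3 by (meson split_list)
    then show ?thesis using word_functional_zero_letter[OF word_functional_shuffle] f g by metis
  qed
qed

lemma algebra_env_dual:
  assumes even: "\<And>x. x \<in> V \<inter> part L 1 \<Longrightarrow> x = 0"
  shows "algebra complex_field (env_dual L V b)"
proof -
  let ?A = "env_dual L V b"
  have elim: "x \<in> carrier ?A \<Longrightarrow> \<exists>f. word_functional f \<and> x = functional_of f" for x
    by (auto simp: carrier_env_dual)
  have intro: "word_functional f \<Longrightarrow> functional_of f \<in> carrier ?A" for f
    by (auto simp: carrier_env_dual)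
  note ops = functional_of_mult functional_of_add functional_of_smult functional_of_one functional_of_zero
    intro word_functional_zero word_functional_sum word_functional_smult word_functional_shuffle word_functional_counit
  show ?thesis
  proof (rule algebraI[OF cring_complex_field])
    show "cring ?A"
    proof (rule cringI)
      show "abelian_group ?A"
      proof (rule abelian_groupI)
        fix x assume "x \<in> carrier ?A"
        then obtain f where f: "word_functional f" "x = functional_of f" using elim by blast
        then have "functional_of (\<lambda>w. - 1 * f w) \<oplus>\<^bsub>?A\<^esub> x = \<zero>\<^bsub>?A\<^esub>" by (simp add: ops)
        then show "\<exists>y\<in>carrier ?A. y \<oplus>\<^bsub>?A\<^esub> x = \<zero>\<^bsub>?A\<^esub>" using intro[OF word_functional_smult[OF f(1)]] by blast
      qed (auto dest!: elim simp: ops add_ac)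
      show "comm_monoid ?A"
      proof (rule comm_monoidI)
        fix x y assume "x \<in> carrier ?A" "y \<in> carrier ?A"
        then show "x \<otimes>\<^bsub>?A\<^esub> y = y \<otimes>\<^bsub>?A\<^esub> x"
          by (auto dest!: elim simp: ops intro!: arg_cong[of _ _ functional_of] word_functional_commute_even[OF even])
      next
        fix x y z assume "x \<in> carrier ?A" "y \<in> carrier ?A" "z \<in> carrier ?A"
        moreover have "super_shuffle (super_shuffle f g) h = super_shuffle f (super_shuffle g h)" for f g h :: "'g word \<Rightarrow> complex"
          using shuffle_assoc by blast
        ultimately show "(x \<otimes>\<^bsub>?A\<^esub> y) \<otimes>\<^bsub>?A\<^esub> z = x \<otimes>\<^bsub>?A\<^esub> (y \<otimes>\<^bsub>?A\<^esub> z)"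
          by (auto dest!: elim simp: ops)
      next
        fix x assume "x \<in> carrier ?A"
        moreover have "super_shuffle (\<lambda>v. of_bool (v = [])) g = g" for g :: "'g word \<Rightarrow> complex"
          using shuffle_unit_left by blast
        ultimately show "\<one>\<^bsub>?A\<^esub> \<otimes>\<^bsub>?A\<^esub> x = x"
          by (auto dest!: elim simp: ops)
      qed (auto dest!: elim simp: ops)
    next
      fix x y z assume "x \<in> carrier ?A" "y \<in> carrier ?A" "z \<in> carrier ?A"
      moreover have "super_shuffle (\<lambda>v. f v + f' v) g = (\<lambda>w. super_shuffle f g w + super_shuffle f' g w)"
        for f f' g :: "'g word \<Rightarrow> complex"
        using shuffle_add_left by blast
      ultimately show "(x \<oplus>\<^bsub>?A\<^esub> y) \<otimes>\<^bsub>?A\<^esub> z = x \<otimes>\<^bsub>?A\<^esub> z \<oplus>\<^bsub>?A\<^esub> y \<otimes>\<^bsub>?A\<^esub> z"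
        by (auto dest!: elim simp: ops)
    qed
  next
    fix c x y assume "x \<in> carrier ?A" "y \<in> carrier ?A"
    moreover have "super_shuffle (\<lambda>v. c * f v) g = (\<lambda>w. c * super_shuffle f g w)"
      for f g :: "'g word \<Rightarrow> complex"
      using shuffle_scale_left by blast
    ultimately show "(c \<odot>\<^bsub>?A\<^esub> x) \<otimes>\<^bsub>?A\<^esub> y = c \<odot>\<^bsub>?A\<^esub> (x \<otimes>\<^bsub>?A\<^esub> y)"
      by (auto dest!: elim simp: ops)
  qed (auto dest!: elim simp: ops complex_field_def algebra_simps)
qed

lemma functional_vanishes_generate:
  assumes \<phi>: "\<phi> \<in> linear_functionals E" and H: "\<And>h. h \<in> H \<Longrightarrow> h \<in> carrier E \<and> \<phi> h = 0"
    and X: "X \<in> generate (add_monoid E) H"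
  shows "X \<in> carrier E \<and> \<phi> X = 0"
proof -
  interpret E: ring E by (rule ring_E)
  have add: "\<phi> (x \<oplus>\<^bsub>E\<^esub> y) = \<phi> x + \<phi> y" if "x \<in> carrier E" "y \<in> carrier E" for x y
    using \<phi> that by (simp add: linear_functionals_def)
  have zero: "\<phi> \<zero>\<^bsub>E\<^esub> = 0" using add[of "\<zero>\<^bsub>E\<^esub>" "\<zero>\<^bsub>E\<^esub>"] by simp
  from X show ?thesis
  proof induction
    case (inv h)
    have "inv\<^bsub>add_monoid E\<^esub> h \<in> carrier E" using H[OF inv] E.add.inv_closed by simp
    moreover have "\<phi> (inv\<^bsub>add_monoid E\<^esub> h \<oplus>\<^bsub>E\<^esub> h) = 0"
      using H[OF inv] E.add.l_inv[of h] zero by simp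
    ultimately show ?case using add[of "inv\<^bsub>add_monoid E\<^esub> h" h] H[OF inv] by simp
  qed (use H add zero in auto)
qed

end

section \<open>Functionals vanishing on the image of a subspace from both sides\<close>

definition biannihilates :: "'g lie_super \<Rightarrow> 'g set \<Rightarrow> ('g word \<Rightarrow> complex) \<Rightarrow> bool" where
  "biannihilates L K f \<longleftrightarrow>
     (\<forall>i x w. x \<in> K \<inter> part L i \<longrightarrow> f ((i, x) # w) = 0 \<and> f (w @ [(i, x)]) = 0)"

text \<open>The first or last letter of the word goes to one of the two factors, which then vanishes.\<close>

lemma biannihilates_shuffle:
  assumes "biannihilates L K f" "biannihilates L K g"
  shows "biannihilates L K (super_shuffle f g)"
proof -
  have left: "(\<lambda>v. f ((i, x) # v)) = (\<lambda>v. 0)" "(\<lambda>v. g ((i, x) # v)) = (\<lambda>v. 0)"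
    if "x \<in> K \<inter> part L i" for x i
    using assms that by (auto simp: biannihilates_def)
  have right: "super_shuffle f g (w @ [z]) = 0"
    if "\<And>v. f (v @ [z]) = 0" "\<And>v. g (v @ [z]) = 0" for f g :: "'a word \<Rightarrow> complex" and w z
    using that
  proof (induction w arbitrary: f g)
    case Nil
    then show ?case using Nil(1)[of "[]"] Nil(2)[of "[]"] by simp
  next
    case (Cons y w)
    have 1: "super_shuffle (\<lambda>v. f (y # v)) (twist (fst y) g) (w @ [z]) = 0"
      using Cons.prems(1)[of "y # _"] Cons.prems(2) by (intro Cons.IH) (simp_all add: twist_def)
    have 2: "super_shuffle f (\<lambda>v. g (y # v)) (w @ [z]) = 0"
      using Cons.prems(2)[of "y # _"] Cons.prems(1) by (intro Cons.IH) simp_all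
    show ?case using 1 2 by simp
  qed
  show ?thesis
    unfolding biannihilates_def using left right[of f _ g] assms
    by (auto simp: biannihilates_def)
qed

lemma enveloping_UNIV:
  assumes "lie_superalgebra L" shows "enveloping L UNIV (bracket L)"
proof (rule enveloping.intro)
  interpret vector_space "scale L" using assms by (rule lie_superalgebra.vector_space)
  show "lie_superalgebra L" by fact
  show "linear_subspace L UNIV" by (simp add: linear_subspace_def)
qed (use lie_superalgebra.graded[OF assms] in auto)

text \<open>A functional vanishes on \<open>\<I>\<close> as soon as it vanishes on the products of a letter from \<open>K\<close> with
  words, because words span the enveloping algebra.\<close>

lemma A_alg_carrier:
  fixes L :: "'g::ab_group_add lie_super"
  assumes "lie_superalgebra L"
  shows "carrier (A_alg L K) = {\<phi> \<in> linear_functionals (U L).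
    biannihilates L K (enveloping.word_values L UNIV (bracket L) \<phi>)}"
proof -
  interpret U: enveloping L UNIV "bracket L" using assms by (rule enveloping_UNIV)
  interpret E: ring U.E by (rule U.ring_E)
  let ?H1 = "{x \<otimes>\<^bsub>U L\<^esub> u | x u. x \<in> K_image L K \<and> u \<in> carrier (U L)}"
  let ?H2 = "{u \<otimes>\<^bsub>U L\<^esub> x | x u. x \<in> K_image L K \<and> u \<in> carrier (U L)}"
  have U: "U L = U.E" by (simp add: U_def)
  have gen: "generator i x \<in> carrier U.F" if "x \<in> part L i" for i x
    using U.generator_closed that by simp
  have "(\<forall>X\<in>I_space L K. \<phi> X = 0) \<longleftrightarrow> biannihilates L K (U.word_values \<phi>)"
    if \<phi>: "\<phi> \<in> linear_functionals U.E" for \<phi>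
  proof
    assume *: "\<forall>X\<in>I_space L K. \<phi> X = 0"
    have I: "X \<in> I_space L K" if "X \<in> ?H1 \<union> ?H2" "X \<in> carrier U.E" for X
    proof -
      have zero: "\<zero>\<^bsub>U.E\<^esub> \<in> K_times_U L K" "\<zero>\<^bsub>U.E\<^esub> \<in> U_times_K L K"
        using generate.one[of "add_monoid U.E"] by (auto simp: K_times_U_def U_times_K_def U)
      have sum: "A \<in> K_times_U L K \<Longrightarrow> B \<in> U_times_K L K \<Longrightarrow> A \<oplus>\<^bsub>U.E\<^esub> B \<in> I_space L K" for A B
        by (auto simp: I_space_def set_add_def set_mult_def U)
      show ?thesis
        using that sum[of X "\<zero>\<^bsub>U.E\<^esub>"] sum[of "\<zero>\<^bsub>U.E\<^esub>" X] zero
        by (auto simp: K_times_U_def U_times_K_def intro: generate.incl)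
    qed
    show "biannihilates L K (U.word_values \<phi>)"
      unfolding biannihilates_def
    proof (intro allI impI conjI)
      fix i x w assume x: "x \<in> K \<inter> part L i"
      have img: "U.cls (generator i x) \<in> K_image L K" using x by (auto simp: K_image_def)
      have val: "\<phi> (U.cls (generator i x) \<otimes>\<^bsub>U.E\<^esub> U.cls p) = 0"
        "\<phi> (U.cls p \<otimes>\<^bsub>U.E\<^esub> U.cls (generator i x)) = 0" if p: "p \<in> carrier U.F" for p
      proof -
        have c: "U.cls (generator i x) \<in> carrier U.E" "U.cls p \<in> carrier U.E"
          using gen[of x i] x p by (simp_all add: U.cls_closed)
        then have "U.cls (generator i x) \<otimes>\<^bsub>U.E\<^esub> U.cls p \<in> ?H1 \<union> ?H2"
          "U.cls p \<otimes>\<^bsub>U.E\<^esub> U.cls (generator i x) \<in> ?H1 \<union> ?H2"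
          using img unfolding U by blast+
        then show "\<phi> (U.cls (generator i x) \<otimes>\<^bsub>U.E\<^esub> U.cls p) = 0"
          "\<phi> (U.cls p \<otimes>\<^bsub>U.E\<^esub> U.cls (generator i x)) = 0"
          using * I E.m_closed c by blast+
      qed
      show "U.word_values \<phi> ((i, x) # w) = 0"
        using val(1)[of "Poly_Mapping.single w 1"] x gen[of x i]
        by (cases "w \<in> lists U.S") (simp_all add: U.word_values_def U.E_mult carrier_free_algebra generator_def
            mult_single plus_list_def del: in_lists_conv_set)
      show "U.word_values \<phi> (w @ [(i, x)]) = 0"
        using val(2)[of "Poly_Mapping.single w 1"] x gen[of x i]
        by (cases "w \<in> lists U.S") (simp_all add: U.word_values_def U.E_mult carrier_free_algebra generator_def
            mult_single plus_list_def del: in_lists_conv_set)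
    qed
  next
    assume *: "biannihilates L K (U.word_values \<phi>)"
    have H: "h \<in> carrier U.E \<and> \<phi> h = 0" if h: "h \<in> ?H1 \<union> ?H2" for h
    proof -
      obtain k u where k: "k \<in> K_image L K" and u: "u \<in> carrier U.E"
        and h: "h = k \<otimes>\<^bsub>U.E\<^esub> u \<or> h = u \<otimes>\<^bsub>U.E\<^esub> k"
        using h unfolding U by blast
      obtain i x where x: "x \<in> K \<inter> part L i" and kx: "k = U.cls (generator i x)"
        using k unfolding K_image_def by blast
      obtain p where p: "p \<in> carrier U.F" and up: "u = U.cls p"
        using u unfolding U.carrier_E by blast
      have h': "h = U.cls (generator i x * p) \<or> h = U.cls (p * generator i x)"
        using h x p gen[of x i] by (simp add: kx up U.E_mult)
      have "lin (U.word_values \<phi>) (generator i x * p) = 0" "lin (U.word_values \<phi>) (p * generator i x) = 0"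
        using * x by (simp_all add: generator_def lin_mult biannihilates_def)
      then show ?thesis
        using h' p gen[of x i] x
        by (auto simp: U.functional_eq_lin[OF \<phi>] U.cls_closed free_algebra_closed)
    qed
    have add: "\<phi> (x \<oplus>\<^bsub>U.E\<^esub> y) = \<phi> x + \<phi> y" if "x \<in> carrier U.E" "y \<in> carrier U.E" for x y
      using \<phi> that by (simp add: linear_functionals_def)
    show "\<forall>X\<in>I_space L K. \<phi> X = 0"
    proof
      fix X assume "X \<in> I_space L K"
      then obtain A B where X: "X = A \<oplus>\<^bsub>U.E\<^esub> B" and A: "A \<in> generate (add_monoid U.E) ?H1"
        and B: "B \<in> generate (add_monoid U.E) ?H2"
        unfolding I_space_def set_add_def set_mult_def K_times_U_def U_times_K_def U by auto
      have "A \<in> carrier U.E \<and> \<phi> A = 0"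
        by (rule U.functional_vanishes_generate[OF \<phi> _ A]) (rule H, blast)
      moreover have "B \<in> carrier U.E \<and> \<phi> B = 0"
        by (rule U.functional_vanishes_generate[OF \<phi> _ B]) (rule H, blast)
      ultimately show "\<phi> X = 0" using X add by simp
    qed
  qed
  then show ?thesis by (auto simp: A_alg_def U_dual_def env_dual_def U)
qed

section \<open>Finite duals through spaces of translates\<close>

definition fscale :: "complex \<Rightarrow> ('a \<Rightarrow> complex) \<Rightarrow> 'a \<Rightarrow> complex" where
  "fscale c f = (\<lambda>w. c * f w)"

interpretation fun_space: vector_space fscale
  by standard (simp_all add: fscale_def fun_eq_iff algebra_simps)

lemma sum_fun_apply: "sum g I w = (\<Sum>i\<in>I. g i w)"
  for g :: "'i \<Rightarrow> 'a \<Rightarrow> complex"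
  by (induction I rule: infinite_finite_induct) auto

text \<open>The translates \<open>w \<mapsto> f (u @ w)\<close> span a space of finite dimension. Letting \<open>F\<close> be
  arbitrary makes the closure properties immediate.\<close>

definition finitely_translated :: "('a list \<Rightarrow> complex) \<Rightarrow> bool" where
  "finitely_translated f \<longleftrightarrow> (\<exists>F. finite F \<and> (\<forall>u. (\<lambda>w. f (u @ w)) \<in> fun_space.span F))"

lemma span_image_linear:
  assumes lin: "\<And>c x y. T (fscale c x + y) = fscale c (T x) + T y" "T 0 = 0" and x: "x \<in> fun_space.span F"
  shows "T x \<in> fun_space.span (T ` F)"
  using x
proof (induction rule: fun_space.span_induct_alt)
  case base
  show ?case by (simp only: lin(2) fun_space.span_zero)
next
  case (step c x y)
  have "fscale c (T x) + T y \<in> fun_space.span (T ` F)"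
    using step by (intro fun_space.span_add[OF fun_space.span_scale[OF fun_space.span_base]]) auto
  then show ?case by (simp only: lin(1))
qed

lemma finitely_translated_sum:
  assumes "finitely_translated f" "finitely_translated g"
  shows "finitely_translated (\<lambda>w. f w + g w)"
proof -
  obtain F G where F: "finite F" "\<And>u. (\<lambda>w. f (u @ w)) \<in> fun_space.span F"
    and G: "finite G" "\<And>u. (\<lambda>w. g (u @ w)) \<in> fun_space.span G"
    using assms by (auto simp: finitely_translated_def)
  have "(\<lambda>w. f (u @ w) + g (u @ w)) \<in> fun_space.span (F \<union> G)" for u
    using fun_space.span_add[of "\<lambda>w. f (u @ w)" "F \<union> G" "\<lambda>w. g (u @ w)"]
      F(2)[of u] G(2)[of u] fun_space.span_mono[of F "F \<union> G"] fun_space.span_mono[of G "F \<union> G"]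
    by (auto simp: plus_fun_def)
  then show ?thesis using F(1) G(1) unfolding finitely_translated_def by blast
qed

lemma finitely_translated_scale:
  assumes "finitely_translated f" shows "finitely_translated (\<lambda>w. c * f w)"
proof -
  obtain F where F: "finite F" "\<And>u. (\<lambda>w. f (u @ w)) \<in> fun_space.span F"
    using assms by (auto simp: finitely_translated_def)
  have "(\<lambda>w. c * f (u @ w)) \<in> fun_space.span F" for u
    using fun_space.span_scale[OF F(2)[of u], of c] by (simp add: fscale_def)
  then show ?thesis using F(1) unfolding finitely_translated_def by blast
qed

lemma finitely_translated_zero: "finitely_translated (\<lambda>w. 0)"
  unfolding finitely_translated_def
  using fun_space.span_zero[of "{}"] by (intro exI[of _ "{}"]) (auto simp: zero_fun_def)

lemma finitely_translated_counit: "finitely_translated (\<lambda>w. of_bool (w = []))"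
proof -
  let ?e = "\<lambda>w. of_bool (w = []) :: complex"
  have "(\<lambda>w. ?e (u @ w)) \<in> fun_space.span {?e}" for u
  proof (cases "u = []")
    case True
    then show ?thesis by (simp add: fun_space.span_base)
  next
    case False
    then have "(\<lambda>w. ?e (u @ w)) = 0" by (auto simp: zero_fun_def)
    then show ?thesis by (simp only: fun_space.span_zero)
  qed
  then show ?thesis unfolding finitely_translated_def by blast
qed

lemma finitely_translated_restrict:
  assumes "finitely_translated f"
  shows "finitely_translated (\<lambda>w. if w \<in> lists A then f w else 0)"
proof -
  let ?r = "\<lambda>f w. if w \<in> lists A then f w else (0::complex)"
  obtain F where F: "finite F" "\<And>u. (\<lambda>w. f (u @ w)) \<in> fun_space.span F"
    using assms by (auto simp: finitely_translated_def)
  have "(\<lambda>w. ?r f (u @ w)) \<in> fun_space.span (?r ` F)" for u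
  proof (cases "u \<in> lists A")
    case True
    then have "(\<lambda>w. ?r f (u @ w)) = ?r (\<lambda>w. f (u @ w))" by auto
    also have "\<dots> \<in> fun_space.span (?r ` F)"
      by (rule span_image_linear[OF _ _ F(2)]) (auto simp: fscale_def fun_eq_iff)
    finally show ?thesis .
  next
    case False
    then have "(\<lambda>w. ?r f (u @ w)) = 0" by (auto simp: zero_fun_def)
    then show ?thesis by (simp only: fun_space.span_zero)
  qed
  then show ?thesis using F(1) unfolding finitely_translated_def by blast
qed

text \<open>A translate of a shuffle product is a sum of shuffle products of translates, up to twisting
  the second factor. So the products of generators for the first and for the second factor suffice,
  once the generators for the second factor are closed under the twist.\<close>

lemma finitely_translated_shuffle:
  assumes "finitely_translated f" "finitely_translated g"
  shows "finitely_translated (super_shuffle f g)"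
proof -
  obtain F G where F: "finite F" "\<And>u. (\<lambda>w. f (u @ w)) \<in> fun_space.span F"
    and G: "finite G" "\<And>u. (\<lambda>w. g (u @ w)) \<in> fun_space.span G"
    using assms by (auto simp: finitely_translated_def)
  \<comment> \<open>The twist is an involution, so one application closes \<open>G\<close> under it.\<close>
  define G' where "G' = G \<union> twist 1 ` G"
  define M where "M = (\<lambda>(a, b). super_shuffle a b) ` (F \<times> G')"
  have "(\<lambda>x. twist i x) ` G' \<subseteq> G'" for i
    by (cases i) (auto simp: G'_def twist_twist)
  then have twist: "twist i h \<in> fun_space.span G'" if "h \<in> fun_space.span G'" for h i
    using span_image_linear[OF _ _ that, of "twist i"] fun_space.span_mono[of "twist i ` G'" G']
    by (auto simp: fscale_def twist_def fun_eq_iff algebra_simps)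
  have product: "super_shuffle a b \<in> fun_space.span M"
    if "a \<in> fun_space.span F" "b \<in> fun_space.span G'" for a b
  proof -
    have 1: "super_shuffle a b \<in> fun_space.span M" if "a \<in> F" for a
    proof -
      have "super_shuffle a b \<in> fun_space.span (super_shuffle a ` G')"
        using \<open>b \<in> _\<close>
        by (rule span_image_linear[rotated 2])
          (auto simp: fscale_def fun_eq_iff plus_fun_def zero_fun_def shuffle_add_right shuffle_scale_right)
      moreover have "super_shuffle a ` G' \<subseteq> M" using that by (auto simp: M_def)
      ultimately show ?thesis using fun_space.span_mono by blast
    qed
    have "super_shuffle a b \<in> fun_space.span ((\<lambda>a. super_shuffle a b) ` F)"
      using \<open>a \<in> _\<close>
      by (rule span_image_linear[rotated 2])
        (auto simp: fscale_def fun_eq_iff plus_fun_def zero_fun_def shuffle_add_left shuffle_scale_left)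
    moreover have "(\<lambda>a. super_shuffle a b) ` F \<subseteq> fun_space.span M" using 1 by blast
    ultimately show ?thesis using fun_space.span_mono fun_space.span_span by blast
  qed
  have "(\<lambda>w. super_shuffle f g (u @ w)) \<in> fun_space.span M"
    if "\<And>v. (\<lambda>w. f (v @ w)) \<in> fun_space.span F" "\<And>v. (\<lambda>w. g (v @ w)) \<in> fun_space.span G'" for u f g
    using that
  proof (induction u arbitrary: f g)
    case Nil
    show ?case using product[of f g] Nil(1)[of "[]"] Nil(2)[of "[]"] by simp
  next
    case (Cons x u)
    have "(\<lambda>w. twist i g (v @ w)) \<in> fun_space.span G'" for i v
    proof -
      have "(\<lambda>w. twist i g (v @ w)) = fscale (parity_sign (i * word_parity v)) (twist i (\<lambda>w. g (v @ w)))"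
        by (simp add: fun_eq_iff twist_def fscale_def distrib_left parity_sign_add)
      then show ?thesis using twist[OF Cons.prems(2)] by (simp add: fun_space.span_scale)
    qed
    then have "(\<lambda>w. super_shuffle (\<lambda>v. f (x # v)) (twist (fst x) g) (u @ w)) \<in> fun_space.span M"
      using Cons.prems(1)[of "x # _"] by (intro Cons.IH) simp_all
    moreover have "(\<lambda>w. super_shuffle f (\<lambda>v. g (x # v)) (u @ w)) \<in> fun_space.span M"
      using Cons.prems(1) Cons.prems(2)[of "x # _"] by (intro Cons.IH) simp_all
    ultimately show ?case using fun_space.span_add by (fastforce simp: plus_fun_def)
  qed
  moreover have "(\<lambda>w. g (v @ w)) \<in> fun_space.span G'" for v
    using G(2)[of v] fun_space.span_mono[of G G'] by (auto simp: G'_def)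
  ultimately have "(\<lambda>w. super_shuffle f g (u @ w)) \<in> fun_space.span M" for u
    using F(2) by blast
  moreover have "finite M" using F(1) G(1) by (simp add: M_def G'_def)
  ultimately show ?thesis unfolding finitely_translated_def by blast
qed

text \<open>Generators that are translates themselves are needed for computing matrix coefficients: a
  translate of a translate is again expressed through them.\<close>

lemma finitely_translated_own_basis:
  assumes "finitely_translated f"
  obtains T where "finite T" "T \<subseteq> range (\<lambda>u w. f (u @ w))" "\<And>u. (\<lambda>w. f (u @ w)) \<in> fun_space.span T"
proof -
  obtain F where F: "finite F" "range (\<lambda>u w. f (u @ w)) \<subseteq> fun_space.span F"
    using assms by (auto simp: finitely_translated_def)
  obtain T where T: "T \<subseteq> range (\<lambda>u w. f (u @ w))" "fun_space.independent T"
    "range (\<lambda>u w. f (u @ w)) \<subseteq> fun_space.span T"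
    using fun_space.maximal_independent_subset by blast
  have "finite T" using fun_space.independent_span_bound[OF F(1) T(2)] T(1) F(2) by blast
  with T that show ?thesis by blast
qed

text \<open>Each functional that is not yet determined on the common kernel of the others costs one more
  vector. The complement is indexed by numbers, as its classes in a quotient need not be distinct.\<close>

lemma finite_codimension_common_kernel:
  assumes "finite \<Gamma>"
  shows "\<exists>(n::nat) b. (\<forall>i<n. b i \<in> carrier (free_algebra S)) \<and>
    (\<forall>p\<in>carrier (free_algebra S). \<exists>c. \<forall>g\<in>\<Gamma>. lin g (p - (\<Sum>i<n. free_smult (c i) (b i))) = 0)"
  using assms
proof (induction \<Gamma>)
  case empty
  show ?case by (rule exI[of _ 0]) simp
next
  case (insert g \<Gamma>)
  let ?F = "carrier (free_algebra S)"
  obtain n :: nat and b where b: "\<And>i. i < n \<Longrightarrow> b i \<in> ?F"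
    and c: "\<And>p. p \<in> ?F \<Longrightarrow> \<exists>c. \<forall>g\<in>\<Gamma>. lin g (p - (\<Sum>i<n. free_smult (c i) (b i))) = 0"
    using insert.IH by blast
  show ?case
  proof (cases "\<exists>q\<in>?F. (\<forall>h\<in>\<Gamma>. lin h q = 0) \<and> lin g q \<noteq> 0")
    case False
    have "\<exists>c. \<forall>h\<in>insert g \<Gamma>. lin h (p - (\<Sum>i<n. free_smult (c i) (b i))) = 0" if p: "p \<in> ?F" for p
    proof -
      obtain c where c: "\<forall>h\<in>\<Gamma>. lin h (p - (\<Sum>i<n. free_smult (c i) (b i))) = 0" using c[OF p] by blast
      have "p - (\<Sum>i<n. free_smult (c i) (b i)) \<in> ?F"
        by (intro free_algebra_closed free_algebra_sum_closed p b) simp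
      then show ?thesis using False c by blast
    qed
    then show ?thesis using b by blast
  next
    case True
    then obtain q where q: "q \<in> ?F" "\<forall>h\<in>\<Gamma>. lin h q = 0" "lin g q \<noteq> 0" by blast
    define b' where "b' = b(n := q)"
    have "\<exists>c. \<forall>h\<in>insert g \<Gamma>. lin h (p - (\<Sum>i<Suc n. free_smult (c i) (b' i))) = 0" if p: "p \<in> ?F" for p
    proof -
      obtain c where c: "\<forall>h\<in>\<Gamma>. lin h (p - (\<Sum>i<n. free_smult (c i) (b i))) = 0" using c[OF p] by blast
      define e where "e = p - (\<Sum>i<n. free_smult (c i) (b i))"
      define r where "r = lin g e / lin g q"
      have "p - (\<Sum>i<Suc n. free_smult ((c(n := r)) i) (b' i)) = e - free_smult r q"
        by (simp add: b'_def e_def)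
      moreover have "\<forall>h\<in>insert g \<Gamma>. lin h (e - free_smult r q) = 0"
        using c q unfolding e_def[symmetric] by (simp add: lin_diff lin_smult r_def)
      ultimately have "\<forall>h\<in>insert g \<Gamma>. lin h (p - (\<Sum>i<Suc n. free_smult ((c(n := r)) i) (b' i))) = 0"
        by simp
      then show ?thesis by blast
    qed
    moreover have "\<forall>i<Suc n. b' i \<in> ?F" using b q by (simp add: b'_def less_Suc_eq)
    ultimately show ?thesis by blast
  qed
qed

context enveloping
begin

lemma finsum_cls:
  "finite I \<Longrightarrow> (\<And>i. i \<in> I \<Longrightarrow> g i \<in> carrier F) \<Longrightarrow> (\<Oplus>\<^bsub>E\<^esub>i\<in>I. cls (g i)) = cls (sum g I)"
proof (induction I rule: finite_induct)
  case empty
  interpret E: ring E by (rule ring_E)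
  show ?case by (simp add: E_zero)
next
  case (insert i I)
  interpret E: ring E by (rule ring_E)
  have "(\<Oplus>\<^bsub>E\<^esub>i\<in>insert i I. cls (g i)) = cls (g i) \<oplus>\<^bsub>E\<^esub> (\<Oplus>\<^bsub>E\<^esub>i\<in>I. cls (g i))"
    using insert by (intro E.finsum_insert) (auto simp: cls_closed)
  then show ?case using insert by (simp add: E_add free_algebra_sum_closed)
qed

lemma finsum_smult_cls:
  assumes "finite B" "B \<subseteq> carrier E"
  shows "(\<Oplus>\<^bsub>E\<^esub>y\<in>B. c y \<odot>\<^bsub>E\<^esub> y) = cls (\<Sum>y\<in>B. free_smult (c y) (coset_rep y))"
proof -
  interpret E: ring E by (rule ring_E)
  have y: "c y \<odot>\<^bsub>E\<^esub> y = cls (free_smult (c y) (coset_rep y))" if "y \<in> B" for y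
    using E_smult[of "coset_rep y" "c y"] coset_rep_props[of y] that assms(2) by auto
  have "(\<Oplus>\<^bsub>E\<^esub>y\<in>B. c y \<odot>\<^bsub>E\<^esub> y) = (\<Oplus>\<^bsub>E\<^esub>y\<in>B. cls (free_smult (c y) (coset_rep y)))"
    using coset_rep_props(1) assms(2) by (intro E.finsum_cong' refl) (auto simp: y free_algebra_closed cls_closed)
  also have "\<dots> = cls (\<Sum>y\<in>B. free_smult (c y) (coset_rep y))"
    using coset_rep_props(1) assms by (intro finsum_cls) (auto simp: free_algebra_closed)
  finally show ?thesis .
qed

text \<open>If \<open>\<phi>\<close> vanishes on the ideal \<open>K\<close>, the translate by \<open>u\<close> only depends on the class of \<open>u\<close>
  modulo \<open>K\<close>.\<close>

lemma finite_dual_finitely_translated: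
  assumes "\<phi> \<in> finite_dual E" shows "finitely_translated (word_values \<phi>)"
proof -
  let ?f = "word_values \<phi>"
  obtain K where \<phi>: "\<phi> \<in> linear_functionals E" and K: "ideal K E" "finite_codimension E K" "\<forall>x\<in>K. \<phi> x = 0"
    using assms by (auto simp: finite_dual_def)
  from K(2) obtain B where B': "finite B \<and> B \<subseteq> carrier E \<and> (\<forall>x\<in>carrier E. \<exists>c. \<exists>k\<in>K.
      x = (\<Oplus>\<^bsub>E\<^esub>y\<in>B. c y \<odot>\<^bsub>E\<^esub> y) \<oplus>\<^bsub>E\<^esub> k)"
    unfolding finite_codimension_def ..
  then have B: "finite B" "B \<subseteq> carrier E" by simp_all
  interpret K: ideal K E by fact
  define h where "h y w = lin (\<lambda>v. ?f (v @ w)) (coset_rep y)" for y w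
  have "(\<lambda>w. ?f (u @ w)) \<in> fun_space.span (h ` B)" for u
  proof (cases "u \<in> lists S")
    case False
    then have "(\<lambda>w. ?f (u @ w)) = 0" by (auto simp: word_values_def zero_fun_def)
    then show ?thesis by (simp only: fun_space.span_zero)
  next
    case u: True
    then have su: "Poly_Mapping.single u 1 \<in> carrier F" by (rule single_in_free_algebra)
    obtain c k where k: "k \<in> K"
      and eq: "cls (Poly_Mapping.single u 1) = (\<Oplus>\<^bsub>E\<^esub>y\<in>B. c y \<odot>\<^bsub>E\<^esub> y) \<oplus>\<^bsub>E\<^esub> k"
      using B'[THEN conjunct2, THEN conjunct2, rule_format, OF cls_closed[OF su]] by blast
    obtain q where q: "q \<in> carrier F" "k = cls q"
      using K.a_Hcarr[OF k] unfolding carrier_E by blast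
    define s where "s = (\<Sum>y\<in>B. free_smult (c y) (coset_rep y))"
    have s: "s \<in> carrier F"
      unfolding s_def using B(2) coset_rep_props(1)
      by (intro free_algebra_sum_closed free_algebra_closed) auto
    have eq': "cls (Poly_Mapping.single u 1) = cls (s + q)"
      unfolding eq finsum_smult_cls[OF B] q(2) s_def[symmetric] by (rule E_add[OF s q(1)])
    have "?f (u @ w) = (\<Sum>y\<in>B. c y * h y w)" for w
    proof (cases "w \<in> lists S")
      case False
      then show ?thesis by (auto simp: h_def word_values_def)
    next
      case w: True
      then have sw: "Poly_Mapping.single w 1 \<in> carrier F" by (rule single_in_free_algebra)
      have prod: "\<phi> (cls p \<otimes>\<^bsub>E\<^esub> cls (Poly_Mapping.single w 1)) = lin (\<lambda>v. ?f (v @ w)) p"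
        if "p \<in> carrier F" for p
        using that sw by (simp add: E_mult functional_eq_lin[OF \<phi>] free_algebra_closed lin_mult)
      have "?f (u @ w) = lin (\<lambda>v. ?f (v @ w)) (s + q)"
        using prod[OF su, unfolded eq'] prod[OF free_algebra_closed(1)[OF s q(1)]] by simp
      also have "lin (\<lambda>v. ?f (v @ w)) q = 0"
        using prod[OF q(1)] K.I_r_closed[OF k cls_closed[OF sw]] K(3) unfolding q(2) by simp
      then have "lin (\<lambda>v. ?f (v @ w)) (s + q) = (\<Sum>y\<in>B. c y * h y w)"
        by (simp add: lin_add s_def lin_sum lin_smult h_def)
      finally show ?thesis .
    qed
    then have "(\<lambda>w. ?f (u @ w)) = (\<Sum>y\<in>B. fscale (c y) (h y))"
      by (auto simp: fscale_def fun_eq_iff sum_fun_apply)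
    also have "\<dots> \<in> fun_space.span (h ` B)"
      by (intro fun_space.span_sum fun_space.span_scale fun_space.span_base imageI)
    finally show ?thesis .
  qed
  then show ?thesis using B(1) unfolding finitely_translated_def by blast
qed

text \<open>The functionals in \<open>\<Gamma>\<close> live on the free algebra and need not respect the relations. Distinct
  vectors of the free algebra may have equal classes, so their coefficients have to be added up.\<close>

lemma finite_codimension_of_functionals:
  assumes "finite \<Gamma>" and K: "\<And>p. p \<in> carrier F \<Longrightarrow> \<forall>g\<in>\<Gamma>. lin g p = 0 \<Longrightarrow> cls p \<in> K"
  shows "finite_codimension E K"
proof -
  obtain n :: nat and b where b: "\<And>i. i < n \<Longrightarrow> b i \<in> carrier F"
    and gen: "\<And>p. p \<in> carrier F \<Longrightarrow> \<exists>c. \<forall>g\<in>\<Gamma>. lin g (p - (\<Sum>i<n. free_smult (c i) (b i))) = 0"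
    using finite_codimension_common_kernel[OF assms(1)] by blast
  define B where "B = (\<lambda>i. cls (b i)) ` {..<n::nat}"
  have B: "finite B" "B \<subseteq> carrier E" using b cls_closed by (auto simp: B_def)
  have "\<exists>c. \<exists>k\<in>K. x = (\<Oplus>\<^bsub>E\<^esub>y\<in>B. c y \<odot>\<^bsub>E\<^esub> y) \<oplus>\<^bsub>E\<^esub> k" if x: "x \<in> carrier E" for x
  proof -
    obtain p where p: "p \<in> carrier F" "x = cls p" using x by (auto simp: carrier_E)
    obtain c where c: "\<forall>g\<in>\<Gamma>. lin g (p - (\<Sum>i<n. free_smult (c i) (b i))) = 0" using gen[OF p(1)] by blast
    define s where "s = (\<Sum>i<n. free_smult (c i) (b i))"
    define d where "d y = (\<Sum>i\<in>{i. i \<in> {..<n} \<and> cls (b i) = y}. c i)" for y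
    have s: "s \<in> carrier F" unfolding s_def using b by (intro free_algebra_sum_closed free_algebra_closed) simp
    have "(\<Sum>y\<in>B. free_smult (d y) (coset_rep y))
        = (\<Sum>y\<in>B. \<Sum>i\<in>{i. i \<in> {..<n} \<and> cls (b i) = y}. free_smult (c i) (coset_rep (cls (b i))))"
      by (intro sum.cong refl)
        (simp add: d_def poly_mapping_eq_iff fun_eq_iff lookup_sum sum_distrib_right)
    also have "\<dots> = (\<Sum>i<n. free_smult (c i) (coset_rep (cls (b i))))"
      unfolding B_def by (rule sum.image_gen[symmetric]) simp
    finally have "(\<Sum>y\<in>B. free_smult (d y) (coset_rep y)) - s
        = (\<Sum>i<n. free_smult (c i) (coset_rep (cls (b i)) - b i))"
      by (simp add: s_def sum_subtractf[symmetric] free_smult_eq_mult right_diff_distrib)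
    also have "\<dots> \<in> J" using b by (intro sum_in_J J_closed(5) coset_rep_cls) simp
    finally have "(\<Oplus>\<^bsub>E\<^esub>y\<in>B. d y \<odot>\<^bsub>E\<^esub> y) = cls s" by (simp add: finsum_smult_cls[OF B] cls_eq)
    then have "x = (\<Oplus>\<^bsub>E\<^esub>y\<in>B. d y \<odot>\<^bsub>E\<^esub> y) \<oplus>\<^bsub>E\<^esub> cls (p - s)"
      using p s by (simp add: E_add free_algebra_closed)
    moreover have "cls (p - s) \<in> K" using c p s by (intro K) (auto simp: s_def[symmetric] free_algebra_closed)
    ultimately show ?thesis by blast
  qed
  then show ?thesis unfolding finite_codimension_def using B by blast
qed

text \<open>The ideal is the largest two-sided ideal in the kernel of \<open>\<phi>\<close>. If \<open>T\<close> is a finite set of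
  translates generating all translates, with coefficients \<open>m u t\<close>, then
  \<open>f (u w v) = \<Sum> m(u, t) m(rep(t) w, t') t'(v)\<close>; so an element lies in the ideal as soon as the finitely
  many matrix coefficients \<open>w \<mapsto> m(rep(t) w, t')\<close> vanish on it.\<close>

lemma finitely_translated_finite_dual:
  assumes \<phi>: "\<phi> \<in> linear_functionals E" and "finitely_translated (word_values \<phi>)"
  shows "\<phi> \<in> finite_dual E"
proof -
  let ?f = "word_values \<phi>"
  obtain T where T: "finite T" "T \<subseteq> range (\<lambda>u w. ?f (u @ w))" "\<And>u. (\<lambda>w. ?f (u @ w)) \<in> fun_space.span T"
    using finitely_translated_own_basis[OF assms(2)] by blast
  have "\<forall>t\<in>T. \<exists>u. t = (\<lambda>w. ?f (u @ w))" using T(2) by blast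
  then obtain rep where rep: "\<And>t. t \<in> T \<Longrightarrow> t = (\<lambda>w. ?f (rep t @ w))" by metis
  have "\<exists>m. \<forall>w. ?f (u @ w) = (\<Sum>t\<in>T. m t * t w)" for u
  proof -
    obtain m where "(\<lambda>w. ?f (u @ w)) = (\<Sum>t\<in>T. fscale (m t) t)"
      using T(3)[of u] unfolding fun_space.span_finite[OF T(1)] by blast
    then have "?f (u @ w) = (\<Sum>t\<in>T. m t * t w)" for w
      by (simp add: fun_eq_iff sum_fun_apply fscale_def)
    then show ?thesis by blast
  qed
  then obtain m where m: "\<And>u w. ?f (u @ w) = (\<Sum>t\<in>T. m u t * t w)" by metis
  define K where "K = {X \<in> carrier E. \<forall>A\<in>carrier E. \<forall>C\<in>carrier E. \<phi> (A \<otimes>\<^bsub>E\<^esub> X \<otimes>\<^bsub>E\<^esub> C) = 0}"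
  define \<Gamma> where "\<Gamma> = (\<lambda>(t, t') w. m (rep t @ w) t') ` (T \<times> T)"
  interpret E: ring E by (rule ring_E)
  have add: "\<phi> (x \<oplus>\<^bsub>E\<^esub> y) = \<phi> x + \<phi> y" if "x \<in> carrier E" "y \<in> carrier E" for x y
    using \<phi> that by (simp add: linear_functionals_def)
  have zero: "\<phi> \<zero>\<^bsub>E\<^esub> = 0" using add[of "\<zero>\<^bsub>E\<^esub>" "\<zero>\<^bsub>E\<^esub>"] by simp
  have minus: "\<phi> (\<ominus>\<^bsub>E\<^esub> x) = - \<phi> x" if "x \<in> carrier E" for x
    using add[of "\<ominus>\<^bsub>E\<^esub> x" x] that zero by (simp add: E.l_neg eq_neg_iff_add_eq_0)
  have "ideal K E"
  proof (rule idealI)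
    show "ring E" by (rule ring_E)
    show "subgroup K (add_monoid E)"
    proof (rule group.subgroupI)
      show "group (add_monoid E)" by (rule E.add.is_group)
      show "K \<subseteq> carrier (add_monoid E)" by (auto simp: K_def)
      show "K \<noteq> {}" using zero by (auto simp: K_def intro!: exI[of _ "\<zero>\<^bsub>E\<^esub>"])
      fix x assume x: "x \<in> K"
      then show "inv\<^bsub>add_monoid E\<^esub> x \<in> K"
        by (simp add: K_def a_inv_def[symmetric] E.r_minus E.l_minus minus)
      fix y assume y: "y \<in> K"
      with x show "x \<otimes>\<^bsub>add_monoid E\<^esub> y \<in> K"
        by (simp add: K_def E.l_distr E.r_distr add)
    qed
  next
    fix x a assume x: "x \<in> K" and a: "a \<in> carrier E"
    have "\<phi> (A \<otimes>\<^bsub>E\<^esub> (a \<otimes>\<^bsub>E\<^esub> x) \<otimes>\<^bsub>E\<^esub> C) = 0" if "A \<in> carrier E" "C \<in> carrier E" for A C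
    proof -
      have "\<phi> ((A \<otimes>\<^bsub>E\<^esub> a) \<otimes>\<^bsub>E\<^esub> x \<otimes>\<^bsub>E\<^esub> C) = 0" using x a that unfolding K_def by blast
      then show ?thesis using x a that by (simp add: K_def E.m_assoc)
    qed
    then show "a \<otimes>\<^bsub>E\<^esub> x \<in> K" using x a by (simp add: K_def)
    have "\<phi> (A \<otimes>\<^bsub>E\<^esub> (x \<otimes>\<^bsub>E\<^esub> a) \<otimes>\<^bsub>E\<^esub> C) = 0" if "A \<in> carrier E" "C \<in> carrier E" for A C
    proof -
      have "\<phi> (A \<otimes>\<^bsub>E\<^esub> x \<otimes>\<^bsub>E\<^esub> (a \<otimes>\<^bsub>E\<^esub> C)) = 0" using x a that unfolding K_def by blast
      then show ?thesis using x a that by (simp add: K_def E.m_assoc)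
    qed
    then show "x \<otimes>\<^bsub>E\<^esub> a \<in> K" using x a by (simp add: K_def)
  qed
  moreover have "\<forall>x\<in>K. \<phi> x = 0"
  proof
    fix x assume "x \<in> K"
    then have "\<phi> (\<one>\<^bsub>E\<^esub> \<otimes>\<^bsub>E\<^esub> x \<otimes>\<^bsub>E\<^esub> \<one>\<^bsub>E\<^esub>) = 0" "x \<in> carrier E" unfolding K_def by blast+
    then show "\<phi> x = 0" by simp
  qed
  moreover have "finite_codimension E K"
  proof (rule finite_codimension_of_functionals)
    show "finite \<Gamma>" using T(1) by (simp add: \<Gamma>_def)
    fix p assume p: "p \<in> carrier F" "\<forall>g\<in>\<Gamma>. lin g p = 0"
    have word: "lin (\<lambda>w. ?f (u @ w @ v)) p = 0" for u v
    proof -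
      have "?f (u @ w @ v) = (\<Sum>t\<in>T. m u t * (\<Sum>t'\<in>T. t' v * m (rep t @ w) t'))" for w
      proof -
        have "?f (u @ w @ v) = (\<Sum>t\<in>T. m u t * t (w @ v))" by (rule m)
        also have "\<dots> = (\<Sum>t\<in>T. m u t * ?f ((rep t @ w) @ v))"
          using rep by (intro sum.cong refl) (metis append_assoc)
        finally show ?thesis by (simp only: m mult.commute)
      qed
      then have "lin (\<lambda>w. ?f (u @ w @ v)) p = (\<Sum>t\<in>T. m u t * (\<Sum>t'\<in>T. t' v * lin (\<lambda>w. m (rep t @ w) t') p))"
        by (simp add: lin_fun_sum lin_fun_smult)
      also have "\<dots> = 0" using p(2) by (intro sum.neutral ballI) (auto simp: \<Gamma>_def intro!: sum.neutral)
      finally show ?thesis .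
    qed
    have "\<phi> (cls a \<otimes>\<^bsub>E\<^esub> cls p \<otimes>\<^bsub>E\<^esub> cls c) = 0" if "a \<in> carrier F" "c \<in> carrier F" for a c
    proof -
      have "\<phi> (cls a \<otimes>\<^bsub>E\<^esub> cls p \<otimes>\<^bsub>E\<^esub> cls c) = lin ?f (a * (p * c))"
        using that p by (simp add: E_mult functional_eq_lin[OF \<phi>] free_algebra_closed mult.assoc)
      also have "\<dots> = lin (\<lambda>u. lin (\<lambda>w. lin (\<lambda>v. ?f (u @ w @ v)) c) p) a" by (simp add: lin_mult)
      also have "\<dots> = lin (\<lambda>u. lin (\<lambda>v. lin (\<lambda>w. ?f (u @ w @ v)) p) c) a"
        by (rule arg_cong[of _ _ "\<lambda>h. lin h a"], rule ext, rule lin_swap)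
      finally show ?thesis by (simp add: word)
    qed
    then show "cls p \<in> K" using p by (auto simp: K_def carrier_E)
  qed
  ultimately show ?thesis using \<phi> unfolding finite_dual_def by blast
qed

lemma finite_dual_eq:
  "finite_dual E = {\<phi> \<in> linear_functionals E. finitely_translated (word_values \<phi>)}"
  using finite_dual_finitely_translated finitely_translated_finite_dual
  by (auto simp: finite_dual_def)

end

section \<open>Symmetrization\<close>

text \<open>Permuting a word moves a given letter to a place that does not depend on the letter; this is why
  symmetrization is multilinear.\<close>

lemma permuted_position:
  assumes \<pi>: "\<pi> permutes {..<length u + Suc (length v)}"
  shows "\<exists>u' v'. \<forall>z. map (\<lambda>i. (u @ z # v) ! \<pi> i) [0..<length u + Suc (length v)] = u' @ z # v'"
proof -
  let ?n = "length u + Suc (length v)" and ?w = "\<lambda>z. u @ z # v"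
  obtain j where j: "\<pi> j = length u" using permutes_surj[OF \<pi>] by (metis surjD)
  have jn: "j < ?n"
    using permutes_in_image[OF \<pi>, of j] j by simp
  have other: "?w z ! \<pi> i = ?w undefined ! \<pi> i" if "i \<noteq> j" for i z
  proof -
    have "\<pi> i \<noteq> length u" using j that permutes_inj[OF \<pi>] by (metis injD)
    then show ?thesis by (auto simp: nth_append nth_Cons')
  qed
  have upt: "[0..<?n] = [0..<j] @ j # [Suc j..<?n]"
    using jn upt_add_eq_append[of 0 j "?n - j"] upt_conv_Cons[of j ?n] by simp
  have "map (\<lambda>i. ?w z ! \<pi> i) [0..<?n]
      = map (\<lambda>i. ?w undefined ! \<pi> i) [0..<j] @ z # map (\<lambda>i. ?w undefined ! \<pi> i) [Suc j..<?n]" for z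
    unfolding upt map_append list.map using j by (auto simp del: upt_Suc intro!: other)
  then show ?thesis by blast
qed

lemma odd_sign_cong:
  "length w = length w' \<Longrightarrow> map fst w = map fst w' \<Longrightarrow> \<pi> permutes {..<length w} \<Longrightarrow> odd_sign \<pi> w = odd_sign \<pi> w'"
proof -
  assume *: "length w = length w'" "map fst w = map fst w'" "\<pi> permutes {..<length w}"
  have "fst (w ! \<pi> k) = fst (w' ! \<pi> k)" if "k < length w" for k
    using *(1,2) permutes_in_image[OF *(3), of k] that by (metis lessThan_iff nth_map)
  then show ?thesis unfolding odd_sign_def
    using *(1) by (intro arg_cong[of _ _ "\<lambda>A. (- 1) ^ card A"]) (auto dest: less_trans)
qed

lemma transpose_Suc_less_iff:
  "p \<noteq> q \<Longrightarrow> {p, q} \<noteq> {a, Suc a} \<Longrightarrow> transpose a (Suc a) p < transpose a (Suc a) q \<longleftrightarrow> p < q"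
  unfolding transpose_def by (auto simp: doubleton_eq_iff)

text \<open>An adjacent transposition changes the relative order of exactly one pair of positions, so the
  number of inversions among odd letters changes by one if both letters are odd, and not at all
  otherwise.\<close>

lemma odd_sign_adjacent_swap:
  fixes u v :: "'g word" and x y :: "bit \<times> 'g"
  defines "w \<equiv> u @ x # y # v" and "w' \<equiv> u @ y # x # v" and "\<tau> \<equiv> transpose (length u) (Suc (length u))"
  assumes \<pi>: "\<pi> permutes {..<length w}"
  shows "odd_sign (\<tau> \<circ> \<pi>) w' = parity_sign (fst x * fst y) * odd_sign \<pi> w"
proof -
  let ?a = "length u" and ?n = "length w"
  have nth: "w' ! \<tau> k = w ! k" for k
    by (auto simp: w_def w'_def \<tau>_def transpose_def nth_append nth_Cons' split: if_splits)
  have len: "length w' = ?n" by (simp add: w_def w'_def)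
  define odd_pair where "odd_pair k l \<longleftrightarrow> k < l \<and> l < ?n \<and> fst (w ! \<pi> k) = 1 \<and> fst (w ! \<pi> l) = 1" for k l
  define A where "A = {(k, l). odd_pair k l \<and> \<pi> l < \<pi> k}"
  define A' where "A' = {(k, l). odd_pair k l \<and> \<tau> (\<pi> l) < \<tau> (\<pi> k)}"
  have sign: "odd_sign \<pi> w = (- 1) ^ card A" "odd_sign (\<tau> \<circ> \<pi>) w' = (- 1) ^ card A'"
    unfolding odd_sign_def A_def A'_def odd_pair_def
    by (rule arg_cong[of _ _ "\<lambda>A. (- 1) ^ card A"], auto simp: nth len)+
  have fin: "finite A" "finite A'"
    by (rule finite_subset[of _ "{..<?n} \<times> {..<?n}"]; auto simp: A_def A'_def odd_pair_def)+
  \<comment> \<open>The positions at which the interchanged letters \<open>x\<close> and \<open>y\<close> arrive.\<close>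
  obtain k l where kl: "\<pi> k = ?a" "\<pi> l = Suc ?a" using permutes_surj[OF \<pi>] by (metis surjD)
  have kn: "k < ?n" "l < ?n"
    using permutes_in_image[OF \<pi>, of k] permutes_in_image[OF \<pi>, of l] kl by (simp_all add: w_def)
  have "k \<noteq> l" using kl by auto
  have inj: "\<pi> p = \<pi> q \<longleftrightarrow> p = q" for p q using permutes_inj[OF \<pi>] by (auto dest: injD)
  have pq: "\<tau> (\<pi> q) < \<tau> (\<pi> p) \<longleftrightarrow> \<pi> q < \<pi> p" if "p \<noteq> q" "{p, q} \<noteq> {k, l}" for p q
  proof -
    have "{\<pi> q, \<pi> p} \<noteq> {?a, Suc ?a}" using that(2) kl inj by (metis doubleton_eq_iff)
    then show ?thesis unfolding \<tau>_def using that(1) inj by (intro transpose_Suc_less_iff) auto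
  qed
  have wk: "w ! \<pi> k = x" "w ! \<pi> l = y" by (simp_all add: kl w_def nth_append)
  have \<tau>: "\<tau> (\<pi> k) = Suc ?a" "\<tau> (\<pi> l) = ?a" by (simp_all add: kl \<tau>_def)
  show ?thesis
  proof (cases "fst x = 1 \<and> fst y = 1")
    case False
    have "A' = A"
    proof -
      have "{p, q} \<noteq> {k, l}" if "odd_pair p q" for p q
        using that False wk by (auto simp: odd_pair_def doubleton_eq_iff)
      then show ?thesis unfolding A_def A'_def using pq by (auto simp: odd_pair_def)
    qed
    moreover have "fst x * fst y = 0" using False by (metis bit_not_one_iff mult_zero_left mult_zero_right)
    ultimately show ?thesis by (simp only: sign parity_sign_simps mult_1)
  next
    case True
    have "parity_sign (fst x * fst y) = - 1" using True by simp
    moreover have "(- 1 :: complex) ^ card A' = - ((- 1) ^ card A)"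
    proof (cases "k < l")
      case kl': True
      have "A' = insert (k, l) A"
      proof (intro Set.set_eqI iffI)
        fix e assume e: "e \<in> A'"
        then show "e \<in> insert (k, l) A"
          using pq[of "fst e" "snd e"] kl' by (cases e) (auto simp: A_def A'_def odd_pair_def doubleton_eq_iff)
      next
        fix e assume e: "e \<in> insert (k, l) A"
        then show "e \<in> A'"
          using pq[of "fst e" "snd e"] kl' kl True wk \<tau> kn
          by (cases "{fst e, snd e} = {k, l}"; cases e) (auto simp: A_def A'_def odd_pair_def doubleton_eq_iff)
      qed
      moreover have "(k, l) \<notin> A" using kl by (auto simp: A_def)
      ultimately show ?thesis using fin by simp
    next
      case False
      then have kl': "l < k" using \<open>k \<noteq> l\<close> by simp
      have "A = insert (l, k) A'"
      proof (intro Set.set_eqI iffI)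
        fix e assume e: "e \<in> A"
        then show "e \<in> insert (l, k) A'"
          using pq[of "fst e" "snd e"] kl' by (cases e) (auto simp: A_def A'_def odd_pair_def doubleton_eq_iff)
      next
        fix e assume e: "e \<in> insert (l, k) A'"
        then show "e \<in> A"
          using pq[of "fst e" "snd e"] kl' kl True wk \<tau> kn
          by (cases "{fst e, snd e} = {k, l}"; cases e) (auto simp: A_def A'_def odd_pair_def doubleton_eq_iff)
      qed
      moreover have "(l, k) \<notin> A'" using \<tau> by (auto simp: A'_def)
      ultimately show ?thesis using fin by simp
    qed
    ultimately show ?thesis by (simp add: sign)
  qed
qed

definition symmetrized :: "('g word \<Rightarrow> complex) \<Rightarrow> 'g word \<Rightarrow> complex" where
  "symmetrized f w = lin f (symmetrize_word w)"

lemma symmetrized_eq: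
  "symmetrized f w = (\<Sum>\<pi> | \<pi> permutes {..<length w}.
     odd_sign \<pi> w / fact (length w) * f (map (\<lambda>i. w ! \<pi> i) [0..<length w]))"
  by (simp add: symmetrized_def symmetrize_word_def lin_sum)

lemma symmetrized_swap:
  "symmetrized f (u @ y # x # v) = parity_sign (fst x * fst y) * symmetrized f (u @ x # y # v)"
proof -
  define w where "w = u @ x # y # v"
  define w' where "w' = u @ y # x # v"
  define \<tau> where "\<tau> = transpose (length u) (Suc (length u))"
  have nth: "w' ! \<tau> k = w ! k" for k
    by (auto simp: w_def w'_def \<tau>_def transpose_def nth_append nth_Cons' split: if_splits)
  have len: "length w' = length w" by (simp add: w_def w'_def)
  have \<tau>: "\<tau> permutes {..<length w}"
    unfolding \<tau>_def by (rule permutes_swap_id) (simp_all add: w_def)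
  have "symmetrized f w' = (\<Sum>\<pi> | \<pi> permutes {..<length w}.
     odd_sign (\<tau> \<circ> \<pi>) w' / fact (length w) * f (map (\<lambda>i. w' ! (\<tau> \<circ> \<pi>) i) [0..<length w]))"
    unfolding symmetrized_eq len by (rule setum_permutations_compose_left[OF \<tau>])
  also have "\<dots> = (\<Sum>\<pi> | \<pi> permutes {..<length w}. parity_sign (fst x * fst y) *
     (odd_sign \<pi> w / fact (length w) * f (map (\<lambda>i. w ! \<pi> i) [0..<length w])))"
    using odd_sign_adjacent_swap[of _ u x y v]
    by (intro sum.cong refl) (simp add: nth w_def[symmetric] w'_def[symmetric] \<tau>_def[symmetric])
  finally show ?thesis by (simp add: symmetrized_eq sum_distrib_left w_def w'_def)
qed

lemma lists_permuted:
  assumes "w \<in> lists A" "\<pi> permutes {..<length w}"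
  shows "map (\<lambda>i. w ! \<pi> i) [0..<length w] \<in> lists A"
  using assms(1) permutes_in_image[OF assms(2)] by (auto simp: subset_iff)

lemma symmetrize_word_keys:
  assumes "w \<in> lists A" shows "symmetrize_word w \<in> carrier (free_algebra A)"
  unfolding symmetrize_word_def using lists_permuted[OF assms]
  by (intro free_algebra_sum_closed single_in_free_algebra) simp

lemma invariant_under_rearrangement:
  assumes swap: "\<And>u x y v. x \<in> A \<Longrightarrow> y \<in> A \<Longrightarrow> set u \<subseteq> A \<Longrightarrow> set v \<subseteq> A \<Longrightarrow> f (u @ x # y # v) = f (u @ y # x # v)"
    and w: "set w \<subseteq> A" "mset w = mset w'"
  shows "f w = f w'"
  using swap w
proof (induction w arbitrary: f w')
  case (Cons x w)
  have "x \<in> set w'" using Cons.prems(3) by (metis list.set_intros(1) set_mset_mset)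
  then obtain u v where w': "w' = u @ x # v" by (meson split_list)
  have A: "x \<in> A" "set u \<subseteq> A" "set v \<subseteq> A"
    using Cons.prems(2,3) w' mset_eq_setD[OF Cons.prems(3)] by auto
  have move: "f (u' @ x # v') = f (x # u' @ v')" if "set u' \<subseteq> A" "set v' \<subseteq> A" for u' v'
    using that
  proof (induction u' arbitrary: v' rule: rev_induct)
    case (snoc y u')
    have "f (u' @ y # x # v') = f (u' @ x # y # v')" using snoc.prems A by (intro Cons.prems(1)) auto
    also have "\<dots> = f (x # u' @ y # v')" using snoc.prems by (intro snoc.IH) auto
    finally show ?case by simp
  qed simp
  have "f (x # w) = f (x # u @ v)"
  proof (rule Cons.IH)
    fix u x' y v assume "x' \<in> A" "y \<in> A" "set u \<subseteq> A" "set v \<subseteq> A"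
    then show "f (x # u @ x' # y # v) = f (x # u @ y # x' # v)"
      using Cons.prems(1)[of x' y "x # u" v] A by simp
  qed (use Cons.prems w' in auto)
  then show ?case using move[OF A(2,3)] w' by simp
qed simp


text \<open>Symmetrization is well defined on the supersymmetric algebra. The restriction to words in \<open>P\<close>
  only matters for the support.\<close>

lemma symmetrized_linear:
  assumes "enveloping L UNIV (bracket L)" "enveloping L P zero_bracket"
    and f: "enveloping.word_functional L UNIV (bracket L) f"
  shows "enveloping.word_functional L P zero_bracket
    (\<lambda>w. if w \<in> lists (letters L P) then symmetrized f w else 0)"
proof -
  interpret U: enveloping L UNIV "bracket L" by fact
  interpret P: enveloping L P zero_bracket by fact
  let ?g = "\<lambda>w. if w \<in> lists P.S then symmetrized f w else 0"
  have slot: "\<exists>u' v'. \<forall>x. map (\<lambda>k. (u @ (i, x) # v) ! \<pi> k) [0..<length u + Suc (length v)] = u' @ (i, x) # v'"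
    if "\<pi> permutes {..<length u + Suc (length v)}" for \<pi> and u v :: "'a word" and i
    using permuted_position[OF that] by metis
  have sign: "odd_sign \<pi> (u @ (i, x) # v) = odd_sign \<pi> (u @ (i, y) # v)"
    if "\<pi> permutes {..<length u + Suc (length v)}" for \<pi> and u v :: "'a word" and i x y
    using that by (intro odd_sign_cong) auto
  have zero: "symmetrized f (u @ (i, 0) # v) = 0" for u v i
    unfolding symmetrized_eq
  proof (rule sum.neutral, safe)
    fix \<pi> assume "\<pi> permutes {..<length (u @ (i, 0) # v)}"
    then obtain u' v' where "map (\<lambda>k. (u @ (i, 0) # v) ! \<pi> k) [0..<length (u @ (i, 0) # v)] = u' @ (i, 0) # v'"
      using slot[of \<pi> u v i] by auto
    then show "odd_sign \<pi> (u @ (i, 0) # v) / fact (length (u @ (i, 0) # v)) *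
       f (map (\<lambda>k. (u @ (i, 0) # v) ! \<pi> k) [0..<length (u @ (i, 0) # v)]) = 0"
      using U.word_functional_zero_letter[OF f] by simp
  qed
  have add: "symmetrized f (u @ (i, x + y) # v) = symmetrized f (u @ (i, x) # v) + symmetrized f (u @ (i, y) # v)"
    if "x \<in> P \<inter> part L i" "y \<in> P \<inter> part L i" for u v i x y
    unfolding symmetrized_eq length_append list.size sum.distrib[symmetric]
  proof (rule sum.cong, simp, safe)
    fix \<pi> assume \<pi>: "\<pi> permutes {..<length u + (length v + Suc 0)}"
    then obtain u' v' where "\<And>x. map (\<lambda>k. (u @ (i, x) # v) ! \<pi> k) [0..<length u + Suc (length v)] = u' @ (i, x) # v'"
      using slot[of \<pi> u v i] by auto
    then show "odd_sign \<pi> (u @ (i, x + y) # v) / fact (length u + (length v + Suc 0)) *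
        f (map (\<lambda>k. (u @ (i, x + y) # v) ! \<pi> k) [0..<length u + (length v + Suc 0)])
      = odd_sign \<pi> (u @ (i, x) # v) / fact (length u + (length v + Suc 0)) *
        f (map (\<lambda>k. (u @ (i, x) # v) ! \<pi> k) [0..<length u + (length v + Suc 0)])
      + odd_sign \<pi> (u @ (i, y) # v) / fact (length u + (length v + Suc 0)) *
        f (map (\<lambda>k. (u @ (i, y) # v) ! \<pi> k) [0..<length u + (length v + Suc 0)])"
      using U.word_functional_add[OF f, of x i y u' v'] that \<pi> sign[of \<pi> u v i "x + y" x] sign[of \<pi> u v i y x]
      by (simp add: distrib_left add_divide_distrib del: upt_Suc)
  qed
  have scale: "symmetrized f (u @ (i, scale L c x) # v) = c * symmetrized f (u @ (i, x) # v)"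
    if "x \<in> P \<inter> part L i" for u v i x c
    unfolding symmetrized_eq length_append list.size sum_distrib_left
  proof (rule sum.cong, simp, safe)
    fix \<pi> assume \<pi>: "\<pi> permutes {..<length u + (length v + Suc 0)}"
    then obtain u' v' where "\<And>x. map (\<lambda>k. (u @ (i, x) # v) ! \<pi> k) [0..<length u + Suc (length v)] = u' @ (i, x) # v'"
      using slot[of \<pi> u v i] by auto
    then show "odd_sign \<pi> (u @ (i, scale L c x) # v) / fact (length u + (length v + Suc 0)) *
        f (map (\<lambda>k. (u @ (i, scale L c x) # v) ! \<pi> k) [0..<length u + (length v + Suc 0)])
      = c * (odd_sign \<pi> (u @ (i, x) # v) / fact (length u + (length v + Suc 0)) *
        f (map (\<lambda>k. (u @ (i, x) # v) ! \<pi> k) [0..<length u + (length v + Suc 0)]))"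
      using U.word_functional_scale[OF f, of x i u' c v'] that \<pi> sign[of \<pi> u v i "scale L c x" x]
      by (simp del: upt_Suc)
  qed
  show ?thesis
    unfolding P.word_functional_def
  proof (intro conjI allI impI)
    fix u v i x y assume xy: "x \<in> P \<inter> part L i" "y \<in> P \<inter> part L i"
    then have "u @ (i, x + y) # v \<in> lists P.S \<longleftrightarrow> u \<in> lists P.S \<and> v \<in> lists P.S"
      "u @ (i, x) # v \<in> lists P.S \<longleftrightarrow> u \<in> lists P.S \<and> v \<in> lists P.S"
      "u @ (i, y) # v \<in> lists P.S \<longleftrightarrow> u \<in> lists P.S \<and> v \<in> lists P.S"
      using P.add_closed[OF xy] by (auto simp: P.in_letters)
    then show "?g (u @ (i, x + y) # v) = ?g (u @ (i, x) # v) + ?g (u @ (i, y) # v)"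
      using add[OF xy] by (simp del: in_lists_conv_set)
  next
    fix u v i c x assume x: "x \<in> P \<inter> part L i"
    then have "u @ (i, scale L c x) # v \<in> lists P.S \<longleftrightarrow> u \<in> lists P.S \<and> v \<in> lists P.S"
      "u @ (i, x) # v \<in> lists P.S \<longleftrightarrow> u \<in> lists P.S \<and> v \<in> lists P.S"
      using P.scale_closed[OF x] by (auto simp: P.in_letters)
    then show "?g (u @ (i, scale L c x) # v) = c * ?g (u @ (i, x) # v)"
      using scale[OF x] by (simp del: in_lists_conv_set)
  next
    fix u v i j x y assume x: "x \<in> P \<inter> part L i" and y: "y \<in> P \<inter> part L j"
    have "u @ (i, x) # (j, y) # v \<in> lists P.S \<longleftrightarrow> u @ (j, y) # (i, x) # v \<in> lists P.S" by auto
    then show "?g (u @ (i, x) # (j, y) # v)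
      = parity_sign (i * j) * ?g (u @ (j, y) # (i, x) # v) + ?g (u @ (i + j, 0) # v)"
      using symmetrized_swap[of f u "(i, x)" "(j, y)" v] zero[of u "i + j" v]
      by (simp add: mult.commute[of j i] symmetrized_swap[of f u "(j, y)" "(i, x)" v] parity_sign_square del: in_lists_conv_set)
  qed simp
qed

text \<open>The letters from \<open>A\<close> commute in the enveloping algebra and carry no signs, so all terms of the
  symmetrization of a word in \<open>A\<close> have the same value, that of the word. Words with the letter
  \<open>(1, 0)\<close> have the value 0 in any order.\<close>

lemma pullback_eq_restriction:
  assumes "enveloping L UNIV (bracket L)" "enveloping L P zero_bracket" "enveloping L A zero_bracket"
    and AP: "A \<subseteq> P" and even: "A \<subseteq> part L 0"
    and commute: "\<And>x y. x \<in> A \<Longrightarrow> y \<in> A \<Longrightarrow> bracket L x y = 0"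
    and odd: "\<And>x. x \<in> A \<inter> part L 1 \<Longrightarrow> x = 0"
    and f: "enveloping.word_functional L UNIV (bracket L) f"
  defines "r \<equiv> \<lambda>w. if w \<in> lists (letters L A) then f w else 0"
  shows "enveloping.word_functional L A zero_bracket r"
    and "pullback L P A (enveloping.functional_of L UNIV (bracket L) f)
      = enveloping.functional_of L A zero_bracket r"
proof -
  interpret U: enveloping L UNIV "bracket L" by fact
  interpret P: enveloping L P zero_bracket by fact
  interpret A: enveloping L A zero_bracket by fact
  show r: "A.word_functional r"
    unfolding A.word_functional_def
  proof (intro conjI allI impI)
    fix u v i x y assume xy: "x \<in> A \<inter> part L i" "y \<in> A \<inter> part L i"
    then have "u @ (i, x + y) # v \<in> lists A.S \<longleftrightarrow> u \<in> lists A.S \<and> v \<in> lists A.S"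
      "u @ (i, x) # v \<in> lists A.S \<longleftrightarrow> u \<in> lists A.S \<and> v \<in> lists A.S"
      "u @ (i, y) # v \<in> lists A.S \<longleftrightarrow> u \<in> lists A.S \<and> v \<in> lists A.S"
      using A.add_closed[OF xy] by (auto simp: A.in_letters)
    then show "r (u @ (i, x + y) # v) = r (u @ (i, x) # v) + r (u @ (i, y) # v)"
      using U.word_functional_add[OF f, of x i y u v] xy by (simp add: r_def del: in_lists_conv_set)
  next
    fix u v i c x assume x: "x \<in> A \<inter> part L i"
    then have "u @ (i, scale L c x) # v \<in> lists A.S \<longleftrightarrow> u \<in> lists A.S \<and> v \<in> lists A.S"
      "u @ (i, x) # v \<in> lists A.S \<longleftrightarrow> u \<in> lists A.S \<and> v \<in> lists A.S"
      using A.scale_closed[OF x] by (auto simp: A.in_letters)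
    then show "r (u @ (i, scale L c x) # v) = c * r (u @ (i, x) # v)"
      using U.word_functional_scale[OF f, of x i u c v] x by (simp add: r_def del: in_lists_conv_set)
  next
    fix u v i j x y assume x: "x \<in> A \<inter> part L i" and y: "y \<in> A \<inter> part L j"
    have "u @ (i, x) # (j, y) # v \<in> lists A.S \<longleftrightarrow> u @ (j, y) # (i, x) # v \<in> lists A.S" by auto
    moreover have "f (u @ (i, x) # (j, y) # v) = parity_sign (i * j) * f (u @ (j, y) # (i, x) # v)"
      using U.word_functional_commute[OF f, of x i y j u v] U.word_functional_zero_letter[OF f] x y commute[of x y] by simp
    moreover have "r (u @ (i + j, 0) # v) = 0" using U.word_functional_zero_letter[OF f] by (simp add: r_def)
    ultimately show "r (u @ (i, x) # (j, y) # v)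
      = parity_sign (i * j) * r (u @ (j, y) # (i, x) # v) + r (u @ (i + j, 0) # v)"
      by (simp add: r_def del: in_lists_conv_set append_in_lists_conv Cons_in_lists_iff)
  qed (simp add: r_def)
  let ?g = "\<lambda>w. if w \<in> lists P.S then symmetrized f w else 0"
  have g: "P.word_functional ?g"
    by (rule symmetrized_linear) (fact assms)+
  have letters: "A.S \<subseteq> P.S" using AP by (auto simp: letters_def)
  have A_even: "z = (0, snd z) \<or> z = (1, 0)" if "z \<in> A.S" for z
    using that odd by (cases z; cases "fst z") (auto simp: letters_def)
  have swap: "f (u @ x # y # v) = f (u @ y # x # v)" if xy: "x \<in> A.S" "y \<in> A.S" for u v x y
  proof -
    consider "x = (1, 0)" | "y = (1, 0)" | "x = (0, snd x)" "y = (0, snd y)" using A_even xy by blast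
    then show ?thesis
    proof cases
      case 1
      then show ?thesis using U.word_functional_zero_letter[OF f, of u 1 "y # v"] U.word_functional_zero_letter[OF f, of "u @ [y]" 1 v] by simp
    next
      case 2
      then show ?thesis using U.word_functional_zero_letter[OF f, of u 1 "x # v"] U.word_functional_zero_letter[OF f, of "u @ [x]" 1 v] by simp
    next
      case 3
      obtain a b where ab: "x = (0, a)" "y = (0, b)" using 3 by metis
      then show ?thesis
        using U.word_functional_commute[OF f, of a 0 b 0 u v] U.word_functional_zero_letter[OF f] xy commute[of a b] even
        by (auto simp: letters_def)
    qed
  qed
  have on_A: "symmetrized f w = f w" if w: "w \<in> lists A.S" for w
  proof -
    have perm: "f (map (\<lambda>i. w ! \<pi> i) [0..<length w]) = f w" if \<pi>: "\<pi> permutes {..<length w}" for \<pi>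
    proof (rule invariant_under_rearrangement[symmetric])
      show "mset w = mset (map (\<lambda>i. w ! \<pi> i) [0..<length w])"
        using mset_permute_list[OF \<pi>] by (simp add: permute_list_def)
      show "set w \<subseteq> A.S" using w by auto
    qed (rule swap)
    show ?thesis
    proof (cases "\<forall>z\<in>set w. fst z = 0")
      case True
      have "odd_sign \<pi> w = 1" if \<pi>: "\<pi> permutes {..<length w}" for \<pi>
      proof -
        have "fst (w ! \<pi> i) = 0" if "i < length w" for i
          using True permutes_in_image[OF \<pi>, of i] that by simp
        then have "{(i, j). i < j \<and> j < length w \<and> \<pi> j < \<pi> i \<and> fst (w ! \<pi> i) = 1 \<and> fst (w ! \<pi> j) = 1} = {}"
          by auto
        then show ?thesis unfolding odd_sign_def by (simp only: card.empty power_0)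
      qed
      then have "symmetrized f w = (\<Sum>\<pi> | \<pi> permutes {..<length w}. f w / fact (length w))"
        unfolding symmetrized_eq using perm by (intro sum.cong refl) simp
      also have "\<dots> = f w" by (simp add: card_permutations)
      finally show ?thesis .
    next
      case False
      then obtain z where z: "z \<in> set w" "fst z \<noteq> 0" by blast
      then have "z = (1, 0)" using A_even[of z] w by (metis fst_conv in_lists_conv_set)
      then have "f w = 0" using z U.word_functional_zero_letter[OF f] by (metis split_list)
      then show ?thesis unfolding symmetrized_eq using perm by simp
    qed
  qed
  show "pullback L P A (U.functional_of f) = A.functional_of r"
  proof
    fix X
    show "pullback L P A (U.functional_of f) X = A.functional_of r X"
    proof (cases "X \<in> carrier A.E")
      case False
      then show ?thesis by (simp add: pullback_def A.functional_of_def Sym_def)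
    next
      case True
      then have rep: "coset_rep X \<in> carrier A.F" by (rule A.coset_rep_props)
      then have repP: "coset_rep X \<in> carrier P.F" using letters by (auto simp: carrier_free_algebra)
      let ?p = "coset_rep (P.cls (coset_rep X))"
      have p: "?p \<in> carrier P.F" by (rule P.coset_rep_props[OF P.cls_closed[OF repP]])
      let ?s = "\<Sum>w\<in>Poly_Mapping.keys ?p. free_smult (Poly_Mapping.lookup ?p w) (symmetrize_word w)"
      have s: "?s \<in> carrier U.F"
      proof (intro free_algebra_sum_closed free_algebra_closed(5) symmetrize_word_keys)
        fix w assume "w \<in> Poly_Mapping.keys ?p"
        then have "w \<in> lists P.S" using p by (auto simp: carrier_free_algebra)
        then show "w \<in> lists U.S" by (auto simp: letters_def)
      qed
      have "pullback L P A (U.functional_of f) X = U.functional_of f (U.cls ?s)"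
        using True by (simp add: pullback_def Sym_def symmetrization_def Sym_inclusion_def)
      also have "\<dots> = (\<Sum>w\<in>Poly_Mapping.keys ?p. Poly_Mapping.lookup ?p w * symmetrized f w)"
        by (simp add: U.functional_of_cls[OF f s] lin_sum lin_smult symmetrized_def)
      also have "\<dots> = lin ?g ?p"
        unfolding lin_def using p by (intro sum.cong refl) (auto simp: carrier_free_algebra)
      also have "\<dots> = P.functional_of ?g (P.cls (coset_rep X))"
        by (simp add: P.functional_of_def P.cls_closed[OF repP])
      also have "\<dots> = lin ?g (coset_rep X)" by (rule P.functional_of_cls[OF g repP])
      also have "\<dots> = lin r (coset_rep X)"
      proof (rule lin_cong)
        fix w assume "w \<in> Poly_Mapping.keys (coset_rep X)"
        then have "w \<in> lists A.S" using rep by (auto simp: carrier_free_algebra)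
        moreover from this have "w \<in> lists P.S" using letters by auto
        ultimately show "?g w = r w" using on_A by (simp add: r_def del: in_lists_conv_set)
      qed
      also have "\<dots> = A.functional_of r X" using True by (simp add: A.functional_of_def)
      finally show ?thesis .
    qed
  qed
qed

section \<open>The symmetric pair\<close>

locale cartan_pair =
  fixes L :: "'g::ab_group_add lie_super" and \<theta> :: "'g \<Rightarrow> 'g" and \<kk> \<pp> \<hh> \<aa> :: "'g set"
  assumes lie: "lie_superalgebra L"
    and involution: "lie_involution L \<theta>"
    and kk_def: "\<kk> = {x. \<theta> x = x}"
    and pp_def: "\<pp> = {x. \<theta> x = - x}"
    and hh_subalgebra: "lie_subalgebra L \<hh>"
    and hh_even: "\<hh> \<subseteq> part L 0"
    and aa_def: "\<aa> = \<hh> \<inter> \<pp>"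
    and diagonalizable: "ad_diagonalizable L \<hh>"
    and hh_centralizer: "centralizer_in L UNIV \<hh> = \<hh>"
    and aa_centralizer: "centralizer_in L \<pp> \<aa> = \<aa>"
begin

sublocale LV: vector_space "scale L"
  using lie by (rule lie_superalgebra.vector_space)

sublocale U: enveloping L UNIV "bracket L"
  using lie by (rule enveloping_UNIV)

lemma part_closed:
  "0 \<in> part L i" "x \<in> part L i \<Longrightarrow> y \<in> part L i \<Longrightarrow> x + y \<in> part L i"
  "x \<in> part L i \<Longrightarrow> y \<in> part L i \<Longrightarrow> x - y \<in> part L i"
  "x \<in> part L i \<Longrightarrow> - x \<in> part L i" "x \<in> part L i \<Longrightarrow> scale L c x \<in> part L i"
  using lie_superalgebra.subspace_part[OF lie, of i] unfolding linear_subspace_def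
  by (simp_all add: LV.subspace_0 LV.subspace_add LV.subspace_diff LV.subspace_neg LV.subspace_scale)

lemma part_unique:
  assumes "x \<in> part L 0" "y \<in> part L 1" "x' \<in> part L 0" "y' \<in> part L 1" "x + y = x' + y'"
  shows "x = x'" "y = y'"
proof -
  have "\<exists>!p. fst p \<in> part L 0 \<and> snd p \<in> part L 1 \<and> x + y = fst p + snd p"
    by (rule lie_superalgebra.part_decomposition[OF lie])
  then have "(x, y) = (x', y')" using assms by (metis fst_conv snd_conv)
  then show "x = x'" "y = y'" by simp_all
qed

lemma part_components:
  obtains e where "\<And>i. e i \<in> part L i" "x = e 0 + e 1"
proof -
  obtain x0 x1 where x: "x0 \<in> part L 0" "x1 \<in> part L 1" "x = x0 + x1"
    using lie_superalgebra.part_decomposition[OF lie, of x] by (metis fst_conv snd_conv)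
  have "(if i = 0 then x0 else x1) \<in> part L i" for i using x by (cases i) auto
  with x(3) show ?thesis by (intro that[of "\<lambda>i. if i = 0 then x0 else x1"]) auto
qed

lemma components_unique:
  assumes "\<And>i. e i \<in> part L i" "\<And>i. e' i \<in> part L i" "e 0 + e 1 = e' 0 + e' 1"
  shows "e i = e' i"
  using part_unique[of "e 0" "e 1" "e' 0" "e' 1"] assms by (cases i) auto

lemma part_disjoint: "x \<in> part L 0 \<Longrightarrow> x \<in> part L 1 \<Longrightarrow> x = 0"
  using part_unique[of x 0 0 x] part_closed(1) by simp

lemma bracket_linear:
  "bracket L x (y + z) = bracket L x y + bracket L x z"
  "bracket L (x + y) z = bracket L x z + bracket L y z"
  "bracket L x (y - z) = bracket L x y - bracket L x z"
  "bracket L x (- y) = - bracket L x y" "bracket L (- x) y = - bracket L x y"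
  "bracket L x (scale L c y) = scale L c (bracket L x y)"
proof -
  have r: "Vector_Spaces.linear (scale L) (scale L) (\<lambda>y. bracket L x y)" for x
    using lie_superalgebra.linear_right[OF lie] by (simp add: linear_map_def)
  have l: "Vector_Spaces.linear (scale L) (scale L) (\<lambda>x. bracket L x y)" for y
    using lie_superalgebra.linear_left[OF lie] by (simp add: linear_map_def)
  interpret R: Vector_Spaces.linear "scale L" "scale L" "\<lambda>y. bracket L x y" by (rule r)
  interpret Ly: Vector_Spaces.linear "scale L" "scale L" "\<lambda>x. bracket L x y" by (rule l)
  interpret Lz: Vector_Spaces.linear "scale L" "scale L" "\<lambda>x. bracket L x z" by (rule l)
  show "bracket L x (y + z) = bracket L x y + bracket L x z" by (rule R.add)
  show "bracket L (x + y) z = bracket L x z + bracket L y z" by (rule Lz.add)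
  show "bracket L x (y - z) = bracket L x y - bracket L x z" by (rule R.diff)
  show "bracket L x (- y) = - bracket L x y" by (rule R.neg)
  show "bracket L (- x) y = - bracket L x y" by (rule Ly.neg)
  show "bracket L x (scale L c y) = scale L c (bracket L x y)" by (rule R.scale)
qed

lemma theta_linear:
  "\<theta> (x + y) = \<theta> x + \<theta> y" "\<theta> (x - y) = \<theta> x - \<theta> y" "\<theta> (- x) = - \<theta> x" "\<theta> (scale L c x) = scale L c (\<theta> x)"
proof -
  interpret T: Vector_Spaces.linear "scale L" "scale L" \<theta>
    using involution by (simp add: lie_involution_def linear_map_def)
  show "\<theta> (x + y) = \<theta> x + \<theta> y" by (rule T.add)
  show "\<theta> (x - y) = \<theta> x - \<theta> y" by (rule T.diff)
  show "\<theta> (- x) = - \<theta> x" by (rule T.neg)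
  show "\<theta> (scale L c x) = scale L c (\<theta> x)" by (rule T.scale)
qed

lemma theta_theta: "\<theta> (\<theta> x) = x"
  using involution by (simp add: lie_involution_def)

lemma theta_part: "x \<in> part L i \<Longrightarrow> \<theta> x \<in> part L i"
  using involution by (auto simp: lie_involution_def)

lemma theta_bracket: "\<theta> (bracket L x y) = bracket L (\<theta> x) (\<theta> y)"
  using involution by (simp add: lie_involution_def)

lemma antisym_even: "x \<in> part L i \<Longrightarrow> y \<in> part L 0 \<Longrightarrow> bracket L x y = - bracket L y x"
  using lie_superalgebra.super_antisym[OF lie, of x i y 0] by simp

lemma aa_even: "\<aa> \<subseteq> part L 0" and aa_pp: "\<aa> \<subseteq> \<pp>"
  using hh_even aa_def by auto

lemma aa_commute: "x \<in> \<aa> \<Longrightarrow> y \<in> \<aa> \<Longrightarrow> bracket L x y = 0"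
  using hh_centralizer aa_def by (auto simp: centralizer_in_def)

lemma aa_odd: "x \<in> \<aa> \<inter> part L 1 \<Longrightarrow> x = 0"
  using aa_even part_disjoint by blast

lemma pp_subspace: "linear_subspace L \<pp>"
  unfolding linear_subspace_def
  by (rule LV.subspaceI) (use theta_linear(4)[of 0 0] in \<open>auto simp: pp_def theta_linear LV.scale_minus_right\<close>)

lemma aa_subspace: "linear_subspace L \<aa>"
  using hh_subalgebra pp_subspace
  by (simp add: aa_def lie_subalgebra_def linear_subspace_def LV.subspace_inter)

sublocale P: enveloping L \<pp> zero_bracket
  using pp_subspace part_closed(1) lie
  by (intro enveloping.intro) (auto simp: linear_subspace_def LV.subspace_0)

sublocale A: enveloping L \<aa> zero_bracket
  using aa_subspace part_closed(1) lie
  by (intro enveloping.intro) (auto simp: linear_subspace_def LV.subspace_0)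

lemma kk_pp_decomposition:
  assumes "x \<in> part L i"
  obtains k p where "k \<in> \<kk> \<inter> part L i" "p \<in> \<pp> \<inter> part L i" "x = k + p"
proof
  have half: "scale L (1/2) z + scale L (1/2) z = z" for z
    by (simp add: LV.scale_left_distrib[symmetric])
  show "scale L (1/2) (x + \<theta> x) \<in> \<kk> \<inter> part L i"
    using assms by (auto simp: kk_def theta_linear theta_theta add.commute part_closed theta_part)
  show "scale L (1/2) (x - \<theta> x) \<in> \<pp> \<inter> part L i"
    using assms by (auto simp: pp_def theta_linear theta_theta part_closed theta_part LV.scale_minus_right[symmetric]
        simp del: LV.scale_minus_right)
  show "x = scale L (1/2) (x + \<theta> x) + scale L (1/2) (x - \<theta> x)"
    using half[of x] by (simp add: LV.scale_right_distrib LV.scale_right_diff_distrib)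
qed

lemma bracket_kk_pp:
  assumes "k \<in> \<kk> \<inter> part L i" "p \<in> \<pp> \<inter> part L j" shows "bracket L k p \<in> \<pp> \<inter> part L (i + j)"
  using assms lie_superalgebra.graded[OF lie, of k i p j]
  by (auto simp: kk_def pp_def theta_bracket bracket_linear)

text \<open>For a joint eigenvector \<open>v\<close> of parity \<open>i\<close> the vectors are \<open>q = v - \<theta> v\<close> and \<open>k = v + \<theta> v\<close>. A
  joint eigenvector on which \<open>\<aa>\<close> acts by zero yields no root vector.\<close>

definition root_vector :: "bit \<Rightarrow> 'g \<Rightarrow> bool" where
  "root_vector i q \<longleftrightarrow> q \<in> \<pp> \<inter> part L i \<and>
     (\<exists>k \<alpha>. k \<in> \<kk> \<inter> part L i \<and> (\<exists>y\<in>\<aa>. \<alpha> y \<noteq> 0) \<and> (\<forall>y\<in>\<aa>. bracket L k y = - scale L (\<alpha> y) q))"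

text \<open>If \<open>\<aa>\<close> acts on \<open>v\<close> with eigenvalue zero, then \<open>v - \<theta> v\<close> centralizes \<open>\<aa>\<close> and hence lies in \<open>\<aa>\<close>.\<close>

lemma root_vector_or_aa:
  assumes v: "v \<in> part L i" and eigen: "\<forall>y\<in>\<aa>. \<exists>c. bracket L y v = scale L c v"
  shows "v - \<theta> v \<in> \<aa> \<inter> part L i \<or> root_vector i (v - \<theta> v)"
proof -
  let ?q = "v - \<theta> v" and ?k = "v + \<theta> v"
  have q: "?q \<in> \<pp> \<inter> part L i" and k: "?k \<in> \<kk> \<inter> part L i"
    using v by (auto simp: pp_def kk_def theta_linear theta_theta part_closed theta_part)
  obtain \<alpha> where \<alpha>: "\<And>y. y \<in> \<aa> \<Longrightarrow> bracket L y v = scale L (\<alpha> y) v" using eigen by metis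
  have \<alpha>': "bracket L y (\<theta> v) = - scale L (\<alpha> y) (\<theta> v)" if y: "y \<in> \<aa>" for y
  proof -
    have "bracket L y (\<theta> v) = \<theta> (bracket L (\<theta> y) v)" by (simp add: theta_bracket theta_theta)
    also have "\<theta> y = - y" using y aa_pp by (auto simp: pp_def)
    finally show ?thesis using \<alpha>[OF y] by (simp add: bracket_linear theta_linear)
  qed
  have anti: "bracket L x y = - bracket L y x" if "x \<in> part L i" "y \<in> \<aa>" for x y
    using that aa_even by (intro antisym_even[of _ i]) auto
  show ?thesis
  proof (cases "\<exists>y\<in>\<aa>. \<alpha> y \<noteq> 0")
    case True
    have "bracket L ?k y = - scale L (\<alpha> y) ?q" if "y \<in> \<aa>" for y
      using anti[of ?k y] k that \<alpha>[OF that] \<alpha>'[OF that]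
      by (simp add: bracket_linear LV.scale_right_diff_distrib)
    then show ?thesis using q k True unfolding root_vector_def by blast
  next
    case False
    have "bracket L ?q y = 0" if "y \<in> \<aa>" for y
      using anti[of ?q y] q that \<alpha>[OF that] \<alpha>'[OF that] False by (simp add: bracket_linear)
    then have "?q \<in> \<aa>" using q aa_centralizer by (auto simp: centralizer_in_def)
    then show ?thesis using q by blast
  qed
qed

text \<open>In other words, the part of \<open>\<pp>\<close> of parity \<open>i\<close> is spanned by \<open>\<aa>\<close> and root vectors. An eigenbasis
  of \<open>\<gg>\<close> need not be homogeneous, but \<open>\<aa>\<close> is even, so the components of an eigenvector are
  eigenvectors too. Hence \<open>h (e - \<theta> e) = 0\<close> holds for the component \<open>e\<close> of parity \<open>i\<close> of any vector,
  and for \<open>e\<close> in \<open>\<pp>\<close> this is \<open>2 h e\<close>.\<close>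

lemma functional_vanishes_on_pp:
  fixes h :: "'g \<Rightarrow> complex"
  assumes add: "\<And>x y. x \<in> part L i \<Longrightarrow> y \<in> part L i \<Longrightarrow> h (x + y) = h x + h y"
    and scale: "\<And>c x. x \<in> part L i \<Longrightarrow> h (scale L c x) = c * h x"
    and aa: "\<And>x. x \<in> \<aa> \<inter> part L i \<Longrightarrow> h x = 0"
    and root: "\<And>q. root_vector i q \<Longrightarrow> h q = 0"
    and x: "x \<in> \<pp> \<inter> part L i"
  shows "h x = 0"
proof -
  obtain B where B: "linear_basis L B" and eigen: "\<forall>y\<in>\<hh>. \<forall>b\<in>B. \<exists>c. bracket L y b = scale L c b"
    using diagonalizable unfolding ad_diagonalizable_def by blast
  have "\<forall>e. (\<forall>j. e j \<in> part L j) \<and> x = e 0 + e 1 \<longrightarrow> h (e i - \<theta> (e i)) = 0" for x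
  proof -
    have "x \<in> LV.span B" using B by (simp add: linear_basis_def)
    then show ?thesis
    proof (induction rule: LV.span_induct_alt)
      case base
      show ?case
      proof (intro allI impI)
        fix e assume e: "(\<forall>j. e j \<in> part L j) \<and> 0 = e 0 + e 1"
        then have "e i = 0" using components_unique[of e "\<lambda>_. 0" i] part_closed(1) by simp
        then show "h (e i - \<theta> (e i)) = 0" using scale[of 0 0] part_closed(1) theta_linear(4)[of 0 0] by simp
      qed
    next
      case (step c b y)
      obtain eb where eb: "\<And>j. eb j \<in> part L j" "b = eb 0 + eb 1"
        using part_components[of b] by blast
      obtain ey where ey: "\<And>j. ey j \<in> part L j" "y = ey 0 + ey 1"
        using part_components[of y] by blast
      have b: "h (eb i - \<theta> (eb i)) = 0"
      proof -
        have "\<exists>c. bracket L z (eb i) = scale L c (eb i)" if z: "z \<in> \<aa>" for z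
        proof -
          obtain c where c: "bracket L z b = scale L c b" using eigen step.hyps z aa_def by blast
          have "bracket L z (eb i) = scale L c (eb i)"
          proof (rule components_unique[of "\<lambda>j. bracket L z (eb j)" "\<lambda>j. scale L c (eb j)"])
            show "bracket L z (eb j) \<in> part L j" for j
              using lie_superalgebra.graded[OF lie, of z 0 "eb j" j] z aa_even eb(1) by auto
            show "bracket L z (eb 0) + bracket L z (eb 1) = scale L c (eb 0) + scale L c (eb 1)"
              using c by (simp add: eb(2) bracket_linear LV.scale_right_distrib)
          qed (simp add: part_closed eb)
          then show ?thesis ..
        qed
        then show ?thesis using root_vector_or_aa[OF eb(1)[of i]] aa root by blast
      qed
      show ?case
      proof (intro allI impI)
        fix e assume e: "(\<forall>j. e j \<in> part L j) \<and> scale L c b + y = e 0 + e 1"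
        have "e i = scale L c (eb i) + ey i"
          by (rule components_unique[of e "\<lambda>j. scale L c (eb j) + ey j"])
            (use e eb ey in \<open>auto simp: part_closed LV.scale_right_distrib add_ac\<close>)
        then have "e i - \<theta> (e i) = scale L c (eb i - \<theta> (eb i)) + (ey i - \<theta> (ey i))"
          by (simp add: theta_linear LV.scale_right_diff_distrib)
        then show "h (e i - \<theta> (e i)) = 0"
          using b step.IH ey eb by (simp add: add scale part_closed theta_part)
      qed
    qed
  qed
  note main = this[of x, rule_format, of "\<lambda>j. if j = i then x else 0"]
  have "h (x - \<theta> x) = 0"
    using main x part_closed(1) by (cases i) auto
  moreover have "x - \<theta> x = x + x" using x by (simp add: pp_def)
  ultimately show ?thesis using add[of x x] x by simp
qed

end

section \<open>A functional on the pair is determined by its values on words in the Cartan subspace\<close>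

text \<open>The step of the induction on the length \<open>n\<close> of words. The assumption on shorter words is what
  removes the commutators when letters of a word of length \<open>n\<close> are interchanged.\<close>

locale radial_functional = cartan_pair +
  fixes f :: "'a word \<Rightarrow> complex" and n :: nat
  assumes f: "U.word_functional f" and kills: "biannihilates L \<kk> f"
    and aa_zero: "\<And>w. w \<in> lists A.S \<Longrightarrow> f w = 0"
    and shorter: "\<And>w. length w < n \<Longrightarrow> f w = 0"
begin

lemma pass_letter:
  assumes "x \<in> part L i" "z \<in> part L j"
  shows "f (u @ (i, x) # (j, z) # v) = parity_sign (i * j) * f (u @ (j, z) # (i, x) # v)
    + f (u @ (i + j, bracket L x z) # v)"
  using U.word_functional_commute[OF f, of x i z j u v] assms by simp

lemma swap_letters:
  assumes "x \<in> part L i" "z \<in> part L j" "length u + length v + 2 = n"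
  shows "f (u @ (i, x) # (j, z) # v) = parity_sign (i * j) * f (u @ (j, z) # (i, x) # v)"
  using pass_letter[OF assms(1,2), of u v] assms(3) by (simp add: shorter)

lemma kk_letter_vanishes:
  assumes "k \<in> \<kk> \<inter> part L i" "length u + Suc (length v) = n" "v \<in> lists U.S"
  shows "f (u @ (i, k) # v) = 0"
  using assms
proof (induction v arbitrary: u)
  case Nil
  then show ?case using kills by (simp add: biannihilates_def)
next
  case (Cons z v)
  obtain j x where z: "z = (j, x)" "x \<in> part L j" using Cons.prems(3) by (cases z) (auto simp: letters_def)
  have "f (u @ (j, x) # (i, k) # v) = 0" using Cons.IH[of "u @ [z]"] Cons.prems z by simp
  then show ?case using swap_letters[of k i x j u v] Cons.prems z by simp
qed

lemma move_past_aa: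
  assumes "q \<in> part L i" "set ys \<subseteq> {0} \<times> \<aa>" "length u + length ys + length v + 1 = n"
  shows "f (u @ (i, q) # ys @ v) = f (u @ ys @ (i, q) # v)"
  using assms
proof (induction ys arbitrary: u)
  case (Cons z ys)
  obtain y where z: "z = (0, y)" "y \<in> part L 0" using Cons.prems(2) aa_even by auto
  have "f (u @ (i, q) # (0, y) # ys @ v) = f (u @ (0, y) # (i, q) # ys @ v)"
    using swap_letters[of q i y 0 u "ys @ v"] Cons.prems z by simp
  also have "\<dots> = f (u @ (0, y) # ys @ (i, q) # v)"
    using Cons.IH[of "u @ [z]"] Cons.prems z by simp
  finally show ?case using z by simp
qed simp

text \<open>The letters in \<open>ps\<close> may belong to \<open>\<aa>\<close> as well, so raising \<open>j\<close> allows more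
  letters outside \<open>\<aa>\<close>. For \<open>j = n\<close> the condition covers all words of length \<open>n\<close> in \<open>\<pp>\<close>.\<close>

definition vanishes_at :: "nat \<Rightarrow> bool" where
  "vanishes_at j \<longleftrightarrow> (\<forall>ys ps. set ys \<subseteq> {0} \<times> \<aa> \<longrightarrow> ps \<in> lists P.S \<longrightarrow> length ps = j \<longrightarrow>
     length ys + j = n \<longrightarrow> f (ys @ ps) = 0)"

text \<open>Here the word has length \<open>n + 1\<close>. Moving \<open>k\<close> through \<open>ps'\<close> leaves behind words in which
  a letter is replaced by a commutator; it lies in \<open>\<pp>\<close> again, so \<open>vanishes_at j\<close> applies to them.\<close>

lemma pass_pp:
  assumes "vanishes_at j" "k \<in> \<kk> \<inter> part L i" "set ys \<subseteq> {0} \<times> \<aa>" "ps @ ps' \<in> lists P.S"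
    "length (ps @ ps') = j" "length ys + j = n"
  shows "f (ys @ ps @ (i, k) # ps') = 0"
  using assms(4,5)
proof (induction ps' arbitrary: ps)
  case Nil
  have "f ((ys @ ps) @ [(i, k)]) = 0" using kills assms(2) unfolding biannihilates_def by blast
  then show ?case by simp
next
  case (Cons z ps')
  obtain i' x where z: "z = (i', x)" "x \<in> \<pp> \<inter> part L i'" using Cons.prems(1) by (cases z) (auto simp: letters_def)
  have "f (ys @ ps @ (i', x) # (i, k) # ps') = 0" using Cons.IH[of "ps @ [z]"] Cons.prems z by simp
  moreover have "f (ys @ (ps @ (i + i', bracket L k x) # ps')) = 0"
    using assms(1,3,6) Cons.prems bracket_kk_pp[OF assms(2) z(2)]
    unfolding vanishes_at_def by (simp add: letters_def)
  ultimately show ?case using pass_letter[of k i x i' "ys @ ps" ps'] assms(2) z by simp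
qed

text \<open>The relation comes from a letter \<open>k\<close> that travels from the start of a word of length \<open>n + 1\<close> to
  its end. Passing a letter \<open>z\<close> from \<open>\<aa>\<close> leaves behind a word in which \<open>- \<alpha>(z) q\<close> stands for \<open>z\<close>. The
  words contain copies of a fixed \<open>y\<close> with \<open>\<alpha>(y) \<noteq> 0\<close>, and the induction is on the number of letters from \<open>\<aa>\<close> that are not among these
  copies of \<open>y\<close>.\<close>

lemma root_letter_vanishes:
  assumes j: "vanishes_at j" and q: "root_vector i q" and ps: "ps \<in> lists P.S" "length ps = j"
    and ys: "set ys \<subseteq> {0} \<times> \<aa>" "length ys + Suc j = n"
  shows "f (ys @ (i, q) # ps) = 0"
proof -
  obtain k \<alpha> y where k: "k \<in> \<kk> \<inter> part L i" and y: "y \<in> \<aa>" "\<alpha> y \<noteq> 0"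
    and \<alpha>: "\<And>y. y \<in> \<aa> \<Longrightarrow> bracket L k y = - scale L (\<alpha> y) q" and qi: "q \<in> part L i"
    using q unfolding root_vector_def by blast
  let ?y = "\<lambda>r. replicate r (0::bit, y)"
  have y_aa: "set (?y r) \<subseteq> {0} \<times> \<aa>" for r using y(1) by auto
  have pass_aa: "f (u @ (i, k) # (0, z) # v) = f (u @ (0, z) # (i, k) # v) - \<alpha> z * f (u @ (i, q) # v)"
    if z: "z \<in> \<aa>" for u z v
  proof -
    have "f (u @ (i, - scale L (\<alpha> z) q) # v) = - \<alpha> z * f (u @ (i, q) # v)"
      using U.word_functional_scale[OF f, of q i u "- \<alpha> z" v] qi by (simp add: LV.scale_minus_left)
    then show ?thesis using pass_letter[of k i z 0 u v] k z aa_even \<alpha>[OF z] by auto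
  qed
  have "f (?y r @ zs @ (i, q) # ps) = 0" if "set zs \<subseteq> {0} \<times> \<aa>" "r + length zs + Suc j = n" for r zs
    using that
  proof (induction "length zs" arbitrary: zs r rule: less_induct)
    case less
    \<comment> \<open>Beyond the first \<open>r + 1\<close> copies of \<open>y\<close>, passing a letter leaves a word with one more copy.\<close>
    have transit: "f (?y (Suc r) @ zs1 @ (i, k) # zs2 @ ps) = 0" if "zs = zs1 @ zs2" for zs1 zs2
      using that
    proof (induction zs2 arbitrary: zs1)
      case Nil
      have "f ((?y (Suc r) @ zs) @ [] @ (i, k) # ps) = 0"
        by (rule pass_pp[OF j k]) (use less.prems y_aa[of "Suc r"] ps in auto)
      then show ?case using Nil by simp
    next
      case (Cons z zs2)
      obtain x where z: "z = (0, x)" "x \<in> \<aa>" using Cons.prems less.prems(1) by auto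
      have "f (?y (Suc r) @ zs1 @ (0, x) # (i, k) # zs2 @ ps) = 0" using Cons.IH[of "zs1 @ [z]"] Cons.prems z by simp
      moreover have "f ((?y (Suc r) @ zs1) @ (i, q) # zs2 @ ps) = f ((?y (Suc r) @ zs1) @ zs2 @ (i, q) # ps)"
        using Cons.prems less.prems qi ps by (intro move_past_aa) auto
      moreover have "f (?y (Suc r) @ (zs1 @ zs2) @ (i, q) # ps) = 0"
        using Cons.prems less.prems by (intro less.hyps) auto
      ultimately show ?case using pass_aa[OF z(2), of "?y (Suc r) @ zs1" "zs2 @ ps"] z by simp
    qed
    \<comment> \<open>Each of the last \<open>t\<close> copies of \<open>y\<close> contributes the same term; \<open>s = 0\<close> is the case of interest.\<close>
    have count: "f (?y s @ (i, k) # ?y t @ zs @ ps) = - of_nat t * \<alpha> y * f (?y r @ zs @ (i, q) # ps)"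
      if "s + t = Suc r" for s t
      using that
    proof (induction t arbitrary: s)
      case 0
      then show ?case using transit[of "[]" zs] by simp
    next
      case (Suc t)
      have "f (?y s @ (0, y) # (i, k) # ?y t @ zs @ ps) = - of_nat t * \<alpha> y * f (?y r @ zs @ (i, q) # ps)"
        using Suc.IH[of "Suc s"] Suc.prems by (simp add: replicate_append_same[symmetric])
      moreover have "f (?y s @ (i, q) # (?y t @ zs) @ ps) = f (?y s @ (?y t @ zs) @ (i, q) # ps)"
        using Suc.prems less.prems qi ps y_aa[of t] by (intro move_past_aa) auto
      then have "f (?y s @ (i, q) # ?y t @ zs @ ps) = f ((?y s @ ?y t) @ zs @ (i, q) # ps)"
        by (simp only: append_assoc)
      moreover have "?y s @ ?y t = ?y r" using Suc.prems by (simp add: replicate_add[symmetric])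
      ultimately have "f (?y s @ (i, k) # (0, y) # ?y t @ zs @ ps)
          = - of_nat t * \<alpha> y * f (?y r @ zs @ (i, q) # ps) - \<alpha> y * f (?y r @ zs @ (i, q) # ps)"
        using pass_aa[OF y(1), of "?y s" "?y t @ zs @ ps"] by (simp del: append_assoc)
      then show ?case by (simp add: ring_distribs)
    qed
    have "f ((i, k) # ?y (Suc r) @ zs @ ps) = 0" using kills k unfolding biannihilates_def by blast
    then show ?case using count[of 0 "Suc r"] y(2) by (simp del: of_nat_Suc)
  qed
  from this[of ys 0] show ?thesis using ys by simp
qed

lemma vanishes_at_all: "vanishes_at j"
proof (induction j)
  case 0
  have "{0} \<times> \<aa> \<subseteq> A.S" using aa_even by (auto simp: letters_def)
  then have "f ys = 0" if "set ys \<subseteq> {0} \<times> \<aa>" for ys :: "'a word"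
    using that by (intro aa_zero) auto
  then show ?case unfolding vanishes_at_def by simp
next
  case (Suc j)
  show ?case unfolding vanishes_at_def
  proof (intro allI impI)
    fix ys ps :: "'a word" assume ys: "set ys \<subseteq> {0} \<times> \<aa>" and ps: "ps \<in> lists P.S" "length ps = Suc j"
      and n: "length ys + Suc j = n"
    obtain i x ps' where ps': "ps = (i, x) # ps'" "x \<in> \<pp> \<inter> part L i" "ps' \<in> lists P.S" "length ps' = j"
      using ps by (cases ps) (auto simp: letters_def)
    have "f (ys @ (i, x) # ps') = 0"
    proof (rule functional_vanishes_on_pp[where h = "\<lambda>x. f (ys @ (i, x) # ps')" and i = i])
      fix x assume x: "x \<in> \<aa> \<inter> part L i"
      show "f (ys @ (i, x) # ps') = 0"
      proof (cases i)
        case zero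
        then have "f ((ys @ [(0, x)]) @ ps') = 0"
          using Suc[unfolded vanishes_at_def, rule_format, of "ys @ [(0, x)]" ps'] ys ps' n x by simp
        then show ?thesis using zero by simp
      next
        case one
        then have "x = 0" using aa_odd x by blast
        then show ?thesis using U.word_functional_zero_letter[OF f] by simp
      qed
    next
      fix q assume "root_vector i q"
      then show "f (ys @ (i, q) # ps') = 0"
        using root_letter_vanishes[OF Suc] ps' ys n by simp
    qed (use U.word_functional_add[OF f] U.word_functional_scale[OF f] ps' in auto)
    then show "f (ys @ ps) = 0" using ps' by simp
  qed
qed

lemma vanishes_at_length:
  assumes "ps \<in> lists P.S" "w \<in> lists U.S" "length ps + length w = n"
  shows "f (ps @ w) = 0"
  using assms
proof (induction w arbitrary: ps)
  case Nil
  then show ?case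
    using vanishes_at_all[of n, unfolded vanishes_at_def, rule_format, of "[]" ps] by simp
next
  case (Cons z w)
  obtain i x where z: "z = (i, x)" "x \<in> part L i" using Cons.prems(2) by (cases z) (auto simp: letters_def)
  obtain k p where kp: "k \<in> \<kk> \<inter> part L i" "p \<in> \<pp> \<inter> part L i" "x = k + p"
    using kk_pp_decomposition[OF z(2)] .
  have "f (ps @ (i, k) # w) = 0" using kk_letter_vanishes[OF kp(1)] Cons.prems by simp
  moreover have "f (ps @ (i, p) # w) = 0" using Cons.IH[of "ps @ [(i, p)]"] Cons.prems kp by (simp add: letters_def)
  ultimately show ?case using U.word_functional_add[OF f, of k i p ps w] kp z by simp
qed

end

text \<open>The filtration by length replaces the associated graded algebra: on words of length \<open>n\<close>, the
  functional behaves as one on the supersymmetric algebra of \<open>\<pp>\<close> as soon as it vanishes on shorter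
  words.\<close>

lemma (in cartan_pair) restriction_injective:
  assumes f: "U.word_functional f" and kills: "biannihilates L \<kk> f"
    and aa_zero: "\<And>w. w \<in> lists A.S \<Longrightarrow> f w = 0"
  shows "f w = 0"
proof (induction "length w" arbitrary: w rule: less_induct)
  case less
  interpret radial_functional L \<theta> \<kk> \<pp> \<hh> \<aa> f "length w"
    using assms less by unfold_locales
  show ?case
    using vanishes_at_length[of "[]" w] U.word_functional_support[OF f, of w] by (cases "w \<in> lists U.S") auto
qed

section \<open>The embedding\<close>

lemma embedding_of_injection:
  assumes B: "algebra complex_field B"
    and inj: "inj_on f (carrier A)"
    and range: "\<And>x. x \<in> carrier A \<Longrightarrow> f x \<in> carrier B"
    and mult: "\<And>x y. x \<in> carrier A \<Longrightarrow> y \<in> carrier A \<Longrightarrow>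
      x \<otimes>\<^bsub>A\<^esub> y \<in> carrier A \<and> f (x \<otimes>\<^bsub>A\<^esub> y) = f x \<otimes>\<^bsub>B\<^esub> f y"
    and add: "\<And>x y. x \<in> carrier A \<Longrightarrow> y \<in> carrier A \<Longrightarrow>
      x \<oplus>\<^bsub>A\<^esub> y \<in> carrier A \<and> f (x \<oplus>\<^bsub>A\<^esub> y) = f x \<oplus>\<^bsub>B\<^esub> f y"
    and smult: "\<And>c x. x \<in> carrier A \<Longrightarrow>
      c \<odot>\<^bsub>A\<^esub> x \<in> carrier A \<and> f (c \<odot>\<^bsub>A\<^esub> x) = c \<odot>\<^bsub>B\<^esub> f x"
    and one: "\<one>\<^bsub>A\<^esub> \<in> carrier A" "f \<one>\<^bsub>A\<^esub> = \<one>\<^bsub>B\<^esub>"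
    and zero: "\<zero>\<^bsub>A\<^esub> \<in> carrier A" "f \<zero>\<^bsub>A\<^esub> = \<zero>\<^bsub>B\<^esub>"
  shows "commutative_algebra_embedding A B f"
proof -
  have "algebra complex_field A"
    by (rule algebra_of_injection[OF B inj range mult add smult one zero])
  moreover have "f \<in> ring_hom A B"
    by (rule ring_hom_memI) (simp_all add: range mult add one)
  ultimately show ?thesis
    unfolding commutative_algebra_embedding_def using B inj smult by blast
qed

context enveloping
begin

lemma algebra_finite_dual:
  assumes "algebra complex_field (env_dual L V b)"
  shows "algebra complex_field (env_dual L V b\<lparr>carrier := finite_dual E\<rparr>)" (is "algebra _ ?A")
proof -
  have carrier: "carrier ?A = functional_of ` {f. word_functional f \<and> finitely_translated f}"
    by (auto simp: finite_dual_eq linear_functionals_eq word_values_functional_of)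
  have intro: "word_functional f \<Longrightarrow> finitely_translated f \<Longrightarrow> functional_of f \<in> carrier ?A" for f
    by (auto simp: carrier)
  have elim: "x \<in> carrier ?A \<Longrightarrow> \<exists>f. word_functional f \<and> finitely_translated f \<and> x = functional_of f" for x
    by (auto simp: carrier)
  note closed = word_functional_zero word_functional_sum word_functional_smult word_functional_shuffle word_functional_counit finitely_translated_zero finitely_translated_sum
    finitely_translated_scale finitely_translated_shuffle finitely_translated_counit
  show ?thesis
  proof (rule algebra_of_injection[OF assms, of "\<lambda>x. x"])
    show "x \<in> carrier (env_dual L V b)" if "x \<in> carrier ?A" for x
      using elim[OF that] by (auto simp: carrier_env_dual)
    show "x \<otimes>\<^bsub>?A\<^esub> y \<in> carrier ?A \<and> x \<otimes>\<^bsub>?A\<^esub> y = x \<otimes>\<^bsub>env_dual L V b\<^esub> y"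
      if xy: "x \<in> carrier ?A" "y \<in> carrier ?A" for x y
      using elim[OF xy(1)] elim[OF xy(2)] intro[OF word_functional_shuffle finitely_translated_shuffle]
      by (auto simp: functional_of_mult)
    show "x \<oplus>\<^bsub>?A\<^esub> y \<in> carrier ?A \<and> x \<oplus>\<^bsub>?A\<^esub> y = x \<oplus>\<^bsub>env_dual L V b\<^esub> y"
      if xy: "x \<in> carrier ?A" "y \<in> carrier ?A" for x y
      using elim[OF xy(1)] elim[OF xy(2)] intro[OF word_functional_sum finitely_translated_sum]
      by (auto simp: functional_of_add)
    show "c \<odot>\<^bsub>?A\<^esub> x \<in> carrier ?A \<and> c \<odot>\<^bsub>?A\<^esub> x = c \<odot>\<^bsub>env_dual L V b\<^esub> x"
      if x: "x \<in> carrier ?A" for c x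
      using elim[OF x] intro[OF word_functional_smult finitely_translated_scale] by (auto simp: functional_of_smult)
    show "\<one>\<^bsub>?A\<^esub> \<in> carrier ?A" using intro[OF word_functional_counit finitely_translated_counit] by (simp add: functional_of_one)
    show "\<zero>\<^bsub>?A\<^esub> \<in> carrier ?A" using intro[OF word_functional_zero finitely_translated_zero] by (simp add: functional_of_zero)
  qed (simp_all add: inj_on_def)
qed

end

context cartan_pair
begin

definition restriction :: "('g word \<Rightarrow> complex) \<Rightarrow> 'g word \<Rightarrow> complex" where
  "restriction f = (\<lambda>w. if w \<in> lists A.S then f w else 0)"

lemma pullback_functional_of:
  assumes "U.word_functional f"
  shows "A.word_functional (restriction f)"
    and "pullback L \<pp> \<aa> (U.functional_of f) = A.functional_of (restriction f)"
  unfolding restriction_def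
  using pullback_eq_restriction[OF U.enveloping_axioms P.enveloping_axioms A.enveloping_axioms aa_pp aa_even
      aa_commute aa_odd assms] by blast+

lemma restriction_shuffle:
  assumes "U.word_functional f" "U.word_functional g"
  shows "restriction (super_shuffle f g) = super_shuffle (restriction f) (restriction g)"
proof
  fix w
  show "restriction (super_shuffle f g) w = super_shuffle (restriction f) (restriction g) w"
  proof (cases "w \<in> lists A.S")
    case True
    then show ?thesis
      using shuffle_cong[of A.S f "restriction f" g "restriction g" w] by (simp add: restriction_def del: in_lists_conv_set)
  next
    case False
    then show ?thesis
      using A.word_functional_support[OF A.word_functional_shuffle] pullback_functional_of(1) assms by (simp add: restriction_def del: in_lists_conv_set)
  qed
qed

text \<open>Both halves of the theorem are instances: \<open>N\<close> is the set of word functions of \<open>\<A>(\<gg>,\<kk>)\<close>, or of its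
  intersection with the finite dual.\<close>

lemma pullback_embedding:
  assumes N: "\<And>f. f \<in> N \<Longrightarrow> U.word_functional f \<and> biannihilates L \<kk> f"
    and closed: "\<And>f g. f \<in> N \<Longrightarrow> g \<in> N \<Longrightarrow> super_shuffle f g \<in> N" "\<And>f g. f \<in> N \<Longrightarrow> g \<in> N \<Longrightarrow> (\<lambda>w. f w + g w) \<in> N"
      "\<And>c f. f \<in> N \<Longrightarrow> (\<lambda>w. c * f w) \<in> N" "(\<lambda>w. of_bool (w = [])) \<in> N" "(\<lambda>w. 0) \<in> N"
    and C: "C = U.functional_of ` N"
    and D: "algebra complex_field (env_dual L \<aa> zero_bracket\<lparr>carrier := D\<rparr>)"
    and range: "\<And>f. f \<in> N \<Longrightarrow> A.functional_of (restriction f) \<in> D"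
  shows "commutative_algebra_embedding (env_dual L UNIV (bracket L)\<lparr>carrier := C\<rparr>)
    (env_dual L \<aa> zero_bracket\<lparr>carrier := D\<rparr>) (pullback L \<pp> \<aa>)"
proof -
  let ?A = "env_dual L UNIV (bracket L)\<lparr>carrier := C\<rparr>" and ?B = "env_dual L \<aa> zero_bracket\<lparr>carrier := D\<rparr>"
  let ?h = "pullback L \<pp> \<aa>"
  have wf: "U.word_functional f" if "f \<in> N" for f using N that by blast
  have h: "?h (U.functional_of f) = A.functional_of (restriction f)" if "f \<in> N" for f
    using pullback_functional_of wf[OF that] by blast
  have wfA: "A.word_functional (restriction f)" if "f \<in> N" for f
    using pullback_functional_of wf[OF that] by blast
  have elim: "x \<in> carrier ?A \<Longrightarrow> \<exists>f\<in>N. x = U.functional_of f" for x by (auto simp: C)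
  have intro: "f \<in> N \<Longrightarrow> U.functional_of f \<in> carrier ?A" for f by (simp add: C)
  have res: "restriction (\<lambda>w. f w + g w) = (\<lambda>w. restriction f w + restriction g w)"
    "restriction (\<lambda>w. c * f w) = (\<lambda>w. c * restriction f w)" for f g c
    by (simp_all add: restriction_def fun_eq_iff)
  show ?thesis
  proof (rule embedding_of_injection[OF D])
    show "inj_on ?h (carrier ?A)"
    proof (rule inj_onI)
      fix x y assume "x \<in> carrier ?A" "y \<in> carrier ?A" and eq: "?h x = ?h y"
      then obtain f g where f: "f \<in> N" "x = U.functional_of f" and g: "g \<in> N" "y = U.functional_of g"
        using elim by blast
      have "restriction f = restriction g"
        using eq f g h wfA A.functional_of_inj by metis
      define d where "d = (\<lambda>w. f w + (- 1) * g w)"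
      have "d \<in> N" unfolding d_def by (intro closed f g)
      have "d w = 0" for w
      proof (rule restriction_injective)
        show "U.word_functional d" "biannihilates L \<kk> d" using N[OF \<open>d \<in> N\<close>] by simp_all
        fix w assume "w \<in> lists A.S"
        then show "d w = 0"
          using fun_cong[OF \<open>restriction f = restriction g\<close>, of w] by (simp add: d_def restriction_def del: in_lists_conv_set)
      qed
      then have "f = g" by (simp add: d_def fun_eq_iff)
      then show "x = y" using f g by simp
    qed
    show "?h x \<in> carrier ?B" if "x \<in> carrier ?A" for x
      using elim[OF that] h range by auto
    show "x \<otimes>\<^bsub>?A\<^esub> y \<in> carrier ?A \<and> ?h (x \<otimes>\<^bsub>?A\<^esub> y) = ?h x \<otimes>\<^bsub>?B\<^esub> ?h y"
      if xy: "x \<in> carrier ?A" "y \<in> carrier ?A" for x y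
    proof -
      obtain f g where f: "f \<in> N" "x = U.functional_of f" and g: "g \<in> N" "y = U.functional_of g"
        using elim xy by blast
      then show ?thesis
        using intro[OF closed(1)[OF f(1) g(1)]]
        by (simp add: U.functional_of_mult A.functional_of_mult h closed wf wfA restriction_shuffle)
    qed
    show "x \<oplus>\<^bsub>?A\<^esub> y \<in> carrier ?A \<and> ?h (x \<oplus>\<^bsub>?A\<^esub> y) = ?h x \<oplus>\<^bsub>?B\<^esub> ?h y"
      if xy: "x \<in> carrier ?A" "y \<in> carrier ?A" for x y
    proof -
      obtain f g where f: "f \<in> N" "x = U.functional_of f" and g: "g \<in> N" "y = U.functional_of g"
        using elim xy by blast
      then show ?thesis
        using intro[OF closed(2)[OF f(1) g(1)]]
        by (simp add: U.functional_of_add A.functional_of_add h closed res)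
    qed
    show "c \<odot>\<^bsub>?A\<^esub> x \<in> carrier ?A \<and> ?h (c \<odot>\<^bsub>?A\<^esub> x) = c \<odot>\<^bsub>?B\<^esub> ?h x"
      if x: "x \<in> carrier ?A" for c x
    proof -
      obtain f where f: "f \<in> N" "x = U.functional_of f" using elim x by blast
      then show ?thesis
        using intro[OF closed(3)[OF f(1)]]
        by (simp add: U.functional_of_smult A.functional_of_smult h closed res)
    qed
    have "restriction (\<lambda>w. of_bool (w = [])) = (\<lambda>w. of_bool (w = []))"
      by (auto simp: restriction_def fun_eq_iff)
    then show "\<one>\<^bsub>?A\<^esub> \<in> carrier ?A" "?h \<one>\<^bsub>?A\<^esub> = \<one>\<^bsub>?B\<^esub>"
      using intro[OF closed(4)] h[OF closed(4)] by (simp_all add: U.functional_of_one A.functional_of_one)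
    have "restriction (\<lambda>w. 0) = (\<lambda>w. 0)" by (simp add: restriction_def fun_eq_iff)
    then show "\<zero>\<^bsub>?A\<^esub> \<in> carrier ?A" "?h \<zero>\<^bsub>?A\<^esub> = \<zero>\<^bsub>?B\<^esub>"
      using intro[OF closed(5)] h[OF closed(5)] by (simp_all add: U.functional_of_zero A.functional_of_zero)
  qed
qed

lemma biannihilates_closed:
  "biannihilates L \<kk> f \<Longrightarrow> biannihilates L \<kk> g \<Longrightarrow> biannihilates L \<kk> (\<lambda>w. f w + g w)"
  "biannihilates L \<kk> f \<Longrightarrow> biannihilates L \<kk> (\<lambda>w. c * f w)"
  "biannihilates L \<kk> (\<lambda>w. of_bool (w = []))" "biannihilates L \<kk> (\<lambda>w. 0)"
  by (simp_all add: biannihilates_def)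

lemma embedding_A_alg: "commutative_algebra_embedding (A_alg L \<kk>) (Sym_dual L \<aa>) (pullback L \<pp> \<aa>)"
proof -
  let ?N = "{f. U.word_functional f \<and> biannihilates L \<kk> f}"
  have "carrier (A_alg L \<kk>) = U.functional_of ` ?N"
    unfolding A_alg_carrier[OF lie] U_def U.linear_functionals_eq
    by (auto simp: U.word_values_functional_of)
  moreover have "algebra complex_field (env_dual L \<aa> zero_bracket\<lparr>carrier := carrier (env_dual L \<aa> zero_bracket)\<rparr>)"
    using A.algebra_env_dual[OF aa_odd] by simp
  ultimately have "commutative_algebra_embedding (env_dual L UNIV (bracket L)\<lparr>carrier := carrier (A_alg L \<kk>)\<rparr>)
    (env_dual L \<aa> zero_bracket\<lparr>carrier := carrier (env_dual L \<aa> zero_bracket)\<rparr>) (pullback L \<pp> \<aa>)"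
    using pullback_functional_of(1)
    by (intro pullback_embedding[where N = ?N])
      (auto simp: U.word_functional_shuffle U.word_functional_sum U.word_functional_smult U.word_functional_counit U.word_functional_zero biannihilates_closed
        biannihilates_shuffle A.carrier_env_dual)
  then show ?thesis by (simp add: A_alg_def U_dual_def Sym_dual_def)
qed

lemma embedding_A_finite:
  "commutative_algebra_embedding (A_finite L \<kk>) (Sym_finite_dual L \<aa>) (pullback L \<pp> \<aa>)"
proof -
  let ?N = "{f. U.word_functional f \<and> biannihilates L \<kk> f \<and> finitely_translated f}"
  have "carrier (A_finite L \<kk>) = U.functional_of ` ?N"
    unfolding A_finite_def A_alg_carrier[OF lie] U_def U.linear_functionals_eq U.finite_dual_eq
    by (auto simp: A_alg_carrier[OF lie] U_def U.linear_functionals_eq U.word_values_functional_of)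
  moreover have "algebra complex_field (env_dual L \<aa> zero_bracket\<lparr>carrier := finite_dual A.E\<rparr>)"
    by (rule A.algebra_finite_dual[OF A.algebra_env_dual[OF aa_odd]])
  moreover have "A.functional_of (restriction f) \<in> finite_dual A.E" if "f \<in> ?N" for f
    using pullback_functional_of(1)[of f] finitely_translated_restrict[of f A.S] that
    by (simp add: A.finite_dual_eq A.functional_of_linear A.word_values_functional_of restriction_def)
  ultimately have "commutative_algebra_embedding (env_dual L UNIV (bracket L)\<lparr>carrier := carrier (A_finite L \<kk>)\<rparr>)
    (env_dual L \<aa> zero_bracket\<lparr>carrier := finite_dual A.E\<rparr>) (pullback L \<pp> \<aa>)"
    by (intro pullback_embedding[where N = ?N])
      (auto simp: U.word_functional_shuffle U.word_functional_sum U.word_functional_smult U.word_functional_counit U.word_functional_zero biannihilates_closed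
        biannihilates_shuffle finitely_translated_zero finitely_translated_sum
        finitely_translated_scale finitely_translated_shuffle finitely_translated_counit)
  then show ?thesis by (simp add: A_finite_def A_alg_def U_dual_def Sym_finite_dual_def Sym_dual_def Sym_def)
qed

end

theorem theorem3p9:
  fixes L :: "'g::ab_group_add lie_super"
    and \<theta> :: "'g \<Rightarrow> 'g"
    and \<kk> \<pp> \<hh> \<tt> \<aa> :: "'g set"
  assumes "lie_superalgebra L"
    and "lie_involution L \<theta>"
    and "\<kk> = {x. \<theta> x = x}"
    and "\<pp> = {x. \<theta> x = - x}"
    and "lie_subalgebra L \<hh>"
    and "\<hh> \<subseteq> part L 0"
    and "\<theta> ` \<hh> = \<hh>"
    and "\<tt> = \<hh> \<inter> \<kk>"
    and "\<aa> = \<hh> \<inter> \<pp>"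
    and "ad_diagonalizable L \<hh>"
    and "centralizer_in L UNIV \<hh> = \<hh>"
    and "centralizer_in L \<pp> \<aa> = \<aa>"
  shows "commutative_algebra_embedding (A_alg L \<kk>) (Sym_dual L \<aa>) (pullback L \<pp> \<aa>)
    \<and> commutative_algebra_embedding (A_finite L \<kk>) (Sym_finite_dual L \<aa>) (pullback L \<pp> \<aa>)"
proof -
  interpret cartan_pair L \<theta> \<kk> \<pp> \<hh> \<aa>
    by (rule cartan_pair.intro) (fact assms)+
  show ?thesis using embedding_A_alg embedding_A_finite by blast
qed

end
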